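(* (Repulsive boundary) Let $\phi_b<0$, $\alpha\in[0,1]$, $f_b\in L^1(\mathbb{R}^3_+)$, and, for some $r>2$, $f_\infty\in L^1(\mathbb{R}^3)\cap L^r_{loc}(\mathbb{R};L^1(\mathbb{R}^2))$, with $f_b,f_\infty\ge0$. Let $V^-$ and $B^-$ be defined as in the context. Suppose that $\int_{\mathbb{R}^3}f_\infty(\xi)\,d\xi=1$, that $$f_\infty(\xi)=f_b\bigl(\sqrt{\xi_1^2+2\phi_b},\xi'\bigr)+\alpha f_\infty(-\xi_1,\xi'),\quad \xi\in(\sqrt{2|\phi_b|},\infty)\times\mathbb{R}^2,$$ $$f_\infty(\xi_1,\xi')=f_\infty(-\xi_1,\xi'),\quad \xi\in(-\sqrt{2|\phi_b|},\sqrt{2|\phi_b|})\times\mathbb{R}^2,$$ and that $V^-\in C^2([\phi_b,0])$. Let (VP) be the boundary value problem of the context. (i) Assume that $\frac{d^2V^-}{d\phi^2}(0)>0$. Then the set $B^-$ is not empty. Furthermore, if and only if $\phi_b>\inf B^-$ holds, the problem (VP) has a unique solution $(f,\phi)$. There also hold that $$|\partial_x^l\phi(x)|\le Ce^{-cx},\quad l=0,1,2,$$ where $c$ and $C$ are positive constants independent of $x$, and $$f(x,\xi)=f_\infty\bigl(-\sqrt{\xi_1^2-2\phi(x)},\xi'\bigr)\chi(-\xi_1)+f_\infty\bigl(\sqrt{\xi_1^2-2\phi(x)},\xi'\bigr)\chi(\xi_1).\qquad(\ast)$$ (ii) Assume that $\frac{d^2V^-}{d\phi^2}(0)=0$ and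 $B^-\ne\emptyset$. If and only if $\phi_b>\inf B^-$ holds, the problem (VP) has a unique solution $(f,\phi)$. Furthermore, $(\ast)$ holds. (iii) Assume that $\frac{d^2V^-}{d\phi^2}(0)=0$ and $B^-=\emptyset$. Then the problem (VP) admits no solution. (iv) Assume that $\frac{d^2V^-}{d\phi^2}(0)<0$. Then the problem (VP) admits no solution.
   Context: Notation: $\mathbb{R}_+=\{x>0\}$, $\overline{\mathbb{R}_+}=[0,\infty)$; $\xi=(\xi_1,\xi_2,\xi_3)=(\xi_1,\xi')\in\mathbb{R}^3$; $\mathbb{R}^3_+=\{\xi\in\mathbb{R}^3:\xi_1>0\}$. $\chi(s)$ is the one-dimensional indicator function of $\{s>0\}$; an expression multiplied by a vanishing $\chi$-factor is $0$. Equalities between $L^1$ functions are understood almost everywhere in $\xi$. $L^r_{loc}(\mathbb{R};L^1(\mathbb{R}^2))$ is the set of $f\in L^1_{loc}(\mathbb{R}^3)$ such that $\{\int_a^b(\int_{\mathbb{R}^2}|f(\xi_1,\xi')|\,d\xi')^r\,d\xi_1\}^{1/r}<\infty$ for all $-\infty<a<b<\infty$. Derivatives at endpoints are one-sided. The function $n_e\in C^2(\mathbb{R})$ is given with $n_e(0)=1$, $n_e'(0)=-1$. The problem (VP), with data $\alpha\in[0,1]$, $\phi_b\in\mathbb{R}$ and nonnegative functions $f_b$ on $\mathbb{R}^3_+$ and $f_\infty$ on $\mathbb{R}^3$, is to find $f=f(x,\xi)$, $\phi=\phi(x)$ with $$\xi_1\partial_xf+\partial_x\phi\,\partial_{\xi_1}f=0,\qquad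 \partial_{xx}\phi=\int_{\mathbb{R}^3}f\,d\xi-n_e(\phi),\qquad x>0,\ \xi\in\mathbb{R}^3,$$ $$f(0,\xi)=f_b(\xi)+\alpha f(0,-\xi_1,\xi')\ (\xi_1>0),\quad \phi(0)=\phi_b,\quad \lim_{x\to\infty}f(x,\xi)=f_\infty(\xi),\quad \lim_{x\to\infty}\phi(x)=0.$$ $(f,\phi)$ is called a solution of (VP) if: (1) $f\in L^1_{loc}(\overline{\mathbb{R}_+}\times\mathbb{R}^3)\cap C(\overline{\mathbb{R}_+};L^1(\mathbb{R}^3))$ and $\phi\in C^1(\overline{\mathbb{R}_+})\cap C^2(\mathbb{R}_+)$; (2) $f\ge0$, and either $\partial_x\phi(x)>0$ for all $x\in\overline{\mathbb{R}_+}$ or $\partial_x\phi(x)<0$ for all $x\in\overline{\mathbb{R}_+}$; (3) $(f,\xi_1\partial_x\psi+\partial_x\phi\,\partial_{\xi_1}\psi)_{L^2(\mathbb{R}_+\times\mathbb{R}^3)}+(f_b,\xi_1\psi(0,\cdot))_{L^2(\mathbb{R}^3_+)}=0$ for all $\psi\in\mathcal{X}$, where $\mathcal{X}=\{\psi\in C_0^1(\overline{\mathbb{R}_+}\times\mathbb{R}^3): \alpha\psi(0,\xi_1,\xi')=\psi(0,-\xi_1,\xi')\text{ for }(\xi_1,\xi')\in\mathbb{R}^3_+\}$ ($C^1$ functions with compact support in $\overline{\mathbb{R}_+}\times\mathbb{R}^3$), and $\lim_{x\to\infty}\|f(x,\cdot)-f_\infty\|_{L^1(\mathbb{R}^3)}=0$;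 (4) $\phi$ solves $\partial_{xx}\phi=\int_{\mathbb{R}^3}f\,d\xi-n_e(\phi)$ for $x>0$ with $\phi(0)=\phi_b$ and $\lim_{x\to\infty}\phi(x)=0$ in the classical sense. For $\phi\le0$, $$\rho_i^-(\phi):=\int_{\mathbb{R}^3}f_\infty(\xi)\frac{|\xi_1|}{\sqrt{\xi_1^2+2\phi}}\,\chi(\xi_1^2+2\phi)\,d\xi,\qquad V^-(\phi):=\int_0^\phi\bigl(\rho_i^-(\varphi)-n_e(\varphi)\bigr)\,d\varphi,$$ $$B^-:=\{\varphi<0:\ V^-(\phi)>0\ \text{for all }\phi\in[\varphi,0)\}$$ ($\inf B^-=-\infty$ is allowed). *)

theory Defs
  imports "HOL-Analysis.Analysis"
begin

text \<open>
  The velocity space is split as \<open>\<xi> = (\<xi>\<^sub>1, \<xi>')\<close>, with \<open>\<xi>\<^sub>1 = fst \<xi>\<close> and \<open>\<xi>' = snd \<xi>\<close>.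
  Elements of Lebesgue spaces are given by Borel representatives; conditions on them are imposed
  almost everywhere in \<open>\<xi>\<close>, so they do not depend on the representative.
\<close>

type_synonym vel = "real \<times> (real ^ 2)"

definition half_space :: "vel set" where
  "half_space = {\<xi>. fst \<xi> > 0}"

definition step :: "real \<Rightarrow> real" where
  "step s = indicator {0<..} s"


subsection \<open>Function spaces\<close>

text \<open>Derivative relative to \<open>S\<close>, hence one-sided at the endpoints of an interval \<open>S\<close>.\<close>

definition deriv_on :: "real set \<Rightarrow> (real \<Rightarrow> real) \<Rightarrow> real \<Rightarrow> real" where
  "deriv_on S g x = vector_derivative g (at x within S)"

primrec Ck_on :: "nat \<Rightarrow> real set \<Rightarrow> (real \<Rightarrow> real) \<Rightarrow> bool" where
  "Ck_on 0 S g \<longleftrightarrow> continuous_on S g"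
| "Ck_on (Suc k) S g \<longleftrightarrow> g differentiable_on S \<and> Ck_on k S (deriv_on S g)"

definition L1_loc :: "'a::euclidean_space set \<Rightarrow> ('a \<Rightarrow> real) \<Rightarrow> bool" where
  "L1_loc S g \<longleftrightarrow> (\<forall>K. compact K \<and> K \<subseteq> S \<longrightarrow> set_integrable lborel K g)"

text \<open>
  The space \<open>L\<^sup>r\<^sub>l\<^sub>o\<^sub>c(\<real>; L\<^sup>1(\<real>\<^sup>2))\<close>. The Bochner integral of a non-integrable function is \<open>0\<close>, so
  finiteness of the inner integral for almost every \<open>\<xi>\<^sub>1\<close> is required separately; with it, the
  last conjunct says that the iterated integral over \<open>[a, b]\<close> is finite (taking the \<open>r\<close>-th root
  does not affect finiteness).
\<close>

definition Lr_loc_L1 :: "real \<Rightarrow> (vel \<Rightarrow> real) \<Rightarrow> bool" where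
  "Lr_loc_L1 r g \<longleftrightarrow> L1_loc UNIV g \<and>
     (\<forall>a b. a < b \<longrightarrow>
        (AE \<xi>1 in lborel. \<xi>1 \<in> {a..b} \<longrightarrow> integrable lborel (\<lambda>\<xi>'. g (\<xi>1, \<xi>'))) \<and>
        set_integrable lborel {a..b} (\<lambda>\<xi>1. (\<integral>\<xi>'. \<bar>g (\<xi>1, \<xi>')\<bar> \<partial>lborel) powr r))"

definition C_L1 :: "(real \<Rightarrow> vel \<Rightarrow> real) \<Rightarrow> bool" where
  "C_L1 f \<longleftrightarrow> (\<forall>x\<ge>0. integrable lborel (f x)) \<and>
     (\<forall>x\<^sub>0\<ge>0. ((\<lambda>x. \<integral>\<xi>. \<bar>f x \<xi> - f x\<^sub>0 \<xi>\<bar> \<partial>lborel) \<longlongrightarrow> 0) (at x\<^sub>0 within {0..}))"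

text \<open>\<open>C\<^sup>1\<close> functions on \<open>[0,\<infinity>) \<times> \<real>\<^sup>3\<close> with compact support (which may meet \<open>x = 0\<close>).\<close>

definition C1_compact :: "(real \<times> vel \<Rightarrow> real) \<Rightarrow> bool" where
  "C1_compact \<psi> \<longleftrightarrow>
     (\<exists>\<psi>' :: real \<times> vel \<Rightarrow> (real \<times> vel) \<Rightarrow>\<^sub>L real.
        (\<forall>p \<in> {0..} \<times> UNIV.
           (\<psi> has_derivative blinfun_apply (\<psi>' p)) (at p within {0..} \<times> UNIV)) \<and>
        continuous_on ({0..} \<times> UNIV) \<psi>') \<and>
     (\<exists>K. compact K \<and> K \<subseteq> {0..} \<times> UNIV \<and> (\<forall>p \<in> {0..} \<times> UNIV - K. \<psi> p = 0))"

definition test_functions :: "real \<Rightarrow> (real \<times> vel \<Rightarrow> real) set" where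
  "test_functions \<alpha> = {\<psi>. C1_compact \<psi> \<and>
     (\<forall>\<xi>1>0. \<forall>\<xi>'. \<alpha> * \<psi> (0, \<xi>1, \<xi>') = \<psi> (0, - \<xi>1, \<xi>'))}"


subsection \<open>The boundary value problem\<close>

definition partial_x :: "(real \<times> vel \<Rightarrow> real) \<Rightarrow> real \<Rightarrow> vel \<Rightarrow> real" where
  "partial_x \<psi> x \<xi> = deriv_on {0..} (\<lambda>y. \<psi> (y, \<xi>)) x"

definition partial_\<xi>1 :: "(real \<times> vel \<Rightarrow> real) \<Rightarrow> real \<Rightarrow> vel \<Rightarrow> real" where
  "partial_\<xi>1 \<psi> x \<xi> = deriv_on UNIV (\<lambda>s. \<psi> (x, s, snd \<xi>)) (fst \<xi>)"

definition weak_Vlasov ::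
  "real \<Rightarrow> (vel \<Rightarrow> real) \<Rightarrow> (real \<Rightarrow> vel \<Rightarrow> real) \<Rightarrow> (real \<Rightarrow> real) \<Rightarrow> bool" where
  "weak_Vlasov \<alpha> f_b f \<phi> \<longleftrightarrow>
     (\<forall>\<psi> \<in> test_functions \<alpha>.
        (LINT p : {0<..} \<times> UNIV | lborel.
           (case p of (x, \<xi>) \<Rightarrow>
              f x \<xi> * (fst \<xi> * partial_x \<psi> x \<xi> + deriv_on {0..} \<phi> x * partial_\<xi>1 \<psi> x \<xi>)))
        + (LINT \<xi> : half_space | lborel. f_b \<xi> * (fst \<xi> * \<psi> (0, \<xi>))) = 0)"

definition VP_solution ::
  "(real \<Rightarrow> real) \<Rightarrow> real \<Rightarrow> real \<Rightarrow> (vel \<Rightarrow> real) \<Rightarrow> (vel \<Rightarrow> real) \<Rightarrow>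
     (real \<Rightarrow> vel \<Rightarrow> real) \<Rightarrow> (real \<Rightarrow> real) \<Rightarrow> bool" where
  "VP_solution n_e \<alpha> \<phi>_b f_b f_inf f \<phi> \<longleftrightarrow>
     \<comment> \<open>(1)\<close>
     L1_loc ({0..} \<times> UNIV) (\<lambda>(x, \<xi>). f x \<xi>) \<and> C_L1 f \<and>
     Ck_on 1 {0..} \<phi> \<and> Ck_on 2 {0<..} \<phi> \<and>
     \<comment> \<open>(2)\<close>
     (\<forall>x\<ge>0. AE \<xi> in lborel. f x \<xi> \<ge> 0) \<and>
     ((\<forall>x\<ge>0. deriv_on {0..} \<phi> x > 0) \<or> (\<forall>x\<ge>0. deriv_on {0..} \<phi> x < 0)) \<and>
     \<comment> \<open>(3)\<close>
     weak_Vlasov \<alpha> f_b f \<phi> \<and>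
     ((\<lambda>x. \<integral>\<xi>. \<bar>f x \<xi> - f_inf \<xi>\<bar> \<partial>lborel) \<longlongrightarrow> 0) at_top \<and>
     \<comment> \<open>(4)\<close>
     (\<forall>x>0. (deriv_on {0<..} ^^ 2) \<phi> x = (\<integral>\<xi>. f x \<xi> \<partial>lborel) - n_e (\<phi> x)) \<and>
     \<phi> 0 = \<phi>_b \<and> (\<phi> \<longlongrightarrow> 0) at_top"

definition same_solution ::
  "(real \<Rightarrow> vel \<Rightarrow> real) \<Rightarrow> (real \<Rightarrow> real) \<Rightarrow> (real \<Rightarrow> vel \<Rightarrow> real) \<Rightarrow> (real \<Rightarrow> real) \<Rightarrow> bool" where
  "same_solution f \<phi> g \<eta> \<longleftrightarrow>
     (\<forall>x\<ge>0. (AE \<xi> in lborel. f x \<xi> = g x \<xi>) \<and> \<phi> x = \<eta> x)"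

definition VP_unique_solution ::
  "(real \<Rightarrow> real) \<Rightarrow> real \<Rightarrow> real \<Rightarrow> (vel \<Rightarrow> real) \<Rightarrow> (vel \<Rightarrow> real) \<Rightarrow> bool" where
  "VP_unique_solution n_e \<alpha> \<phi>_b f_b f_inf \<longleftrightarrow>
     (\<exists>f \<phi>. VP_solution n_e \<alpha> \<phi>_b f_b f_inf f \<phi>) \<and>
     (\<forall>f \<phi> g \<eta>. VP_solution n_e \<alpha> \<phi>_b f_b f_inf f \<phi> \<longrightarrow> VP_solution n_e \<alpha> \<phi>_b f_b f_inf g \<eta> \<longrightarrow>
        same_solution f \<phi> g \<eta>)"


text \<open>
  The explicit formula for \<open>f\<close> in terms of \<open>\<phi> < 0\<close> and \<open>f_inf\<close>, obtained by following characteristics,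
  along which \<open>\<xi>\<^sub>1\<^sup>2/2 - \<phi>\<close> is conserved.
\<close>

definition characteristic_formula ::
  "(vel \<Rightarrow> real) \<Rightarrow> (real \<Rightarrow> vel \<Rightarrow> real) \<Rightarrow> (real \<Rightarrow> real) \<Rightarrow> bool" where
  "characteristic_formula f_inf f \<phi> \<longleftrightarrow>
     (\<forall>x\<ge>0. AE \<xi> in lborel.
        f x \<xi> = f_inf (- sqrt ((fst \<xi>)\<^sup>2 - 2 * \<phi> x), snd \<xi>) * step (- fst \<xi>)
              + f_inf (sqrt ((fst \<xi>)\<^sup>2 - 2 * \<phi> x), snd \<xi>) * step (fst \<xi>))"

definition exp_decay :: "(real \<Rightarrow> real) \<Rightarrow> bool" where
  "exp_decay \<phi> \<longleftrightarrow>
     (\<exists>c>0. \<exists>C>0. \<forall>l \<in> {0, 1, 2}. \<forall>x\<ge>0. \<bar>(deriv_on {0..} ^^ l) \<phi> x\<bar> \<le> C * exp (- c * x))"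


subsection \<open>Sagdeev potential\<close>

definition \<rho>_minus :: "(vel \<Rightarrow> real) \<Rightarrow> real \<Rightarrow> real" where
  "\<rho>_minus f_inf \<phi> =
     (\<integral>\<xi>. f_inf \<xi> * (\<bar>fst \<xi>\<bar> / sqrt ((fst \<xi>)\<^sup>2 + 2 * \<phi>)) * step ((fst \<xi>)\<^sup>2 + 2 * \<phi>) \<partial>lborel)"

text \<open>The interval integral is oriented: for \<open>\<phi> < 0\<close> it is minus the integral over \<open>[\<phi>, 0]\<close>.\<close>

definition V_minus :: "(real \<Rightarrow> real) \<Rightarrow> (vel \<Rightarrow> real) \<Rightarrow> real \<Rightarrow> real" where
  "V_minus n_e f_inf \<phi> = (LBINT t=0..ereal \<phi>. \<rho>_minus f_inf t - n_e t)"

definition B_minus :: "(real \<Rightarrow> real) \<Rightarrow> (vel \<Rightarrow> real) \<Rightarrow> real set" where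
  "B_minus n_e f_inf = {\<phi>. \<phi> < 0 \<and> (\<forall>t \<in> {\<phi>..<0}. V_minus n_e f_inf t > 0)}"

end

theory Submission
  imports Defs
begin

text \<open>
  \<^bold>\<open>The density is transported from infinity.\<close> The potential increases from \<open>\<phi>\<^sub>b < 0\<close> to \<open>0\<close>, so the
  energy \<open>\<xi>\<^sub>1\<^sup>2/2 - \<phi>(x)\<close>, which the Vlasov flow conserves, is positive on phase space, and along
  a characteristic either end that does not hit the wall runs off to infinity. A particle with velocity
  \<open>\<xi>\<^sub>1\<close> at \<open>x\<close> has velocity \<open>sgn \<xi>\<^sub>1 sqrt(\<xi>\<^sub>1\<^sup>2 - 2\<phi>(x))\<close> at infinity, and the data at infinity
  determine \<open>f\<close> at every point of phase space: this is the formula (\<ast>). For a weak solution it is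
  obtained by testing with functions of the energy that are cut off to one sign of \<open>\<xi>\<^sub>1\<close> and to a
  compact interval of \<open>x > 0\<close>: the corresponding moments of \<open>\<xi>\<^sub>1 f\<close> do not depend on \<open>x\<close>
  (\<open>moment_conserved\<close>), letting \<open>x \<rightarrow> \<infinity>\<close> identifies them (\<open>moment_identity\<close>), and they are rich
  enough to determine \<open>f(x, \<cdot>)\<close> (\<open>characteristic_AE\<close>).

  \<^bold>\<open>The potential solves an autonomous equation.\<close> Integrating (\<ast>) gives the density
  \<open>\<rho>\<^sup>-(\<phi>)\<close>, so \<open>\<phi>'' = V'(\<phi>)\<close> with the Sagdeev potential \<open>V = V\<^sup>-\<close>. The constant in the first
  integral is zero, since otherwise \<open>\<phi>'\<close> would stay away from zero, so
  \<open>\<phi>' = sqrt(2V(\<phi>))\<close> (\<open>energy_identity\<close>). As \<open>\<phi>\<close> runs through \<open>[\<phi>\<^sub>b, 0)\<close>, the potential \<open>V\<close> is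
  positive there. Conversely, if \<open>V > 0\<close> on \<open>[\<phi>\<^sub>b, 0)\<close>, the first order equation is solved by
  separation of variables; the solution is unique, and it exists for all \<open>x\<close> because
  \<open>V(\<phi>) = O(\<phi>\<^sup>2)\<close> makes the distance needed to reach \<open>0\<close> infinite (\<open>profile_unique\<close>,
  \<open>profile_exists\<close>). By continuity of \<open>V\<close> the condition \<open>V > 0\<close> on \<open>[\<phi>\<^sub>b, 0)\<close> is
  \<open>\<phi>\<^sub>b > inf B\<^sup>-\<close> (\<open>INF_B_minus_less_iff\<close>). Hence there is no solution if
  \<open>B\<^sup>-\<close> is empty. Since \<open>V(0) = V'(0) = 0\<close>, a nonzero \<open>V''(0)\<close> settles the sign of \<open>V\<close> near \<open>0\<close>: a
  negative one excludes solutions, and a positive one makes \<open>B\<^sup>-\<close> nonempty and provides the lower bound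
  \<open>V(\<phi>) \<ge> c\<phi>\<^sup>2\<close> that turns \<open>\<phi>' = sqrt(2V(\<phi>))\<close> into exponential decay.

  \<^bold>\<open>The transported density is a solution.\<close> Two points need work. First, \<open>f(x, \<cdot>)\<close> must depend
  continuously on \<open>x\<close> in \<open>L\<^sup>1\<close>, and \<open>\<rho>\<^sup>-\<close> must be continuous. Written in the velocity \<open>s\<close> at infinity,
  the integral of \<open>f(x, \<cdot>)\<close> carries the weight \<open>|s| / sqrt(s\<^sup>2 + 2\<phi>(x))\<close>, which is locally in
  \<open>L\<^sup>q\<close> exactly for \<open>q < 2\<close>; its singularity is controlled uniformly in \<open>x\<close> by the \<open>L\<^sup>r\<close> bound
  with \<open>r > 2\<close> (\<open>slow_particles_small\<close>). Second, in the weak formulation the same change of variables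
  followed by Fubini's theorem leaves, for each velocity at infinity, the integral of a derivative along
  one characteristic (\<open>integral_along_characteristic\<close>), that is, a boundary term at the wall or at
  the turning point. For particles that turn, the terms for \<open>s\<close> and \<open>-s\<close> cancel because \<open>f\<^sub>\<infinity>\<close> is
  even there; for particles that reach the wall, they add up to the incoming flux \<open>\<xi>\<^sub>1 f\<^sub>b\<close> (\<open>transported_weak\<close>).
\<close>

section \<open>Velocities at infinity\<close>

text \<open>
  Throughout, \<open>m\<close> stands for \<open>-2\<phi>(x) \<ge> 0\<close>. Conservation of \<open>\<xi>\<^sub>1\<^sup>2 + m\<close> turns the local velocity \<open>v\<close>
  at \<open>x\<close> into the velocity at infinity, with the same sign.
\<close>

definition vinf :: "real \<Rightarrow> real \<Rightarrow> real" where
  "vinf m v = sgn v * sqrt (v\<^sup>2 + m)"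

text \<open>
  The inverse of \<open>vinf m\<close>. For \<open>s\<^sup>2 < m\<close> a particle with velocity \<open>s\<close> at infinity does not reach
  \<open>x\<close>, and the value is meaningless.
\<close>

definition vloc :: "real \<Rightarrow> real \<Rightarrow> real" where
  "vloc m s = sgn s * sqrt (s\<^sup>2 - m)"

text \<open>
  The derivative of \<open>vloc m\<close>. The value \<open>0\<close> for \<open>s\<^sup>2 \<le> m\<close> makes every integral against \<open>jac m\<close>
  ignore the velocities at infinity for which \<open>vloc m\<close> is meaningless.
\<close>

definition jac :: "real \<Rightarrow> real \<Rightarrow> real" where
  "jac m s = (if m < s\<^sup>2 then \<bar>s\<bar> / sqrt (s\<^sup>2 - m) else 0)"

lemma jac_nonneg [simp]: "jac m s \<ge> 0"
  by (simp add: jac_def)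

lemma jac_minus [simp]: "jac m (- s) = jac m s"
  by (simp add: jac_def)

lemma vloc_minus [simp]: "vloc m (- s) = - vloc m s"
  by (simp add: vloc_def sgn_minus)

lemma vinf_vloc: "m \<ge> 0 \<Longrightarrow> m < s\<^sup>2 \<Longrightarrow> vinf m (vloc m s) = s"
  by (cases "s = 0") (auto simp: vinf_def vloc_def sgn_mult power_mult_distrib sgn_if abs_if)

lemma vloc_vinf: "m \<ge> 0 \<Longrightarrow> vloc m (vinf m v) = v"
proof (cases "v = 0")
  case False
  moreover assume "m \<ge> 0"
  ultimately have "v\<^sup>2 + m > 0" by (simp add: add_pos_nonneg)
  then show ?thesis
    by (auto simp: vinf_def vloc_def sgn_mult power_mult_distrib sgn_if abs_if)
qed (simp add: vinf_def vloc_def)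

lemma measurable_vinf [measurable (raw)]:
  assumes [measurable]: "f \<in> borel_measurable M" "g \<in> borel_measurable M"
  shows "(\<lambda>x. vinf (f x) (g x)) \<in> borel_measurable M"
  unfolding vinf_def by measurable

lemma measurable_vloc [measurable (raw)]:
  assumes [measurable]: "f \<in> borel_measurable M" "g \<in> borel_measurable M"
  shows "(\<lambda>x. vloc (f x) (g x)) \<in> borel_measurable M"
  unfolding vloc_def by measurable

lemma measurable_jac [measurable (raw)]:
  assumes [measurable]: "f \<in> borel_measurable M" "g \<in> borel_measurable M"
  shows "(\<lambda>x. jac (f x) (g x)) \<in> borel_measurable M"
  unfolding jac_def by measurable

lemma measurable_fst_borel [measurable]:
  "(fst :: 'a::second_countable_topology \<times> 'b::second_countable_topology \<Rightarrow> 'a) \<in> borel_measurable borel"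
  by (intro borel_measurable_continuous_onI continuous_intros)

lemma measurable_snd_borel [measurable]:
  "(snd :: 'a::second_countable_topology \<times> 'b::second_countable_topology \<Rightarrow> 'b) \<in> borel_measurable borel"
  by (intro borel_measurable_continuous_onI continuous_intros)

text \<open>
  The derivative of \<open>vloc m\<close> blows up at \<open>s = sqrt m\<close>, so the substitution is made with the inverse map
  \<open>vinf m\<close>, whose derivative stays bounded, on compact intervals that exhaust the half line.
\<close>

lemma nn_integral_vloc_pos:
  fixes H :: "real \<Rightarrow> ennreal"
  assumes m: "m \<ge> 0" and [measurable]: "H \<in> borel_measurable borel"
  shows "(\<integral>\<^sup>+v. H v * indicator {0<..} v \<partial>lborel)
       = (\<integral>\<^sup>+s. H (vloc m s) * jac m s * indicator {0<..} s \<partial>lborel)"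
proof -
  define g where "g v = sqrt (v\<^sup>2 + m)" for v
  define F where "F s = H (vloc m s) * ennreal (jac m s)" for s
  have [measurable]: "F \<in> borel_measurable borel" unfolding F_def by measurable
  \<comment> \<open>The shift by \<open>2\<close> makes the left end smaller than the right end for every \<open>n\<close>.\<close>
  define A where "A n = {1 / (real n + 2) .. real n + 2}" for n
  define B where "B n = {g (1 / (real n + 2)) .. g (real n + 2)}" for n
  have gmono: "g x \<le> g y" if "0 \<le> x" "x \<le> y" for x y
    using that by (simp add: g_def power_mono)
  have step: "(\<integral>\<^sup>+s. F s * indicator (B n) s \<partial>lborel) = (\<integral>\<^sup>+v. H v * indicator (A n) v \<partial>lborel)" for n
  proof -
    let ?a = "1 / (real n + 2)" and ?b = "real n + 2"
    have pos: "v > 0" if "v \<in> {?a..?b}" for v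
    proof -
      have "0 < ?a" by simp
      also have "?a \<le> v" using that by simp
      finally show ?thesis .
    qed
    have pos2: "v\<^sup>2 + m > 0" if "v \<in> {?a..?b}" for v
      using pos[OF that] m by (simp add: add_pos_nonneg)
    have "(\<integral>\<^sup>+s. F s * indicator {g ?a..g ?b} s \<partial>lborel)
        = (\<integral>\<^sup>+v. F (g v) * ennreal (v / sqrt (v\<^sup>2 + m)) * indicator {?a..?b} v \<partial>lborel)"
    proof (rule nn_integral_substitution_aux)
      show "(g has_real_derivative v / sqrt (v\<^sup>2 + m)) (at v)" if "v \<in> {?a..?b}" for v
        unfolding g_def using pos2[OF that]
        by (auto intro!: derivative_eq_intros simp: field_simps)
      show "continuous_on {?a..?b} (\<lambda>v. v / sqrt (v\<^sup>2 + m))"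
        using pos2 by (intro continuous_intros) force
      show "0 \<le> v / sqrt (v\<^sup>2 + m)" if "v \<in> {?a..?b}" for v
        using pos[OF that] m by simp
    next
      have "?a < 1" by simp
      also have "1 < ?b" by simp
      finally show "?a < ?b" .
    qed auto
    also have "\<dots> = (\<integral>\<^sup>+v. H v * indicator {?a..?b} v \<partial>lborel)"
    proof (intro nn_integral_cong)
      fix v
      show "F (g v) * ennreal (v / sqrt (v\<^sup>2 + m)) * indicator {?a..?b} v = H v * indicator {?a..?b} v"
      proof (cases "v \<in> {?a..?b}")
        case True
        note v = pos[OF True]
        have "g v = vinf m v" using v by (simp add: g_def vinf_def)
        then have 1: "vloc m (g v) = v" using m by (simp add: vloc_vinf)
        have "jac m (g v) = sqrt (v\<^sup>2 + m) / v"
          using v m by (simp add: jac_def g_def)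
        then have "ennreal (jac m (g v)) * ennreal (v / sqrt (v\<^sup>2 + m)) = 1"
          using v pos2[OF True] by (subst ennreal_mult[symmetric]) auto
        then show ?thesis using 1 by (simp add: F_def mult.assoc)
      qed simp
    qed
    finally show ?thesis by (simp add: A_def B_def)
  qed
  have a_dec: "1 / (real (Suc n) + 2) \<le> 1 / (real n + 2)" for n
    by (intro divide_left_mono) auto
  have incA: "incseq A"
    unfolding A_def using a_dec by (intro incseq_SucI atLeastatMost_subset_iff[THEN iffD2]) auto
  have incB: "incseq B"
    unfolding B_def using a_dec
    by (intro incseq_SucI atLeastatMost_subset_iff[THEN iffD2] disjI2 conjI gmono) auto
  have A_un: "(\<Union>n. A n) = {0<..}"
  proof (intro equalityI subsetI)
    fix v :: real assume v: "v \<in> {0<..}"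
    obtain k where k: "max v (1 / v) < real k" using reals_Archimedean2 by blast
    have "1 < v * real k" using k v by (simp add: field_simps)
    also have "\<dots> \<le> v * (real k + 2)" using v by simp
    finally have "v \<in> A k"
      using k v by (auto simp: A_def field_simps)
    then show "v \<in> (\<Union>n. A n)" by blast
  next
    fix v assume "v \<in> (\<Union>n. A n)"
    then obtain n where "1 / (real n + 2) \<le> v" by (auto simp: A_def)
    moreover have "0 < 1 / (real n + 2)" by simp
    ultimately have "0 < v" by (rule less_le_trans[rotated])
    then show "v \<in> {0<..}" by simp
  qed
  have B_un: "(\<Union>n. B n) = {sqrt m<..}"
  proof (intro equalityI subsetI)
    fix s assume "s \<in> {sqrt m<..}"
    then have s: "s > sqrt m" "s > 0" using m by (auto intro: le_less_trans[rotated])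
    then have s2: "s\<^sup>2 > m" by (meson not_le real_le_rsqrt)
    define v where "v = sqrt (s\<^sup>2 - m)"
    have v: "v > 0" "g v = s" using s2 s by (auto simp: v_def g_def)
    then have "v \<in> (\<Union>n. A n)" unfolding A_un by simp
    then obtain n where "v \<in> A n" by blast
    then have "s \<in> B n" unfolding A_def B_def v(2)[symmetric] using v(1) by (simp add: gmono)
    then show "s \<in> (\<Union>n. B n)" by blast
  next
    fix s assume "s \<in> (\<Union>n. B n)"
    then obtain n where "g (1 / (real n + 2)) \<le> s" by (auto simp: B_def)
    moreover have "sqrt m < g (1 / (real n + 2))" by (simp add: g_def)
    ultimately have "sqrt m < s" by (rule less_le_trans[rotated])
    then show "s \<in> {sqrt m<..}" by simp
  qed
  have "(\<integral>\<^sup>+v. H v * indicator {0<..} v \<partial>lborel) = emeasure (density lborel H) (\<Union>n. A n)"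
    by (simp add: A_un emeasure_density)
  also have "\<dots> = (SUP n. emeasure (density lborel H) (A n))"
    using incA by (subst SUP_emeasure_incseq) (auto simp: A_def)
  also have "\<dots> = (SUP n. emeasure (density lborel F) (B n))"
    using step by (subst (1 2) emeasure_density) (auto simp: A_def B_def)
  also have "\<dots> = emeasure (density lborel F) (\<Union>n. B n)"
    using incB by (subst SUP_emeasure_incseq) (auto simp: B_def)
  also have "\<dots> = (\<integral>\<^sup>+s. F s * indicator {sqrt m<..} s \<partial>lborel)"
    by (simp add: B_un emeasure_density)
  also have "\<dots> = (\<integral>\<^sup>+s. F s * indicator {0<..} s \<partial>lborel)"
  proof (intro nn_integral_cong)
    fix s
    have "m < s\<^sup>2 \<and> 0 < s \<longleftrightarrow> sqrt m < s"
    proof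
      assume "m < s\<^sup>2 \<and> 0 < s"
      then have "sqrt m < sqrt (s\<^sup>2)" "0 < s" by (simp_all only: real_sqrt_less_iff)
      then show "sqrt m < s" by simp
    next
      assume s: "sqrt m < s"
      moreover have "0 \<le> sqrt m" using m by simp
      ultimately have "0 < s" "(sqrt m)\<^sup>2 < s\<^sup>2"
        by (linarith, intro power_strict_mono, simp_all)
      then show "m < s\<^sup>2 \<and> 0 < s" using m by simp
    qed
    then show "F s * indicator {sqrt m<..} s = F s * indicator {0<..} s"
      by (auto simp: F_def jac_def split: split_indicator)
  qed
  finally show ?thesis by (simp add: F_def)
qed

lemma nn_integral_split_sign:
  fixes H :: "real \<Rightarrow> ennreal"
  assumes [measurable]: "H \<in> borel_measurable borel"
  shows "(\<integral>\<^sup>+v. H v \<partial>lborel) = (\<integral>\<^sup>+v. H v * indicator {0<..} v \<partial>lborel)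
     + (\<integral>\<^sup>+v. H (- v) * indicator {0<..} v \<partial>lborel)"
proof -
  have "(\<integral>\<^sup>+v. H v \<partial>lborel) = (\<integral>\<^sup>+v. H v * indicator {0<..} v + H v * indicator {..<0} v \<partial>lborel)"
    using AE_lborel_singleton[of 0]
    by (intro nn_integral_cong_AE) (auto elim!: eventually_mono split: split_indicator)
  also have "\<dots> = (\<integral>\<^sup>+v. H v * indicator {0<..} v \<partial>lborel) + (\<integral>\<^sup>+v. H v * indicator {..<0} v \<partial>lborel)"
    by (intro nn_integral_add) auto
  also have "(\<integral>\<^sup>+v. H v * indicator {..<0} v \<partial>lborel) = (\<integral>\<^sup>+v. H (- v) * indicator {0<..} v \<partial>lborel)"
    by (subst nn_integral_real_affine[where c = "-1" and t = 0])
       (auto intro!: nn_integral_cong split: split_indicator)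
  finally show ?thesis .
qed

lemma nn_integral_vloc:
  fixes H :: "real \<Rightarrow> ennreal"
  assumes m: "m \<ge> 0" and [measurable]: "H \<in> borel_measurable borel"
  shows "(\<integral>\<^sup>+v. H v \<partial>lborel) = (\<integral>\<^sup>+s. H (vloc m s) * jac m s \<partial>lborel)"
proof -
  have "(\<integral>\<^sup>+v. H (- v) * indicator {0<..} v \<partial>lborel)
      = (\<integral>\<^sup>+s. H (- vloc m s) * jac m s * indicator {0<..} s \<partial>lborel)"
    by (rule nn_integral_vloc_pos[OF m, of "\<lambda>v. H (- v)"]) simp
  then show ?thesis
    by (simp add: nn_integral_split_sign[of H] nn_integral_vloc_pos[OF m, of H]
          nn_integral_split_sign[of "\<lambda>s. H (vloc m s) * ennreal (jac m s)"])
qed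

definition vel_inf :: "real \<Rightarrow> vel \<Rightarrow> vel" where
  "vel_inf m \<xi> = (vinf m (fst \<xi>), snd \<xi>)"

definition vel_loc :: "real \<Rightarrow> vel \<Rightarrow> vel" where
  "vel_loc m \<zeta> = (vloc m (fst \<zeta>), snd \<zeta>)"

lemma measurable_vel_inf [measurable (raw)]:
  assumes [measurable]: "f \<in> borel_measurable M" "g \<in> borel_measurable M"
  shows "(\<lambda>x. vel_inf (f x) (g x)) \<in> borel_measurable M"
  unfolding vel_inf_def borel_prod[symmetric] by measurable

lemma measurable_vel_loc [measurable (raw)]:
  assumes [measurable]: "f \<in> borel_measurable M" "g \<in> borel_measurable M"
  shows "(\<lambda>x. vel_loc (f x) (g x)) \<in> borel_measurable M"
  unfolding vel_loc_def borel_prod[symmetric] by measurable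

lemma nn_integral_vel_loc:
  fixes H :: "vel \<Rightarrow> ennreal"
  assumes m: "m \<ge> 0" and [measurable]: "H \<in> borel_measurable borel"
  shows "(\<integral>\<^sup>+\<xi>. H \<xi> \<partial>lborel) = (\<integral>\<^sup>+\<zeta>. H (vel_loc m \<zeta>) * jac m (fst \<zeta>) \<partial>lborel)"
proof -
  have [measurable]: "H \<in> borel_measurable (lborel \<Otimes>\<^sub>M lborel)"
    by (simp add: lborel_prod)
  have [measurable]: "(\<lambda>\<zeta>. H (vel_loc m \<zeta>) * jac m (fst \<zeta>)) \<in> borel_measurable (lborel \<Otimes>\<^sub>M lborel)"
    by (simp add: lborel_prod)
  have "(\<integral>\<^sup>+\<xi>. H \<xi> \<partial>lborel) = (\<integral>\<^sup>+y. \<integral>\<^sup>+x. H (x, y) \<partial>lborel \<partial>lborel)"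
    by (subst lborel_pair.nn_integral_snd) (simp_all add: lborel_prod)
  also have "\<dots> = (\<integral>\<^sup>+y. \<integral>\<^sup>+x. H (vloc m x, y) * jac m x \<partial>lborel \<partial>lborel)"
    by (intro nn_integral_cong nn_integral_vloc m) measurable
  also have "\<dots> = (\<integral>\<^sup>+\<zeta>. H (vel_loc m \<zeta>) * jac m (fst \<zeta>) \<partial>lborel)"
    using lborel_pair.nn_integral_snd[of "\<lambda>\<zeta>. H (vel_loc m \<zeta>) * jac m (fst \<zeta>)"]
    by (simp add: lborel_prod vel_loc_def)
  finally show ?thesis .
qed

lemma distr_vel_loc:
  assumes m: "m \<ge> 0"
  shows "lborel = distr (density lborel (\<lambda>\<zeta>. ennreal (jac m (fst \<zeta>)))) borel (vel_loc m)"
proof (rule measure_eqI)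
  fix A :: "vel set" assume "A \<in> sets lborel"
  then have [measurable]: "A \<in> sets borel" by simp
  have "emeasure lborel A = (\<integral>\<^sup>+\<xi>. indicator A \<xi> \<partial>lborel)" by simp
  also have "\<dots> = (\<integral>\<^sup>+\<zeta>. indicator A (vel_loc m \<zeta>) * ennreal (jac m (fst \<zeta>)) \<partial>lborel)"
    by (rule nn_integral_vel_loc[OF m]) auto
  also have "\<dots> = emeasure (distr (density lborel (\<lambda>\<zeta>. ennreal (jac m (fst \<zeta>)))) borel (vel_loc m)) A"
  proof -
    have "emeasure (distr (density lborel (\<lambda>\<zeta>. ennreal (jac m (fst \<zeta>)))) borel (vel_loc m)) A
        = (\<integral>\<^sup>+\<zeta>. ennreal (jac m (fst \<zeta>)) * indicator (vel_loc m -` A) \<zeta> \<partial>lborel)"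
      using measurable_sets_borel[of "vel_loc m" borel A]
      by (subst emeasure_distr) (simp_all add: emeasure_density)
    also have "\<dots> = (\<integral>\<^sup>+\<zeta>. indicator A (vel_loc m \<zeta>) * ennreal (jac m (fst \<zeta>)) \<partial>lborel)"
      by (intro nn_integral_cong) (simp add: indicator_vimage mult.commute)
    finally show ?thesis ..
  qed
  finally show "emeasure lborel A = \<dots>" .
qed simp

text \<open>
  The substitution holds for signed functions as well, because it identifies Lebesgue measure with an
  image of the measure with density \<open>jac m\<close>.
\<close>

lemma integrable_vel_loc:
  fixes h :: "vel \<Rightarrow> real"
  assumes m: "m \<ge> 0" and [measurable]: "h \<in> borel_measurable borel"
  shows "integrable lborel h \<longleftrightarrow> integrable lborel (\<lambda>\<zeta>. jac m (fst \<zeta>) * h (vel_loc m \<zeta>))"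
    and "(\<integral>\<xi>. h \<xi> \<partial>lborel) = (\<integral>\<zeta>. jac m (fst \<zeta>) * h (vel_loc m \<zeta>) \<partial>lborel)"
proof -
  show "integrable lborel h \<longleftrightarrow> integrable lborel (\<lambda>\<zeta>. jac m (fst \<zeta>) * h (vel_loc m \<zeta>))"
    by (subst distr_vel_loc[OF m], subst integrable_distr_eq) (simp_all add: integrable_density)
  show "(\<integral>\<xi>. h \<xi> \<partial>lborel) = (\<integral>\<zeta>. jac m (fst \<zeta>) * h (vel_loc m \<zeta>) \<partial>lborel)"
    by (subst distr_vel_loc[OF m], subst integral_distr) (simp_all add: integral_density)
qed

lemma vel_inf_loc: "m \<ge> 0 \<Longrightarrow> m < (fst \<zeta>)\<^sup>2 \<Longrightarrow> vel_inf m (vel_loc m \<zeta>) = \<zeta>"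
  by (simp add: vel_inf_def vel_loc_def vinf_vloc)

lemma vel_inf_0 [simp]: "vel_inf 0 \<xi> = \<xi>"
  by (simp add: vel_inf_def vinf_def sgn_if abs_if prod_eq_iff)

lemma nn_integral_comp_vel_inf:
  fixes H :: "vel \<Rightarrow> ennreal"
  assumes m: "m \<ge> 0" and [measurable]: "H \<in> borel_measurable borel"
  shows "(\<integral>\<^sup>+\<xi>. H (vel_inf m \<xi>) \<partial>lborel) = (\<integral>\<^sup>+\<zeta>. H \<zeta> * jac m (fst \<zeta>) \<partial>lborel)"
proof -
  have "(\<integral>\<^sup>+\<xi>. H (vel_inf m \<xi>) \<partial>lborel)
      = (\<integral>\<^sup>+\<zeta>. H (vel_inf m (vel_loc m \<zeta>)) * jac m (fst \<zeta>) \<partial>lborel)"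
    by (rule nn_integral_vel_loc[OF m]) measurable
  also have "\<dots> = (\<integral>\<^sup>+\<zeta>. H \<zeta> * jac m (fst \<zeta>) \<partial>lborel)"
  proof (rule nn_integral_cong)
    fix \<zeta> :: vel
    show "H (vel_inf m (vel_loc m \<zeta>)) * jac m (fst \<zeta>) = H \<zeta> * jac m (fst \<zeta>)"
      by (cases "m < (fst \<zeta>)\<^sup>2") (simp_all add: vel_inf_loc[OF m] jac_def)
  qed
  finally show ?thesis .
qed

text \<open>
  The image of Lebesgue measure under \<open>vel_inf m\<close> has a density, so null sets pull back to null sets, and
  composition with \<open>vel_inf m\<close> does not depend on the representative.
\<close>

lemma AE_comp_vel_inf:
  assumes m: "m \<ge> 0" and "AE \<zeta> in lborel. P \<zeta>"
  shows "AE \<xi> in lborel. P (vel_inf m \<xi>)"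
proof -
  from AE_E[OF assms(2)] obtain N where N:
    "{\<zeta> \<in> space lborel. \<not> P \<zeta>} \<subseteq> N" "emeasure lborel N = 0" "N \<in> sets lborel" .
  then have [measurable]: "N \<in> sets borel" by simp
  have "(\<integral>\<^sup>+\<xi>. indicator N (vel_inf m \<xi>) \<partial>lborel) = (\<integral>\<^sup>+\<zeta>. indicator N \<zeta> * ennreal (jac m (fst \<zeta>)) \<partial>lborel)"
    by (rule nn_integral_comp_vel_inf[OF m]) simp
  also have "\<dots> = 0"
    using N by (subst nn_integral_0_iff_AE) (auto intro!: AE_I[of _ _ N] split: split_indicator)
  finally have "AE \<xi> in lborel. indicator N (vel_inf m \<xi>) = (0::ennreal)"
    by (subst (asm) nn_integral_0_iff_AE) auto
  then show ?thesis
    by eventually_elim (use N(1) in \<open>auto split: split_indicator_asm\<close>)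
qed

section \<open>Slow particles\<close>

text \<open>
  A weighted Young inequality obtained by comparing \<open>F\<^bsup>r-1\<^esup>\<close> with \<open>M k\<close>. A large \<open>M\<close>
  makes the first term small; for \<open>r > 2\<close> and \<open>k = jac m\<close> the exponent \<open>1/(r - 1) < 1\<close> keeps the second one
  locally integrable.
\<close>

lemma mult_le_powr_split:
  fixes F k M r :: real
  assumes "r > 1" "F \<ge> 0" "k \<ge> 0" "M > 0"
  shows "F * k \<le> F powr r / M + k * (M * k) powr (1 / (r - 1))"
proof (cases "M * k \<le> F powr (r - 1)")
  case True
  have "F * k = F * (M * k) / M" using assms by simp
  also have "\<dots> \<le> F * F powr (r - 1) / M"
    using True assms by (intro divide_right_mono mult_left_mono) auto
  also have "F * F powr (r - 1) = F powr r"
    using assms by (cases "F = 0") (auto simp: powr_mult_base)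
  finally show ?thesis using assms by (smt (verit) mult_nonneg_nonneg powr_ge_zero)
next
  case False
  then have "(F powr (r - 1)) powr (1 / (r - 1)) \<le> (M * k) powr (1 / (r - 1))"
    using assms by (intro powr_mono2) auto
  then have "F \<le> (M * k) powr (1 / (r - 1))"
    using assms by (simp add: powr_powr)
  then have "F * k \<le> (M * k) powr (1 / (r - 1)) * k"
    using assms by (intro mult_right_mono) auto
  moreover have "0 \<le> F powr r / M" using assms by simp
  ultimately show ?thesis by (simp add: mult.commute)
qed

lemma nn_integral_powr_near_0:
  fixes q d :: real
  assumes "0 < q" "q < 1" "d > 0"
  shows "(\<integral>\<^sup>+v. ennreal (\<bar>v\<bar> powr (- q)) * indicator {v. \<bar>v\<bar> < d} v \<partial>lborel)
     \<le> ennreal (2 * (d powr (1 - q) / (1 - q)))"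
proof -
  have "((\<lambda>x. x powr (- q)) has_integral (d powr (- q + 1) / (- q + 1))) {0..d}"
    using assms by (intro has_integral_powr_from_0) auto
  then have I: "(\<integral>\<^sup>+v. ennreal (v powr (- q)) * indicator {0..d} v \<partial>lborel) = ennreal (d powr (1 - q) / (1 - q))"
    by (subst nn_integral_has_integral_lebesgue'[where I = "d powr (1 - q) / (1 - q)"]) (auto simp: add.commute)
  have half: "(\<integral>\<^sup>+v. ennreal (\<bar>v\<bar> powr (- q)) * indicator {v. \<bar>v\<bar> < d} v * indicator {0<..} v \<partial>lborel)
     \<le> ennreal (d powr (1 - q) / (1 - q))"
    unfolding I[symmetric] by (intro nn_integral_mono) (auto split: split_indicator)
  have "(\<integral>\<^sup>+v. ennreal (\<bar>v\<bar> powr (- q)) * indicator {v. \<bar>v\<bar> < d} v \<partial>lborel)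
     \<le> ennreal (d powr (1 - q) / (1 - q)) + ennreal (d powr (1 - q) / (1 - q))"
    using half by (subst nn_integral_split_sign) (auto intro!: add_mono simp: indicator_def)
  also have "\<dots> = ennreal (2 * (d powr (1 - q) / (1 - q)))"
    using assms by (subst ennreal_plus[symmetric]) auto
  finally show ?thesis .
qed

lemma jac_vinf: "m \<ge> 0 \<Longrightarrow> v \<noteq> 0 \<Longrightarrow> jac m (vinf m v) = sqrt (v\<^sup>2 + m) / \<bar>v\<bar>"
  by (auto simp: jac_def vinf_def power_mult_distrib sgn_if abs_mult abs_of_nonneg)

text \<open>
  This is where \<open>r > 2\<close> enters. In the velocity at infinity the left-hand side is the integral of
  \<open>F(s) jac m s\<close>, with \<open>F\<close> the partial \<open>L\<^sup>1\<close> norm of \<open>f\<close>, over the particles that are slow at \<open>x\<close>.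
  The preceding inequality bounds it by \<open>\<integral>F\<^sup>r / M\<close> plus an integral which, back in the local velocity
  \<open>v\<close>, is at most a constant times \<open>\<integral>|v|\<^bsup>-q\<^esup>\<close> with \<open>q = 1/(r - 1) < 1\<close>. All bounds are uniform in
  \<open>m\<close>, which is what makes them useful.
\<close>

lemma slow_particles_small:
  fixes f :: "vel \<Rightarrow> real"
  assumes r: "r > 2" and f: "integrable lborel f" "Lr_loc_L1 r f" and R: "R \<ge> 0" and e: "e > 0"
  shows "\<exists>\<delta>>0. \<forall>m\<in>{0..R}.
    (\<integral>\<^sup>+\<xi>. ennreal \<bar>f (vel_inf m \<xi>)\<bar> * indicator {\<xi>. \<bar>fst \<xi>\<bar> < \<delta>} \<xi> \<partial>lborel) \<le> ennreal e"
proof -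
  have [measurable]: "f \<in> borel_measurable borel" using f(1) by auto
  have fp[measurable]: "f \<in> borel_measurable (lborel \<Otimes>\<^sub>M lborel)" by (simp add: lborel_prod)
  have [measurable]: "(\<lambda>p. f (fst p, snd p)) \<in> borel_measurable (lborel \<Otimes>\<^sub>M lborel)" by simp
  define q where "q = 1 / (r - 1)"
  have q: "0 < q" "q < 1" using r by (auto simp: q_def)
  define b where "b = 1 + R"
  have b: "b > 0" "sqrt (1 + R) \<le> b"
    using R by (auto simp: b_def intro!: real_le_lsqrt simp: power2_eq_square algebra_simps)
  have bb: "- b < b" using b by simp
  define F where "F s = (\<integral>\<^sup>+y. ennreal \<bar>f (s, y)\<bar> \<partial>lborel)" for s
  define G where "G s = (\<integral>y. \<bar>f (s, y)\<bar> \<partial>lborel)" for s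
  have [measurable]: "F \<in> borel_measurable borel" unfolding F_def by measurable
  have G0: "G s \<ge> 0" for s by (simp add: G_def)
  have FG: "AE s in lborel. s \<in> {-b..b} \<longrightarrow> F s = ennreal (G s)"
  proof -
    have "AE s in lborel. s \<in> {-b..b} \<longrightarrow> integrable lborel (\<lambda>y. f (s, y))"
      using f(2) bb unfolding Lr_loc_L1_def by blast
    then show ?thesis
      by eventually_elim (auto simp: F_def G_def nn_integral_eq_integral)
  qed
  have Gint: "set_integrable lborel {-b..b} (\<lambda>s. G s powr r)"
    using f(2) bb unfolding Lr_loc_L1_def G_def by blast
  define A where "A = (\<integral>s\<in>{-b..b}. G s powr r \<partial>lborel)"
  have A: "(\<integral>\<^sup>+s. ennreal (indicator {-b..b} s * G s powr r) \<partial>lborel) = ennreal A" "A \<ge> 0"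
    using Gint unfolding A_def set_integrable_def set_lebesgue_integral_def
    by (auto intro!: nn_integral_eq_integral)
  \<comment> \<open>The choice of \<open>M\<close> makes the first term of the splitting at most \<open>e/2\<close>; the choice of \<open>\<delta>\<close> does the same for the second.\<close>
  define M where "M = 2 * (A + 1) / e"
  have M: "M > 0" "A / M \<le> e / 2" using A(2) e by (auto simp: M_def field_simps)
  define C where "C = 2 * (M * b) powr q / (1 - q)"
  have C: "C > 0" using q M b by (simp add: C_def)
  define \<delta> where "\<delta> = min 1 ((e / (2 * C)) powr (1 / (1 - q)))"
  have \<delta>: "\<delta> > 0" "\<delta> \<le> 1" using e C by (auto simp: \<delta>_def)
  have "\<delta> powr (1 - q) \<le> ((e / (2 * C)) powr (1 / (1 - q))) powr (1 - q)"
    using \<delta> q by (intro powr_mono2) (auto simp: \<delta>_def)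
  also have "\<dots> = e / (2 * C)" using q e C by (simp add: powr_powr)
  finally have \<delta>C: "C * \<delta> powr (1 - q) \<le> e / 2" using C by (simp add: field_simps)
  show ?thesis
  proof (intro exI[of _ \<delta>] conjI ballI \<delta>(1))
    fix m assume "m \<in> {0..R}"
    then have m: "m \<ge> 0" "m \<le> R" by auto
    let ?I = "\<lambda>v. indicator {v. \<bar>v\<bar> < \<delta>} v :: ennreal"
    have "(\<integral>\<^sup>+\<xi>. ennreal \<bar>f (vel_inf m \<xi>)\<bar> * indicator {\<xi>. \<bar>fst \<xi>\<bar> < \<delta>} \<xi> \<partial>lborel)
        = (\<integral>\<^sup>+\<xi>. ennreal \<bar>f (vel_inf m \<xi>)\<bar> * ?I (fst \<xi>) \<partial>(lborel \<Otimes>\<^sub>M lborel))"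
      by (simp add: lborel_prod indicator_def)
    also have "\<dots> = (\<integral>\<^sup>+v. \<integral>\<^sup>+y. ennreal \<bar>f (vinf m v, y)\<bar> * ?I v \<partial>lborel \<partial>lborel)"
    proof -
      have "(\<lambda>\<xi>. ennreal \<bar>f (vel_inf m \<xi>)\<bar> * ?I (fst \<xi>)) \<in> borel_measurable (lborel \<Otimes>\<^sub>M lborel)"
        unfolding lborel_prod by simp
      from lborel.nn_integral_fst[OF this] show ?thesis by (simp add: vel_inf_def)
    qed
    also have "\<dots> = (\<integral>\<^sup>+v. F (vinf m v) * ?I v \<partial>lborel)"
      unfolding F_def by (intro nn_integral_cong) (simp add: nn_integral_multc)
    also have "\<dots> = (\<integral>\<^sup>+s. F (vinf m (vloc m s)) * ?I (vloc m s) * jac m s \<partial>lborel)"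
      by (rule nn_integral_vloc[OF m(1)]) measurable
    also have "\<dots> \<le> (\<integral>\<^sup>+s. ennreal (1 / M) * ennreal (indicator {-b..b} s * G s powr r)
        + ennreal ((M * jac m s) powr q) * ?I (vloc m s) * ennreal (jac m s) \<partial>lborel)"
    proof (intro nn_integral_mono_AE)
      show "AE s in lborel. F (vinf m (vloc m s)) * ?I (vloc m s) * jac m s
        \<le> ennreal (1 / M) * ennreal (indicator {-b..b} s * G s powr r)
          + ennreal ((M * jac m s) powr q) * ?I (vloc m s) * ennreal (jac m s)"
        using FG
      proof eventually_elim
        case (elim s)
        show ?case
        proof (cases "m < s\<^sup>2 \<and> \<bar>vloc m s\<bar> < \<delta>")
          case True
          have "\<bar>vloc m s\<bar> = sqrt (s\<^sup>2 - m)"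
            using True m by (auto simp: vloc_def abs_mult abs_sgn_eq)
          then have "sqrt (s\<^sup>2 - m) < 1" using True \<delta> by linarith
          then have "s\<^sup>2 - m < 1" by (simp only: real_sqrt_lt_1_iff)
          then have "sqrt (s\<^sup>2) \<le> sqrt (1 + R)" using m by (intro real_sqrt_le_mono) simp
          then have "\<bar>s\<bar> \<le> b" using b by simp
          then have s: "s \<in> {-b..b}" by auto
          have "F (vinf m (vloc m s)) * ?I (vloc m s) * jac m s = ennreal (G s * jac m s)"
            using True s elim m G0 by (simp add: vinf_vloc ennreal_mult)
          also have "\<dots> \<le> ennreal (G s powr r / M + jac m s * (M * jac m s) powr q)"
            unfolding q_def using M G0 r by (intro ennreal_leI mult_le_powr_split) auto
          also have "\<dots> = ennreal (1 / M) * ennreal (indicator {-b..b} s * G s powr r)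
              + ennreal ((M * jac m s) powr q) * ?I (vloc m s) * ennreal (jac m s)"
            using True s M by (simp add: ennreal_plus ennreal_mult[symmetric] mult.commute)
          finally show ?thesis .
        next
          case False
          then have "F (vinf m (vloc m s)) * ?I (vloc m s) * jac m s = 0" by (auto simp: jac_def)
          then show ?thesis by (metis zero_le)
        qed
      qed
    qed
    also have "\<dots> = ennreal (1 / M) * ennreal A
        + (\<integral>\<^sup>+s. ennreal ((M * jac m s) powr q) * ?I (vloc m s) * ennreal (jac m s) \<partial>lborel)"
    proof -
      have "(\<lambda>s. indicator {-b..b} s * G s powr r) \<in> borel_measurable borel"
        using Gint unfolding set_integrable_def by (auto simp: mult.commute)
      then show ?thesis
        using A(1) by (subst nn_integral_add) (auto simp: nn_integral_cmult)
    qed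
    also have "(\<integral>\<^sup>+s. ennreal ((M * jac m s) powr q) * ?I (vloc m s) * ennreal (jac m s) \<partial>lborel)
        = (\<integral>\<^sup>+s. ennreal ((M * jac m (vinf m (vloc m s))) powr q) * ?I (vloc m s) * ennreal (jac m s) \<partial>lborel)"
    proof (rule nn_integral_cong)
      fix s show "ennreal ((M * jac m s) powr q) * ?I (vloc m s) * ennreal (jac m s)
        = ennreal ((M * jac m (vinf m (vloc m s))) powr q) * ?I (vloc m s) * ennreal (jac m s)"
        using m by (cases "m < s\<^sup>2") (simp_all add: vinf_vloc jac_def)
    qed
    also have "\<dots> = (\<integral>\<^sup>+v. ennreal ((M * jac m (vinf m v)) powr q) * ?I v \<partial>lborel)"
      by (rule nn_integral_vloc[OF m(1), symmetric]) measurable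
    also have "\<dots> \<le> (\<integral>\<^sup>+v. ennreal ((M * b) powr q) * (ennreal (\<bar>v\<bar> powr (- q)) * ?I v) \<partial>lborel)"
    proof (intro nn_integral_mono_AE)
      show "AE v in lborel. ennreal ((M * jac m (vinf m v)) powr q) * ?I v
          \<le> ennreal ((M * b) powr q) * (ennreal (\<bar>v\<bar> powr (- q)) * ?I v)"
        using AE_lborel_singleton[of 0]
      proof eventually_elim
        case (elim v)
        show ?case
        proof (cases "\<bar>v\<bar> < \<delta>")
          case True
          have "\<bar>v\<bar>\<^sup>2 \<le> 1" using True \<delta> by (intro power_le_one) auto
          then have "sqrt (v\<^sup>2 + m) \<le> sqrt (1 + R)" using m by (intro real_sqrt_le_mono) auto
          then have "jac m (vinf m v) \<le> b / \<bar>v\<bar>"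
            unfolding jac_vinf[OF m(1) elim] using b by (intro divide_right_mono) linarith+
          then have "M * jac m (vinf m v) \<le> M * (b / \<bar>v\<bar>)"
            using M by (intro mult_left_mono) auto
          then have "(M * jac m (vinf m v)) powr q \<le> (M * b / \<bar>v\<bar>) powr q"
            using M q by (intro powr_mono2) auto
          also have "\<dots> = (M * b) powr q * \<bar>v\<bar> powr (- q)"
            using M b by (simp add: powr_divide powr_minus_divide)
          finally show ?thesis using True by (simp add: ennreal_mult[symmetric] ennreal_leI)
        qed simp
      qed
    qed
    also have "\<dots> = ennreal ((M * b) powr q) * (\<integral>\<^sup>+v. ennreal (\<bar>v\<bar> powr (- q)) * ?I v \<partial>lborel)"
      by (rule nn_integral_cmult) measurable
    also have "\<dots> \<le> ennreal ((M * b) powr q) * ennreal (2 * (\<delta> powr (1 - q) / (1 - q)))"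
      using nn_integral_powr_near_0[OF q \<delta>(1)] by (intro mult_left_mono) auto
    also have "\<dots> = ennreal (C * \<delta> powr (1 - q))"
      using q by (simp add: C_def ennreal_mult[symmetric] field_simps)
    also have "\<dots> \<le> ennreal (e / 2)" using \<delta>C by (rule ennreal_leI)
    also have "ennreal (1 / M) * ennreal A \<le> ennreal (e / 2)"
      using M A(2) by (simp add: ennreal_mult[symmetric] ennreal_leI)
    also have "ennreal (e / 2) + ennreal (e / 2) = ennreal e"
      using e by (subst ennreal_plus[symmetric]) auto
    finally show "(\<integral>\<^sup>+\<xi>. ennreal \<bar>f (vel_inf m \<xi>)\<bar> * indicator {\<xi>. \<bar>fst \<xi>\<bar> < \<delta>} \<xi> \<partial>lborel) \<le> ennreal e"
      by (simp add: add_mono)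
  qed
qed

section \<open>Continuity in the mean of the transported density\<close>

text \<open>
  For the indicator of a set of finite measure, take an open superset \<open>U\<close> of almost the same measure;
  the functions \<open>min 1 (n dist(x, -U))\<close>, cut off at radius \<open>n\<close>, converge to the indicator of \<open>U\<close>.
\<close>

lemma continuous_L1_dense:
  fixes f :: "'a::euclidean_space \<Rightarrow> real"
  assumes "integrable lborel f" "e > 0"
  shows "\<exists>g B. continuous_on UNIV g \<and> bounded {x. g x \<noteq> 0} \<and> (\<forall>x. \<bar>g x\<bar> \<le> B)
     \<and> (\<integral>\<^sup>+x. ennreal \<bar>f x - g x\<bar> \<partial>lborel) \<le> ennreal e"
  using assms
proof (induction f arbitrary: e rule: integrable_induct)
  case (base A c)
  define d where "d = e / (2 * (\<bar>c\<bar> + 1))"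
  have d: "d > 0" "\<bar>c\<bar> * d \<le> e / 2" using base by (auto simp: d_def field_simps)
  have [measurable]: "A \<in> sets borel" using base by simp
  obtain U where U: "open U" "A \<subseteq> U" "emeasure lborel (U - A) < ennreal d"
    using outer_regular_lborel[of A d] d base by auto
  have [measurable]: "U \<in> sets borel" using U by auto
  have "emeasure lborel U \<le> emeasure lborel A + emeasure lborel (U - A)"
    using U(2) by (subst plus_emeasure) (auto simp: Un_absorb1)
  also have "\<dots> < \<infinity>" using base U(3) by (auto simp: less_top[symmetric] ennreal_add_eq_top)
  finally have Ufin: "emeasure lborel U < \<infinity>" .
  have Une: "- U \<noteq> {}"
  proof
    assume "- U = {}"
    then have "U = UNIV" by auto
    then show False using Ufin by simp
  qed
  define g where "g n x = min 1 (real n * infdist x (- U)) * max 0 (min 1 (real n - norm x))" for n x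
  have gcont: "continuous_on UNIV (g n)" for n
    unfolding g_def by (intro continuous_intros)
  have [measurable]: "g n \<in> borel_measurable borel" for n
    using gcont by (rule borel_measurable_continuous_onI)
  have g01: "0 \<le> g n x" "g n x \<le> indicator U x" for n x
  proof -
    show "0 \<le> g n x" by (simp add: g_def infdist_nonneg)
    have "g n x \<le> 1 * 1" unfolding g_def
      by (intro mult_mono) (auto simp: infdist_nonneg)
    moreover have "g n x = 0" if "x \<notin> U" using that by (simp add: g_def)
    ultimately show "g n x \<le> indicator U x" by (auto simp: indicator_def)
  qed
  have lim: "(\<lambda>n. g n x) \<longlonglongrightarrow> indicator U x" for x
  proof (cases "x \<in> U")
    case True
    then have "infdist x (- U) \<noteq> 0"
      using U(1) Une in_closed_iff_infdist_zero[of "- U" x] by (simp add: closed_Compl)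
    then have inf: "infdist x (- U) > 0" using infdist_nonneg[of x "- U"] by linarith
    obtain N where N: "max (1 / infdist x (- U)) (norm x + 1) < real N" using reals_Archimedean2 by blast
    have "\<forall>\<^sub>F n in sequentially. g n x = indicator U x"
      using eventually_ge_at_top[of N]
    proof eventually_elim
      case (elim n)
      then have n: "max (1 / infdist x (- U)) (norm x + 1) < real n" using N by linarith
      then have "1 < real n * infdist x (- U)" "norm x + 1 < real n" using inf by (auto simp: field_simps)
      then show ?case using True by (simp add: g_def)
    qed
    then show ?thesis by (rule tendsto_eventually)
  next
    case False
    then have "g n x = 0" for n by (simp add: g_def)
    then show ?thesis using False by simp
  qed
  have "(\<lambda>n. \<integral>\<^sup>+x. ennreal (norm (indicator U x - g n x)) \<partial>lborel) \<longlonglongrightarrow> 0"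
  proof (rule nn_integral_dominated_convergence_norm[where w = "indicator U"])
    show "AE x in lborel. norm (g j x) \<le> indicator U x" for j
      using g01[of j] by simp
  qed (use lim Ufin in \<open>auto simp: ennreal_indicator\<close>)
  then have "\<forall>\<^sub>F n in sequentially. (\<integral>\<^sup>+x. ennreal \<bar>indicator U x - g n x\<bar> \<partial>lborel) < ennreal d"
    using d by (intro order_tendstoD(2)[of _ 0]) auto
  then obtain n where n: "(\<integral>\<^sup>+x. ennreal \<bar>indicator U x - g n x\<bar> \<partial>lborel) < ennreal d"
    by (auto simp: eventually_sequentially)
  have "(\<integral>\<^sup>+x. ennreal \<bar>indicator A x *\<^sub>R c - c * g n x\<bar> \<partial>lborel)
      \<le> (\<integral>\<^sup>+x. ennreal \<bar>c\<bar> * (indicator (U - A) x + ennreal \<bar>indicator U x - g n x\<bar>) \<partial>lborel)"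
  proof (intro nn_integral_mono)
    fix x
    have "\<bar>indicator A x *\<^sub>R c - c * g n x\<bar> = \<bar>c\<bar> * \<bar>indicator A x - g n x\<bar>"
      by (simp add: abs_mult[symmetric] algebra_simps)
    also have "\<dots> \<le> \<bar>c\<bar> * (indicator (U - A) x + \<bar>indicator U x - g n x\<bar>)"
      using U(2) by (intro mult_left_mono) (auto simp: indicator_def)
    finally have "ennreal \<bar>indicator A x *\<^sub>R c - c * g n x\<bar>
      \<le> ennreal (\<bar>c\<bar> * (indicator (U - A) x + \<bar>indicator U x - g n x\<bar>))" by (rule ennreal_leI)
    also have "\<dots> = ennreal \<bar>c\<bar> * (indicator (U - A) x + ennreal \<bar>indicator U x - g n x\<bar>)"
      by (simp add: ennreal_mult ennreal_plus ennreal_indicator)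
    finally show "ennreal \<bar>indicator A x *\<^sub>R c - c * g n x\<bar> \<le> \<dots>" .
  qed
  also have "\<dots> = ennreal \<bar>c\<bar> * (emeasure lborel (U - A) + (\<integral>\<^sup>+x. ennreal \<bar>indicator U x - g n x\<bar> \<partial>lborel))"
    by (simp add: nn_integral_cmult nn_integral_add)
  also have "\<dots> \<le> ennreal \<bar>c\<bar> * (ennreal d + ennreal d)"
    using n U(3) by (intro mult_left_mono add_mono) auto
  also have "\<dots> = ennreal (\<bar>c\<bar> * d + \<bar>c\<bar> * d)"
    using d(1) by (simp add: ennreal_mult[symmetric] ennreal_plus[symmetric] distrib_left del: ennreal_plus)
  also have "\<dots> \<le> ennreal e" using d(2) by (intro ennreal_leI) linarith
  finally have 1: "(\<integral>\<^sup>+x. ennreal \<bar>indicator A x *\<^sub>R c - c * g n x\<bar> \<partial>lborel) \<le> ennreal e" .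
  have "{x. c * g n x \<noteq> 0} \<subseteq> cball 0 (real n)"
    by (auto simp: g_def)
  then have 2: "bounded {x. c * g n x \<noteq> 0}" using bounded_subset bounded_cball by blast
  have "\<bar>g n x\<bar> \<le> 1" for x using g01[of n x] by (cases "x \<in> U") auto
  then have 3: "\<bar>c * g n x\<bar> \<le> \<bar>c\<bar>" for x by (simp add: abs_mult mult_left_le)
  have 4: "continuous_on UNIV (\<lambda>x. c * g n x)" using gcont by (intro continuous_intros)
  show ?case using 1 2 3 4 by (intro exI[of _ "\<lambda>x. c * g n x"] exI[of _ "\<bar>c\<bar>"]) simp
next
  case (add f1 f2)
  have [measurable]: "f1 \<in> borel_measurable borel" "f2 \<in> borel_measurable borel" using add by auto
  obtain g1 B1 where g1: "continuous_on UNIV g1" "bounded {x. g1 x \<noteq> 0}" "\<And>x. \<bar>g1 x\<bar> \<le> B1"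
     "(\<integral>\<^sup>+x. ennreal \<bar>f1 x - g1 x\<bar> \<partial>lborel) \<le> ennreal (e/2)" using add.IH(1)[of "e/2"] add.prems by auto
  obtain g2 B2 where g2: "continuous_on UNIV g2" "bounded {x. g2 x \<noteq> 0}" "\<And>x. \<bar>g2 x\<bar> \<le> B2"
     "(\<integral>\<^sup>+x. ennreal \<bar>f2 x - g2 x\<bar> \<partial>lborel) \<le> ennreal (e/2)" using add.IH(2)[of "e/2"] add.prems by auto
  have [measurable]: "g1 \<in> borel_measurable borel" "g2 \<in> borel_measurable borel"
    using g1 g2 by (auto intro: borel_measurable_continuous_onI)
  have "(\<integral>\<^sup>+x. ennreal \<bar>f1 x + f2 x - (g1 x + g2 x)\<bar> \<partial>lborel)
     \<le> (\<integral>\<^sup>+x. ennreal \<bar>f1 x - g1 x\<bar> + ennreal \<bar>f2 x - g2 x\<bar> \<partial>lborel)"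
    by (intro nn_integral_mono) (simp add: ennreal_plus[symmetric] del: ennreal_plus)
  also have "\<dots> = (\<integral>\<^sup>+x. ennreal \<bar>f1 x - g1 x\<bar> \<partial>lborel) + (\<integral>\<^sup>+x. ennreal \<bar>f2 x - g2 x\<bar> \<partial>lborel)"
    by (rule nn_integral_add) measurable
  also have "\<dots> \<le> ennreal (e/2) + ennreal (e/2)" using g1 g2 by (intro add_mono)
  also have "\<dots> = ennreal e" using add.prems by (subst ennreal_plus[symmetric]) auto
  finally have 1: "(\<integral>\<^sup>+x. ennreal \<bar>f1 x + f2 x - (g1 x + g2 x)\<bar> \<partial>lborel) \<le> ennreal e" .
  have 2: "bounded {x. g1 x + g2 x \<noteq> 0}"
    by (rule bounded_subset[OF bounded_Un[THEN iffD2, OF conjI[OF g1(2) g2(2)]]]) auto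
  have 3: "\<bar>g1 x + g2 x\<bar> \<le> B1 + B2" for x using g1(3)[of x] g2(3)[of x] by linarith
  have 4: "continuous_on UNIV (\<lambda>x. g1 x + g2 x)" using g1 g2 by (intro continuous_intros)
  show ?case using 1 2 3 4 by (intro exI[of _ "\<lambda>x. g1 x + g2 x"] exI[of _ "B1 + B2"]) simp
next
  case (lim f s)
  have [measurable]: "f \<in> borel_measurable borel" "s i \<in> borel_measurable borel" for i using lim by auto
  have "(\<lambda>i. \<integral>\<^sup>+x. ennreal (norm (f x - s i x)) \<partial>lborel) \<longlonglongrightarrow> 0"
  proof (rule nn_integral_dominated_convergence_norm[where w = "\<lambda>x. 2 * norm (f x)"])
    have "integrable lborel (\<lambda>x. 2 * norm (f x))" using lim by auto
    then show "(\<integral>\<^sup>+x. ennreal (2 * norm (f x)) \<partial>lborel) < \<infinity>"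
      unfolding integrable_iff_bounded by simp
  qed (use lim in auto)
  then have "\<forall>\<^sub>F i in sequentially. (\<integral>\<^sup>+x. ennreal (norm (f x - s i x)) \<partial>lborel) < ennreal (e / 2)"
    using lim.prems by (intro order_tendstoD(2)[of _ 0]) auto
  then obtain i where i: "(\<integral>\<^sup>+x. ennreal \<bar>f x - s i x\<bar> \<partial>lborel) < ennreal (e / 2)"
    by (auto simp: eventually_sequentially)
  obtain g B where g: "continuous_on UNIV g" "bounded {x. g x \<noteq> 0}" "\<And>x. \<bar>g x\<bar> \<le> B"
     "(\<integral>\<^sup>+x. ennreal \<bar>s i x - g x\<bar> \<partial>lborel) \<le> ennreal (e/2)" using lim.IH[of "e/2" i] lim.prems by auto
  have [measurable]: "g \<in> borel_measurable borel"
    using g by (auto intro: borel_measurable_continuous_onI)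
  have "(\<integral>\<^sup>+x. ennreal \<bar>f x - g x\<bar> \<partial>lborel)
     \<le> (\<integral>\<^sup>+x. ennreal \<bar>f x - s i x\<bar> + ennreal \<bar>s i x - g x\<bar> \<partial>lborel)"
    by (intro nn_integral_mono) (simp add: ennreal_plus[symmetric] del: ennreal_plus)
  also have "\<dots> = (\<integral>\<^sup>+x. ennreal \<bar>f x - s i x\<bar> \<partial>lborel) + (\<integral>\<^sup>+x. ennreal \<bar>s i x - g x\<bar> \<partial>lborel)"
    by (rule nn_integral_add) measurable
  also have "\<dots> \<le> ennreal (e/2) + ennreal (e/2)" using g(4) i by (intro add_mono) auto
  also have "\<dots> = ennreal e" using lim.prems by (subst ennreal_plus[symmetric]) auto
  finally show ?case using g by blast
qed

lemma jac_le:
  assumes "m \<ge> 0" "\<delta> > 0" "\<bar>vloc m s\<bar> \<ge> \<delta>"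
  shows "jac m s \<le> 1 + sqrt m / \<delta>"
proof (cases "m < s\<^sup>2")
  case True
  let ?w = "sqrt (s\<^sup>2 - m)"
  have w: "?w \<ge> \<delta>" using assms True by (cases "s = 0") (auto simp: vloc_def abs_mult abs_sgn_eq)
  have "\<bar>s\<bar> = sqrt ((s\<^sup>2 - m) + m)" by simp
  also have "\<dots> \<le> ?w + sqrt m" using assms True by (intro sqrt_add_le_add_sqrt) auto
  finally have "jac m s \<le> (?w + sqrt m) / ?w" using True by (simp add: jac_def divide_right_mono)
  also have "\<dots> = 1 + sqrt m / ?w" using True by (simp add: add_divide_distrib)
  also have "\<dots> \<le> 1 + sqrt m / \<delta>" using w assms True by (intro add_left_mono divide_left_mono mult_pos_pos) auto
  finally show ?thesis .
qed (use assms in \<open>simp add: jac_def\<close>)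

text \<open>
  Away from \<open>\<xi>\<^sub>1 = 0\<close> the weight \<open>jac m\<close> is bounded, hence composition with \<open>vel_inf m\<close> is bounded
  on \<open>L\<^sup>1\<close>, uniformly for bounded \<open>m\<close>.
\<close>

lemma nn_integral_fast_particles:
  fixes H :: "vel \<Rightarrow> ennreal"
  assumes m: "m \<ge> 0" and \<delta>: "\<delta> > 0" and [measurable]: "H \<in> borel_measurable borel"
  shows "(\<integral>\<^sup>+\<xi>. H (vel_inf m \<xi>) * indicator {\<xi>. \<delta> \<le> \<bar>fst \<xi>\<bar>} \<xi> \<partial>lborel)
    \<le> ennreal (1 + sqrt m / \<delta>) * (\<integral>\<^sup>+\<zeta>. H \<zeta> \<partial>lborel)"
proof -
  have "(\<integral>\<^sup>+\<xi>. H (vel_inf m \<xi>) * indicator {\<xi>. \<delta> \<le> \<bar>fst \<xi>\<bar>} \<xi> \<partial>lborel)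
     = (\<integral>\<^sup>+\<zeta>. H (vel_inf m (vel_loc m \<zeta>)) * indicator {\<xi>. \<delta> \<le> \<bar>fst \<xi>\<bar>} (vel_loc m \<zeta>) * jac m (fst \<zeta>) \<partial>lborel)"
    by (rule nn_integral_vel_loc[OF m]) measurable
  also have "\<dots> \<le> (\<integral>\<^sup>+\<zeta>. ennreal (1 + sqrt m / \<delta>) * H \<zeta> \<partial>lborel)"
  proof (intro nn_integral_mono)
    fix \<zeta> :: vel
    show "H (vel_inf m (vel_loc m \<zeta>)) * indicator {\<xi>. \<delta> \<le> \<bar>fst \<xi>\<bar>} (vel_loc m \<zeta>) * jac m (fst \<zeta>)
       \<le> ennreal (1 + sqrt m / \<delta>) * H \<zeta>"
    proof (cases "m < (fst \<zeta>)\<^sup>2 \<and> \<delta> \<le> \<bar>vloc m (fst \<zeta>)\<bar>")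
      case True
      then have "ennreal (jac m (fst \<zeta>)) \<le> ennreal (1 + sqrt m / \<delta>)"
        using m \<delta> by (intro ennreal_leI jac_le) auto
      then have "H \<zeta> * jac m (fst \<zeta>) \<le> H \<zeta> * ennreal (1 + sqrt m / \<delta>)" by (intro mult_left_mono) auto
      moreover have "vel_inf m (vel_loc m \<zeta>) = \<zeta>" "\<delta> \<le> \<bar>fst (vel_loc m \<zeta>)\<bar>"
        using True m by (simp_all add: vel_inf_loc) (simp add: vel_loc_def)
      ultimately show ?thesis by (simp add: mult.commute)
    qed (auto simp: jac_def vel_loc_def)
  qed
  also have "\<dots> = ennreal (1 + sqrt m / \<delta>) * (\<integral>\<^sup>+\<zeta>. H \<zeta> \<partial>lborel)"
    by (rule nn_integral_cmult) measurable
  finally show ?thesis .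
qed

lemma uniform_L1_bound:
  assumes r: "r > 2" and f: "integrable lborel f" "Lr_loc_L1 r f" and R: "R \<ge> 0"
  shows "\<exists>C\<ge>0. \<forall>m\<in>{0..R}. (\<integral>\<^sup>+\<xi>. ennreal \<bar>f (vel_inf m \<xi>)\<bar> \<partial>lborel) \<le> ennreal C"
proof -
  have [measurable]: "f \<in> borel_measurable borel" using f(1) by auto
  obtain \<delta> where \<delta>: "\<delta> > 0" "\<And>m. m \<in> {0..R} \<Longrightarrow>
    (\<integral>\<^sup>+\<xi>. ennreal \<bar>f (vel_inf m \<xi>)\<bar> * indicator {\<xi>. \<bar>fst \<xi>\<bar> < \<delta>} \<xi> \<partial>lborel) \<le> ennreal 1"
    using slow_particles_small[OF r f R zero_less_one] by auto
  define N where "N = (\<integral>\<zeta>. \<bar>f \<zeta>\<bar> \<partial>lborel)"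
  have N: "(\<integral>\<^sup>+\<zeta>. ennreal \<bar>f \<zeta>\<bar> \<partial>lborel) = ennreal N" "N \<ge> 0"
    using f(1) unfolding N_def by (auto intro!: nn_integral_eq_integral)
  show ?thesis
  proof (intro exI[of _ "1 + (1 + sqrt R / \<delta>) * N"] conjI ballI)
    show "1 + (1 + sqrt R / \<delta>) * N \<ge> 0" using N(2) R \<delta>(1) by simp
    fix m assume m: "m \<in> {0..R}"
    have "(\<integral>\<^sup>+\<xi>. ennreal \<bar>f (vel_inf m \<xi>)\<bar> \<partial>lborel)
      = (\<integral>\<^sup>+\<xi>. ennreal \<bar>f (vel_inf m \<xi>)\<bar> * indicator {\<xi>. \<bar>fst \<xi>\<bar> < \<delta>} \<xi>
          + ennreal \<bar>f (vel_inf m \<xi>)\<bar> * indicator {\<xi>. \<delta> \<le> \<bar>fst \<xi>\<bar>} \<xi> \<partial>lborel)"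
      by (intro nn_integral_cong) (auto split: split_indicator)
    also have "\<dots> = (\<integral>\<^sup>+\<xi>. ennreal \<bar>f (vel_inf m \<xi>)\<bar> * indicator {\<xi>. \<bar>fst \<xi>\<bar> < \<delta>} \<xi> \<partial>lborel)
        + (\<integral>\<^sup>+\<xi>. ennreal \<bar>f (vel_inf m \<xi>)\<bar> * indicator {\<xi>. \<delta> \<le> \<bar>fst \<xi>\<bar>} \<xi> \<partial>lborel)"
      by (rule nn_integral_add) measurable
    also have "\<dots> \<le> ennreal 1 + ennreal (1 + sqrt m / \<delta>) * ennreal N"
      using nn_integral_fast_particles[of m \<delta> "\<lambda>\<zeta>. ennreal \<bar>f \<zeta>\<bar>"] m \<delta>(1)
      by (intro add_mono \<delta>(2)) (simp_all add: N(1))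
    also have "\<dots> \<le> ennreal 1 + ennreal (1 + sqrt R / \<delta>) * ennreal N"
      using m \<delta>(1) by (intro add_mono mult_right_mono ennreal_leI) (auto intro!: divide_right_mono)
    also have "\<dots> = ennreal (1 + (1 + sqrt R / \<delta>) * N)"
    proof -
      have "1 + sqrt R / \<delta> \<ge> 0" using R \<delta>(1) by simp
      then show ?thesis using N(2)
        by (subst ennreal_plus) (auto simp: ennreal_mult)
    qed
    finally show "(\<integral>\<^sup>+\<xi>. ennreal \<bar>f (vel_inf m \<xi>)\<bar> \<partial>lborel) \<le> ennreal (1 + (1 + sqrt R / \<delta>) * N)" .
  qed
qed

lemma integrable_comp_vel_inf:
  assumes r: "r > 2" and f: "integrable lborel f" "Lr_loc_L1 r f" and m: "m \<ge> 0"
  shows "integrable lborel (\<lambda>\<xi>. f (vel_inf m \<xi>))"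
proof -
  have [measurable]: "f \<in> borel_measurable borel" using f(1) by auto
  obtain C where "\<forall>k\<in>{0..m}. (\<integral>\<^sup>+\<xi>. ennreal \<bar>f (vel_inf k \<xi>)\<bar> \<partial>lborel) \<le> ennreal C"
    using uniform_L1_bound[OF r f m] by blast
  then have "(\<integral>\<^sup>+\<xi>. ennreal \<bar>f (vel_inf m \<xi>)\<bar> \<partial>lborel) \<le> ennreal C"
    using m by simp
  then show ?thesis by (intro integrableI_bounded) (auto intro: le_less_trans)
qed

text \<open>
  For a continuous compactly supported function this is dominated convergence: \<open>vel_inf\<close> does not
  decrease the norm, so all supports lie in one ball. The general case follows by density and the uniform
  bound for fast particles.
\<close>

lemma L1_continuous_fast:
  fixes f :: "vel \<Rightarrow> real"
  assumes f: "integrable lborel f" and \<delta>: "\<delta> > 0" and e: "e > 0"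
    and m: "\<And>n. m n \<ge> 0" "m \<longlonglongrightarrow> m0"
  shows "\<forall>\<^sub>F n in sequentially.
    (\<integral>\<^sup>+\<xi>. ennreal \<bar>f (vel_inf (m n) \<xi>) - f (vel_inf m0 \<xi>)\<bar> * indicator {\<xi>. \<delta> \<le> \<bar>fst \<xi>\<bar>} \<xi> \<partial>lborel) \<le> ennreal e"
proof -
  have m0: "m0 \<ge> 0" using m by (intro LIMSEQ_le_const[OF m(2)]) auto
  have [measurable]: "f \<in> borel_measurable borel" using f by auto
  obtain R where R: "\<And>n. \<bar>m n\<bar> \<le> R" using convergent_imp_Bseq[of m] m(2) by (auto simp: convergent_def Bseq_def)
  have R0: "R \<ge> 0" using R[of 0] by linarith
  define C where "C = 1 + sqrt (max R m0) / \<delta>"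
  have C: "C > 0" "1 + sqrt (m n) / \<delta> \<le> C" "1 + sqrt m0 / \<delta> \<le> C" for n
    using R[of n] \<delta> m0 by (auto simp: C_def intro!: divide_right_mono add_pos_nonneg)
  define d where "d = e / (3 * C)"
  have d: "d > 0" "C * d = e / 3" using C(1) e by (auto simp: d_def)
  obtain g B where g: "continuous_on UNIV g" "bounded {x. g x \<noteq> 0}" "\<And>x. \<bar>g x\<bar> \<le> B"
     "(\<integral>\<^sup>+x. ennreal \<bar>f x - g x\<bar> \<partial>lborel) \<le> ennreal d" using continuous_L1_dense[OF f d(1)] by auto
  have gm[measurable]: "g \<in> borel_measurable borel"
    using g by (auto intro: borel_measurable_continuous_onI)
  obtain \<rho> where \<rho>: "\<And>x. g x \<noteq> 0 \<Longrightarrow> norm x \<le> \<rho>" using g(2) by (auto simp: bounded_iff)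
  have B: "B \<ge> 0" using g(3)[of 0] by linarith
  \<comment> \<open>Keeps the supports of all \<open>g \<circ> vel_inf k\<close> in the ball that contains the support of \<open>g\<close>.\<close>
  have norm_le: "norm \<xi> \<le> norm (vel_inf k \<xi>)" if "k \<ge> 0" for k and \<xi> :: vel
  proof -
    have "\<bar>fst \<xi>\<bar> \<le> \<bar>vinf k (fst \<xi>)\<bar>"
      using that by (auto simp: vinf_def abs_mult abs_sgn_eq intro!: real_le_rsqrt)
    then have "(fst \<xi>)\<^sup>2 \<le> (vinf k (fst \<xi>))\<^sup>2" by (simp add: abs_le_square_iff)
    then show ?thesis by (simp add: norm_prod_def vel_inf_def)
  qed
  let ?S = "indicator {\<xi>. \<delta> \<le> \<bar>fst \<xi>\<bar>} :: vel \<Rightarrow> ennreal"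
  have "(\<lambda>n. \<integral>\<^sup>+\<xi>. ennreal (norm (g (vel_inf m0 \<xi>) - g (vel_inf (m n) \<xi>))) \<partial>lborel) \<longlonglongrightarrow> 0"
  proof (rule nn_integral_dominated_convergence_norm[where w = "\<lambda>\<xi>. B * indicator (cball 0 \<rho>) \<xi>"])
    show "AE \<xi> in lborel. norm (g (vel_inf (m j) \<xi>)) \<le> B * indicator (cball 0 \<rho>) \<xi>" for j
    proof (rule AE_I2)
      fix \<xi> :: vel
      show "norm (g (vel_inf (m j) \<xi>)) \<le> B * indicator (cball 0 \<rho>) \<xi>"
        using g(3)[of "vel_inf (m j) \<xi>"] norm_le[OF m(1), of \<xi> j] \<rho>[of "vel_inf (m j) \<xi>"]
        by (cases "g (vel_inf (m j) \<xi>) = 0") (auto simp: B)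
    qed
    show "AE \<xi> in lborel. (\<lambda>i. g (vel_inf (m i) \<xi>)) \<longlonglongrightarrow> g (vel_inf m0 \<xi>)"
    proof (rule AE_I2)
      fix \<xi> :: vel
      have "(\<lambda>i. vel_inf (m i) \<xi>) \<longlonglongrightarrow> vel_inf m0 \<xi>"
        unfolding vel_inf_def vinf_def by (intro tendsto_intros m(2))
      moreover have "isCont g (vel_inf m0 \<xi>)" using g(1) unfolding continuous_on_eq_continuous_at[OF open_UNIV] by blast
      ultimately show "(\<lambda>i. g (vel_inf (m i) \<xi>)) \<longlonglongrightarrow> g (vel_inf m0 \<xi>)" by (rule isCont_tendsto_compose[rotated])
    qed
    have "(\<integral>\<^sup>+\<xi>. ennreal (B * indicator (cball 0 \<rho>) \<xi>) \<partial>(lborel :: vel measure))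
       = (\<integral>\<^sup>+\<xi>. ennreal B * indicator (cball 0 \<rho>) \<xi> \<partial>(lborel :: vel measure))"
      using B by (intro nn_integral_cong) (simp add: ennreal_mult ennreal_indicator)
    also have "\<dots> < \<infinity>" using emeasure_compact_finite[OF compact_cball, of "0::vel" \<rho>]
      by (subst nn_integral_cmult_indicator) (simp_all add: ennreal_mult_less_top)
    finally show "(\<integral>\<^sup>+\<xi>. ennreal (B * indicator (cball 0 \<rho>) \<xi>) \<partial>(lborel :: vel measure)) < \<infinity>" .
    show "(\<lambda>\<xi>. B * indicator (cball 0 \<rho>) \<xi>) \<in> borel_measurable lborel"
      using borel_closed[OF closed_cball, of "0::vel" \<rho>] by (intro borel_measurable_times borel_measurable_indicator) auto
  qed measurable
  then have "\<forall>\<^sub>F n in sequentially.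
      (\<integral>\<^sup>+\<xi>. ennreal (norm (g (vel_inf m0 \<xi>) - g (vel_inf (m n) \<xi>))) \<partial>lborel) < ennreal (e / 3)"
    using e by (intro order_tendstoD(2)[of _ 0]) auto
  then show ?thesis
  proof eventually_elim
    case (elim n)
    have bnd: "(\<integral>\<^sup>+\<xi>. ennreal \<bar>f (vel_inf k \<xi>) - g (vel_inf k \<xi>)\<bar> * ?S \<xi> \<partial>lborel) \<le> ennreal (e / 3)"
      if k: "k \<ge> 0" "1 + sqrt k / \<delta> \<le> C" for k
    proof -
      have "(\<integral>\<^sup>+\<xi>. ennreal \<bar>f (vel_inf k \<xi>) - g (vel_inf k \<xi>)\<bar> * ?S \<xi> \<partial>lborel)
        \<le> ennreal (1 + sqrt k / \<delta>) * (\<integral>\<^sup>+x. ennreal \<bar>f x - g x\<bar> \<partial>lborel)"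
        using nn_integral_fast_particles[OF k(1) \<delta>, of "\<lambda>x. ennreal \<bar>f x - g x\<bar>"] by simp
      also have "\<dots> \<le> ennreal C * ennreal d" using k(2) g(4) by (intro mult_mono ennreal_leI) auto
      also have "\<dots> = ennreal (e / 3)" using C d(1) unfolding d(2)[symmetric] by (simp add: ennreal_mult)
      finally show ?thesis .
    qed
    have "(\<integral>\<^sup>+\<xi>. ennreal \<bar>f (vel_inf (m n) \<xi>) - f (vel_inf m0 \<xi>)\<bar> * ?S \<xi> \<partial>lborel)
     \<le> (\<integral>\<^sup>+\<xi>. ennreal \<bar>f (vel_inf (m n) \<xi>) - g (vel_inf (m n) \<xi>)\<bar> * ?S \<xi>
        + (ennreal (norm (g (vel_inf m0 \<xi>) - g (vel_inf (m n) \<xi>)))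
        + ennreal \<bar>f (vel_inf m0 \<xi>) - g (vel_inf m0 \<xi>)\<bar> * ?S \<xi>) \<partial>lborel)"
      by (intro nn_integral_mono) (auto simp: ennreal_plus[symmetric] simp del: ennreal_plus split: split_indicator)
    also have "\<dots> = (\<integral>\<^sup>+\<xi>. ennreal \<bar>f (vel_inf (m n) \<xi>) - g (vel_inf (m n) \<xi>)\<bar> * ?S \<xi> \<partial>lborel)
        + ((\<integral>\<^sup>+\<xi>. ennreal (norm (g (vel_inf m0 \<xi>) - g (vel_inf (m n) \<xi>))) \<partial>lborel)
        + (\<integral>\<^sup>+\<xi>. ennreal \<bar>f (vel_inf m0 \<xi>) - g (vel_inf m0 \<xi>)\<bar> * ?S \<xi> \<partial>lborel))"
      by (subst nn_integral_add, measurable, subst nn_integral_add, measurable)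
    also have "\<dots> \<le> ennreal (e/3) + (ennreal (e/3) + ennreal (e/3))"
      using elim by (intro add_mono bnd m m0 C) auto
    also have "\<dots> = ennreal e" using e by (simp add: ennreal_plus[symmetric] del: ennreal_plus)
    finally show ?case .
  qed
qed

text \<open>
  The central continuity statement: with \<open>m = -2\<phi>(x)\<close> it yields the continuity of the transported
  density in \<open>x\<close>, its limit at infinity (\<open>m \<longlonglongrightarrow> 0\<close>), and the continuity of \<open>\<rho>\<^sup>-\<close>.
\<close>

lemma L1_continuous_vel_inf:
  fixes f :: "vel \<Rightarrow> real"
  assumes r: "r > 2" and f: "integrable lborel f" "Lr_loc_L1 r f"
    and m: "\<And>n. m n \<ge> 0" "m \<longlonglongrightarrow> m0"
  shows "(\<lambda>n. \<integral>\<xi>. \<bar>f (vel_inf (m n) \<xi>) - f (vel_inf m0 \<xi>)\<bar> \<partial>lborel) \<longlonglongrightarrow> 0"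
proof (rule tendstoI)
  fix e :: real assume e: "e > 0"
  have m0: "m0 \<ge> 0" using m by (intro LIMSEQ_le_const[OF m(2)]) auto
  have [measurable]: "f \<in> borel_measurable borel" using f by auto
  obtain R0 where R0: "\<And>n. \<bar>m n\<bar> \<le> R0" using convergent_imp_Bseq[of m] m(2) by (auto simp: convergent_def Bseq_def)
  define R where "R = max R0 m0"
  have R: "R \<ge> 0" "m n \<in> {0..R}" "m0 \<in> {0..R}" for n
    using R0[of n] m(1)[of n] m0 by (auto simp: R_def)
  obtain \<delta> where \<delta>: "\<delta> > 0" and slow: "\<And>k. k \<in> {0..R} \<Longrightarrow>
    (\<integral>\<^sup>+\<xi>. ennreal \<bar>f (vel_inf k \<xi>)\<bar> * indicator {\<xi>. \<bar>fst \<xi>\<bar> < \<delta>} \<xi> \<partial>lborel) \<le> ennreal (e / 4)"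
    using slow_particles_small[OF r f R(1), of "e/4"] e by auto
  let ?S = "indicator {\<xi>. \<delta> \<le> \<bar>fst \<xi>\<bar>} :: vel \<Rightarrow> ennreal"
  let ?T = "indicator {\<xi>. \<bar>fst \<xi>\<bar> < \<delta>} :: vel \<Rightarrow> ennreal"
  show "\<forall>\<^sub>F n in sequentially. dist (\<integral>\<xi>. \<bar>f (vel_inf (m n) \<xi>) - f (vel_inf m0 \<xi>)\<bar> \<partial>lborel) 0 < e"
  proof (rule eventually_mono[OF L1_continuous_fast[OF f(1) \<delta>, of "e/4" m m0]])
    fix n
    assume el: "(\<integral>\<^sup>+\<xi>. ennreal \<bar>f (vel_inf (m n) \<xi>) - f (vel_inf m0 \<xi>)\<bar> * ?S \<xi> \<partial>lborel) \<le> ennreal (e/4)"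
    have "(\<integral>\<^sup>+\<xi>. ennreal \<bar>f (vel_inf (m n) \<xi>) - f (vel_inf m0 \<xi>)\<bar> \<partial>lborel)
      \<le> (\<integral>\<^sup>+\<xi>. ennreal \<bar>f (vel_inf (m n) \<xi>) - f (vel_inf m0 \<xi>)\<bar> * ?S \<xi>
        + (ennreal \<bar>f (vel_inf (m n) \<xi>)\<bar> * ?T \<xi> + ennreal \<bar>f (vel_inf m0 \<xi>)\<bar> * ?T \<xi>) \<partial>lborel)"
      by (intro nn_integral_mono) (auto simp: ennreal_plus[symmetric] simp del: ennreal_plus split: split_indicator)
    also have "\<dots> = (\<integral>\<^sup>+\<xi>. ennreal \<bar>f (vel_inf (m n) \<xi>) - f (vel_inf m0 \<xi>)\<bar> * ?S \<xi> \<partial>lborel)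
        + ((\<integral>\<^sup>+\<xi>. ennreal \<bar>f (vel_inf (m n) \<xi>)\<bar> * ?T \<xi> \<partial>lborel)
         + (\<integral>\<^sup>+\<xi>. ennreal \<bar>f (vel_inf m0 \<xi>)\<bar> * ?T \<xi> \<partial>lborel))"
      by (subst nn_integral_add, measurable, subst nn_integral_add, measurable)
    also have "\<dots> \<le> ennreal (e/4) + (ennreal (e/4) + ennreal (e/4))"
      by (intro add_mono el slow R)
    also have "\<dots> = ennreal (3 * e / 4)" using e by (simp add: ennreal_plus[symmetric] del: ennreal_plus)
    finally have "(\<integral>\<xi>. \<bar>f (vel_inf (m n) \<xi>) - f (vel_inf m0 \<xi>)\<bar> \<partial>lborel) \<le> 3 * e / 4"
      using e by (intro integral_real_bounded) auto
    moreover have "0 \<le> (\<integral>\<xi>. \<bar>f (vel_inf (m n) \<xi>) - f (vel_inf m0 \<xi>)\<bar> \<partial>lborel)" by simp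
    ultimately show "dist (\<integral>\<xi>. \<bar>f (vel_inf (m n) \<xi>) - f (vel_inf m0 \<xi>)\<bar> \<partial>lborel) 0 < e"
      using e by (simp only: dist_real_def)
  qed (use e m in auto)
qed

section \<open>Ion density and Sagdeev potential\<close>

lemma at_within_convex_ne_bot:
  fixes S :: "real set"
  assumes "convex S" "x \<in> S" "y \<in> S" "x \<noteq> y"
  shows "at x within S \<noteq> bot"
  using connected_imp_perfect[of S x] convex_connected[OF assms(1)] assms
  by (auto simp: trivial_limit_within)

lemma deriv_on_eqI:
  assumes "(g has_real_derivative d) (at x within S)" "convex S" "x \<in> S" "y \<in> S" "x \<noteq> y"
  shows "deriv_on S g x = d"
  unfolding deriv_on_def
  using assms at_within_convex_ne_bot
  by (intro vector_derivative_within) (auto simp: has_real_derivative_iff_has_vector_derivative)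

lemma has_deriv_on:
  assumes "g differentiable_on S" "x \<in> S"
  shows "(g has_real_derivative deriv_on S g x) (at x within S)"
  using assms unfolding deriv_on_def has_real_derivative_iff_has_vector_derivative
  by (simp add: differentiable_on_def vector_derivative_works)

text \<open>
  The definition of \<open>\<rho>\<^sup>-\<close> is the integral of the transported density written in the velocity at infinity.
\<close>

lemma rho_minus_eq:
  assumes "\<phi> \<le> 0" and [measurable]: "f \<in> borel_measurable borel"
  shows "\<rho>_minus f \<phi> = (\<integral>\<xi>. f (vel_inf (- 2 * \<phi>) \<xi>) \<partial>lborel)"
proof -
  have m: "- 2 * \<phi> \<ge> 0" using assms by simp
  have "(\<integral>\<xi>. f (vel_inf (- 2 * \<phi>) \<xi>) \<partial>lborel)
    = (\<integral>\<zeta>. jac (- 2 * \<phi>) (fst \<zeta>) * f (vel_inf (- 2 * \<phi>) (vel_loc (- 2 * \<phi>) \<zeta>)) \<partial>lborel)"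
    by (rule integrable_vel_loc(2)[OF m]) measurable
  also have "\<dots> = \<rho>_minus f \<phi>"
    unfolding \<rho>_minus_def
  proof (rule Bochner_Integration.integral_cong[OF refl])
    fix \<xi> :: vel
    show "jac (- 2 * \<phi>) (fst \<xi>) * f (vel_inf (- 2 * \<phi>) (vel_loc (- 2 * \<phi>) \<xi>))
      = f \<xi> * (\<bar>fst \<xi>\<bar> / sqrt ((fst \<xi>)\<^sup>2 + 2 * \<phi>)) * step ((fst \<xi>)\<^sup>2 + 2 * \<phi>)"
      using vel_inf_loc[OF m, of \<xi>]
      by (cases "- 2 * \<phi> < (fst \<xi>)\<^sup>2") (simp_all add: jac_def step_def)
  qed
  finally show ?thesis ..
qed

lemma continuous_rho_minus:
  assumes r: "r > 2" and f: "integrable lborel f" "Lr_loc_L1 r f"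
  shows "continuous_on {..0} (\<rho>_minus f)"
proof (unfold continuous_on_sequentially, intro allI ballI impI, elim conjE)
  fix t t0 assume t0: "t0 \<in> {..0::real}" and t: "\<forall>n. t n \<in> {..0}" "t \<longlonglongrightarrow> t0"
  have [measurable]: "f \<in> borel_measurable borel" using f by auto
  have int: "integrable lborel (\<lambda>\<xi>. f (vel_inf (- 2 * u) \<xi>))" if "u \<le> 0" for u
    using that by (intro integrable_comp_vel_inf[OF r f]) auto
  have lim: "(\<lambda>n. \<integral>\<xi>. \<bar>f (vel_inf (- 2 * t n) \<xi>) - f (vel_inf (- 2 * t0) \<xi>)\<bar> \<partial>lborel) \<longlonglongrightarrow> 0"
    using t by (intro L1_continuous_vel_inf[OF r f] tendsto_intros) auto
  have "(\<lambda>n. \<rho>_minus f (t n) - \<rho>_minus f t0) \<longlonglongrightarrow> 0"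
  proof (rule Lim_null_comparison[OF _ lim], rule always_eventually, rule allI)
    fix n
    have "\<rho>_minus f (t n) - \<rho>_minus f t0
       = (\<integral>\<xi>. f (vel_inf (- 2 * t n) \<xi>) - f (vel_inf (- 2 * t0) \<xi>) \<partial>lborel)"
      using t t0 int by (simp add: rho_minus_eq Bochner_Integration.integral_diff)
    then show "norm (\<rho>_minus f (t n) - \<rho>_minus f t0)
      \<le> (\<integral>\<xi>. \<bar>f (vel_inf (- 2 * t n) \<xi>) - f (vel_inf (- 2 * t0) \<xi>)\<bar> \<partial>lborel)"
      using integral_norm_bound[of lborel "\<lambda>\<xi>. f (vel_inf (- 2 * t n) \<xi>) - f (vel_inf (- 2 * t0) \<xi>)"] by simp
  qed
  then show "(\<rho>_minus f \<circ> t) \<longlonglongrightarrow> \<rho>_minus f t0" by (simp add: LIM_zero_iff comp_def)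
qed

lemma V_minus_derivative:
  assumes c: "continuous_on {..0} (\<lambda>t. \<rho>_minus f t - n_e t)" and t: "t \<le> 0"
  shows "(V_minus n_e f has_real_derivative (\<rho>_minus f t - n_e t)) (at t within {..0})"
proof -
  have "((\<lambda>u. LBINT y=ereal 0..ereal u. \<rho>_minus f y - n_e y) has_vector_derivative (\<rho>_minus f t - n_e t))
     (at t within {t - 1..0})"
    using t by (intro interval_integral_FTC2 continuous_on_subset[OF c]) auto
  moreover have "at t within {t - 1..0} = at t within {..0}"
    by (rule at_within_nhd[where S = "{t - 1<..}"]) auto
  ultimately show ?thesis
    by (simp add: V_minus_def[abs_def] has_real_derivative_iff_has_vector_derivative zero_ereal_def)
qed

lemma rho_minus_0:
  assumes [measurable]: "f \<in> borel_measurable borel"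
  shows "\<rho>_minus f 0 = (\<integral>\<xi>. f \<xi> \<partial>lborel)"
  by (simp add: rho_minus_eq)

text \<open>
  Near \<open>0\<close> the derivative \<open>k\<close> of \<open>W\<close> satisfies \<open>k t \<le> a t / 2\<close> for \<open>t < 0\<close>, so
  \<open>W t - a t\<^sup>2 / 4\<close> is nonincreasing there and vanishes at \<open>0\<close>.
\<close>

lemma quadratic_lower_bound_left:
  fixes W k :: "real \<Rightarrow> real"
  assumes d: "d < 0" and W: "\<And>t. t \<in> {d..0} \<Longrightarrow> (W has_real_derivative k t) (at t within {d..0})"
    and W0: "W 0 = 0" "k 0 = 0" and k: "(k has_real_derivative a) (at 0 within {d..0})" and a: "a > 0"
  shows "\<exists>\<epsilon>>0. \<forall>t\<in>{-\<epsilon>..0}. W t \<ge> a / 4 * t\<^sup>2"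
proof -
  have "((\<lambda>y. (k y - k 0) / (y - 0)) \<longlongrightarrow> a) (at 0 within {d..0})"
    using k by (simp add: has_field_derivative_iff)
  then have "\<forall>\<^sub>F y in at 0 within {d..0}. k y / y > a / 2"
    using a W0 by (auto dest!: order_tendstoD(1)[where a = "a/2"])
  then obtain e where e: "e > 0" "\<And>y. y \<in> {d..0} \<Longrightarrow> y \<noteq> 0 \<Longrightarrow> dist y 0 < e \<Longrightarrow> k y / y > a / 2"
    unfolding eventually_at by blast
  define \<epsilon> where "\<epsilon> = min (e / 2) (- d)"
  have \<epsilon>: "\<epsilon> > 0" "\<epsilon> < e" "\<epsilon> \<le> - d" using e d by (auto simp: \<epsilon>_def)
  show ?thesis
  proof (intro exI[of _ \<epsilon>] conjI ballI \<epsilon>(1))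
    fix t assume t: "t \<in> {-\<epsilon>..0}"
    have "\<exists>x\<in>{t..0}. (W 0 - a / 4 * 0\<^sup>2) - (W t - a / 4 * t\<^sup>2) = (\<lambda>v. (k x - a / 2 * x) * v) (0 - t)"
    proof (rule mvt_very_simple)
      fix x assume x: "t \<le> x" "x \<le> 0"
      have "(W has_real_derivative k x) (at x within {t..0})"
        using x t \<epsilon> by (intro has_field_derivative_subset[OF W]) auto
      then have "((\<lambda>t. W t - a / 4 * t\<^sup>2) has_real_derivative (k x - a / 2 * x)) (at x within {t..0})"
        by (auto intro!: derivative_eq_intros)
      then show "((\<lambda>t. W t - a / 4 * t\<^sup>2) has_derivative (\<lambda>v. (k x - a / 2 * x) * v)) (at x within {t..0})"
        by (simp add: has_field_derivative_def)
    qed (use t in auto)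
    then obtain x where x: "x \<in> {t..0}" "- (W t - a / 4 * t\<^sup>2) = (k x - a / 2 * x) * (0 - t)"
      using W0 by auto
    have "k x - a / 2 * x \<le> 0"
    proof (cases "x = 0")
      case False
      then have "k x / x > a / 2" using x t \<epsilon> by (intro e(2)) (auto simp: dist_real_def)
      then show ?thesis using False x by (auto simp: field_simps)
    qed (use W0 in simp)
    then have "(k x - a / 2 * x) * (0 - t) \<le> 0" using t by (intro mult_nonpos_nonneg) auto
    then show "W t \<ge> a / 4 * t\<^sup>2" using x(2) by linarith
  qed
qed

text \<open>
  The Sagdeev potential as the profile equation sees it: \<open>C\<^sup>1\<close> on the whole half line, which leaves room
  to the left of the wall value \<open>b0\<close>, and \<open>C\<^sup>2\<close> only between \<open>b0\<close> and the equilibrium \<open>0\<close>.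
\<close>

locale sagdeev =
  fixes V h h' :: "real \<Rightarrow> real" and b0 :: real
  assumes V_deriv: "t \<le> 0 \<Longrightarrow> (V has_real_derivative h t) (at t within {..0})"
    and h_cont: "continuous_on {..0} h"
    and V0: "V 0 = 0" and h0: "h 0 = 0"
    and b0: "b0 < 0"
    and h_deriv: "t \<in> {b0..0} \<Longrightarrow> (h has_real_derivative h' t) (at t within {b0..0})"
    and h'_cont: "continuous_on {b0..0} h'"
begin

lemma V_cont: "continuous_on {..0} V"
  using V_deriv by (intro DERIV_continuous_on) auto

lemma V_DERIV: "t < 0 \<Longrightarrow> (V has_real_derivative h t) (at t)"
  using V_deriv[of t] at_within_interior[of t "{..0}"] by auto

lemma quadratic_upper:
  "\<exists>C>0. \<forall>t\<in>{b0..0}. \<bar>V t\<bar> \<le> C * t\<^sup>2 \<and> \<bar>h t\<bar> \<le> C * \<bar>t\<bar>"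
proof -
  have "bounded (h' ` {b0..0})"
    using h'_cont compact_Icc compact_continuous_image compact_imp_bounded by blast
  then obtain C where C: "C > 0" "\<And>t. t \<in> {b0..0} \<Longrightarrow> \<bar>h' t\<bar> \<le> C"
    unfolding bounded_pos by auto
  have h: "\<bar>h t\<bar> \<le> C * \<bar>t\<bar>" if t: "t \<in> {b0..0}" for t
  proof -
    have "\<exists>x\<in>{t..0}. h 0 - h t = (\<lambda>v. h' x * v) (0 - t)"
      using t by (intro mvt_very_simple)
        (auto intro!: has_field_derivative_imp_has_derivative has_field_derivative_subset[OF h_deriv])
    then obtain x where x: "x \<in> {t..0}" "h t = h' x * t" using h0 by auto
    have "\<bar>h' x\<bar> \<le> C" using C(2)[of x] x t by auto
    then show ?thesis unfolding x(2) abs_mult by (intro mult_right_mono) auto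
  qed
  have "\<bar>V t\<bar> \<le> C * t\<^sup>2" if t: "t \<in> {b0..0}" for t
  proof -
    have "\<exists>x\<in>{t..0}. V 0 - V t = (\<lambda>v. h x * v) (0 - t)"
      using t by (intro mvt_very_simple)
        (auto intro!: has_field_derivative_imp_has_derivative has_field_derivative_subset[OF V_deriv])
    then obtain x where x: "x \<in> {t..0}" "V t = h x * t" using V0 by auto
    have "\<bar>h x\<bar> \<le> C * \<bar>t\<bar>"
      using h[of x] x t C(1) by (auto intro: order_trans mult_left_mono)
    then have "\<bar>V t\<bar> \<le> (C * \<bar>t\<bar>) * \<bar>t\<bar>" unfolding x(2) abs_mult by (intro mult_right_mono) auto
    then show ?thesis by (simp add: power2_eq_square mult.assoc)
  qed
  then show ?thesis using C(1) h by blast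
qed

lemma quadratic_lower_near_0:
  assumes "h' 0 > 0"
  shows "\<exists>\<epsilon>>0. \<forall>t\<in>{-\<epsilon>..0}. V t \<ge> h' 0 / 4 * t\<^sup>2"
  using assms b0 V0 h0
  by (intro quadratic_lower_bound_left[of b0 V h])
     (auto intro: has_field_derivative_subset[OF V_deriv] h_deriv)

lemma negative_near_0:
  assumes "h' 0 < 0"
  shows "\<exists>t\<in>{b0..<0}. V t < 0"
proof -
  have "\<exists>\<epsilon>>0. \<forall>t\<in>{-\<epsilon>..0}. - V t \<ge> - h' 0 / 4 * t\<^sup>2"
    using assms b0 V0 h0
    by (intro quadratic_lower_bound_left[of b0 "\<lambda>t. - V t" "\<lambda>t. - h t"])
       (auto intro!: derivative_intros has_field_derivative_subset[OF V_deriv] h_deriv)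
  then obtain \<epsilon> where \<epsilon>: "\<epsilon> > 0" "\<And>t. t \<in> {-\<epsilon>..0} \<Longrightarrow> - V t \<ge> - h' 0 / 4 * t\<^sup>2" by blast
  define t where "t = max b0 (-\<epsilon>)"
  have t: "t \<in> {b0..<0}" "t \<in> {-\<epsilon>..0}" using b0 \<epsilon> by (auto simp: t_def)
  have "- h' 0 / 4 * t\<^sup>2 > 0" using assms t by (intro mult_pos_pos) auto
  then show ?thesis using \<epsilon>(2)[OF t(2)] t by (intro bexI[of _ t]) auto
qed

lemma positive_extends:
  assumes pos: "\<And>t. t \<in> {b0..<0} \<Longrightarrow> V t > 0"
  shows "\<exists>b<b0. \<forall>t\<in>{b..<0}. V t > 0"
proof -
  have "isCont V b0" using V_DERIV[OF b0] by (rule DERIV_isCont)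
  then have "\<forall>\<^sub>F y in at b0. V y > 0"
    using pos[of b0] b0 by (auto simp: isCont_def dest!: order_tendstoD(1)[where a = 0])
  then obtain e where e: "e > 0" "\<And>y. y \<noteq> b0 \<Longrightarrow> dist y b0 < e \<Longrightarrow> V y > 0"
    unfolding eventually_at by blast
  show ?thesis
  proof (intro exI[of _ "b0 - e / 2"] conjI ballI)
    fix t assume t: "t \<in> {b0 - e / 2..<0}"
    show "V t > 0"
      using pos[of t] e(2)[of t] t e(1) by (cases "t < b0") (auto simp: dist_real_def)
  qed (use e in auto)
qed

lemma quadratic_lower:
  assumes "h' 0 > 0" and pos: "\<And>t. t \<in> {b0..<0} \<Longrightarrow> V t > 0"
  shows "\<exists>c>0. \<forall>t\<in>{b0..0}. V t \<ge> c * t\<^sup>2"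
proof -
  obtain \<epsilon> where \<epsilon>: "\<epsilon> > 0" "\<And>t. t \<in> {-\<epsilon>..0} \<Longrightarrow> V t \<ge> h' 0 / 4 * t\<^sup>2"
    using quadratic_lower_near_0[OF assms(1)] by blast
  show ?thesis
  proof (cases "b0 < - \<epsilon>")
    case True
    have "\<exists>x\<in>{b0..-\<epsilon>}. \<forall>y\<in>{b0..-\<epsilon>}. V x \<le> V y"
      using True \<epsilon> by (intro continuous_attains_inf continuous_on_subset[OF V_cont]) auto
    then obtain x where x: "x \<in> {b0..-\<epsilon>}" "\<And>y. y \<in> {b0..-\<epsilon>} \<Longrightarrow> V x \<le> V y" by blast
    define c where "c = min (h' 0 / 4) (V x / b0\<^sup>2)"
    have Vx: "V x > 0" using pos[of x] x \<epsilon> by auto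
    have c: "c > 0" using Vx assms b0 by (auto simp: c_def)
    have "V t \<ge> c * t\<^sup>2" if t: "t \<in> {b0..0}" for t
    proof (cases "t \<in> {-\<epsilon>..0}")
      case True
      have "c \<le> h' 0 / 4" unfolding c_def by (rule min.cobounded1)
      then have "c * t\<^sup>2 \<le> h' 0 / 4 * t\<^sup>2" by (rule mult_right_mono) simp
      then show ?thesis using \<epsilon>(2)[OF True] by linarith
    next
      case False
      have "\<bar>t\<bar> \<le> \<bar>b0\<bar>" using t by auto
      then have "t\<^sup>2 \<le> b0\<^sup>2" by (simp add: abs_le_square_iff)
      then have "c * t\<^sup>2 \<le> V x / b0\<^sup>2 * b0\<^sup>2" using Vx by (intro mult_mono) (auto simp: c_def)
      also have "\<dots> = V x" using b0 by simp
      also have "\<dots> \<le> V t" using False t by (intro x(2)) auto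
      finally show ?thesis .
    qed
    then show ?thesis using c by blast
  next
    case False
    then show ?thesis using \<epsilon> assms(1) by (intro exI[of _ "h' 0 / 4"]) auto
  qed
qed

end

section \<open>The profile equation\<close>

lemma at_within_Ici_interior: "a < x \<Longrightarrow> at x within {a..} = at (x::real)"
  by (rule at_within_interior) auto

lemma increasing_on_Ici:
  fixes \<phi> p :: "real \<Rightarrow> real"
  assumes "\<And>x. x \<ge> a \<Longrightarrow> (\<phi> has_real_derivative p x) (at x within {a..})"
    and "\<And>x. x \<ge> a \<Longrightarrow> p x > 0" and "a \<le> x" "x < y"
  shows "\<phi> x < \<phi> y"
proof (rule DERIV_pos_imp_increasing_open[OF \<open>x < y\<close>])
  show "\<exists>d. (\<phi> has_real_derivative d) (at z) \<and> 0 < d" if "x < z" "z < y" for z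
    using assms(1,2)[of z] assms(3) that by (auto simp: at_within_Ici_interior)
  have "continuous_on {a..} \<phi>" using assms(1) by (intro DERIV_continuous_on) auto
  then show "continuous_on {x..y} \<phi>" by (rule continuous_on_subset) (use assms(3) in auto)
qed

lemma increasing_neg_of_tendsto_0:
  fixes \<phi> :: "real \<Rightarrow> real"
  assumes mono: "\<And>x y. 0 \<le> x \<Longrightarrow> x < y \<Longrightarrow> \<phi> x < \<phi> y" and lim: "(\<phi> \<longlongrightarrow> 0) at_top" and x: "x \<ge> 0"
  shows "\<phi> x < 0"
proof (rule ccontr)
  assume "\<not> \<phi> x < 0"
  then have pos: "\<phi> (x + 1) > 0" using mono[of x "x+1"] x by auto
  have "\<forall>\<^sub>F y in at_top. \<phi> y < \<phi> (x + 1)" using lim pos by (rule order_tendstoD(2))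
  then have "\<forall>\<^sub>F y in at_top. \<phi> y < \<phi> (x + 1) \<and> y > x + 1"
    using eventually_gt_at_top by (rule eventually_conj)
  then obtain y where "\<phi> y < \<phi> (x + 1)" "y > x + 1" by (auto dest: eventually_happens)
  then show False using mono[of "x+1" y] x by auto
qed

context sagdeev begin

text \<open>
  The function \<open>E = p\<^sup>2/2 - V(\<phi>)\<close> is constant, and its value is half the limit of \<open>p\<^sup>2\<close> because
  \<open>V(\<phi>) \<longlonglongrightarrow> V(0) = 0\<close>. A positive value would keep \<open>p = \<phi>'\<close> above a positive constant and drive \<open>\<phi>\<close>
  through \<open>0\<close>.
\<close>

lemma energy_identity:
  assumes d: "\<And>x. x \<ge> 0 \<Longrightarrow> (\<phi> has_real_derivative p x) (at x within {0..})"
    and pc: "continuous_on {0..} p"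
    and pd: "\<And>x. x > 0 \<Longrightarrow> (p has_real_derivative h (\<phi> x)) (at x)"
    and pp: "\<And>x. x \<ge> 0 \<Longrightarrow> p x > 0" and lim: "(\<phi> \<longlongrightarrow> 0) at_top" and x: "x \<ge> 0"
  shows "p x = sqrt (2 * V (\<phi> x))" and "V (\<phi> x) > 0"
proof -
  note mono = increasing_on_Ici[OF d pp]
  have neg: "\<phi> x < 0" if "x \<ge> 0" for x
    using mono lim that by (rule increasing_neg_of_tendsto_0)
  have \<phi>c: "continuous_on {0..} \<phi>" using d by (intro DERIV_continuous_on) auto
  define E where "E x = (p x)\<^sup>2 / 2 - V (\<phi> x)" for x
  have Vc: "continuous_on {0..} (\<lambda>x. V (\<phi> x))"
    using neg by (intro continuous_on_compose2[OF V_cont \<phi>c]) (auto simp: less_imp_le)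
  have Ec: "continuous_on {0..} E"
    unfolding E_def by (intro continuous_intros pc Vc) auto
  have E0: "E x = E 0" if "x \<ge> 0" for x
  proof (cases "x = 0")
    case False
    show ?thesis
    proof (rule DERIV_isconst2[of 0 x E x])
      fix y assume y: "0 < y" "y < x"
      have "(\<phi> has_real_derivative p y) (at y)" using d[of y] y by (simp add: at_within_Ici_interior)
      then have "((\<lambda>x. V (\<phi> x)) has_real_derivative (h (\<phi> y) * p y)) (at y)"
        using y by (intro DERIV_chain2[OF V_DERIV] neg) auto
      then show "(E has_real_derivative 0) (at y)"
        unfolding E_def using pd[OF y(1)] by (auto intro!: derivative_eq_intros)
    qed (use that False in \<open>auto intro: continuous_on_subset[OF Ec]\<close>)
  qed simp
  have "\<forall>\<^sub>F x in at_top. \<phi> x < 0"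
    using eventually_ge_at_top[of 0] by (rule eventually_mono) (rule neg)
  then have "\<forall>\<^sub>F x in at_top. \<phi> x \<in> {..0} \<and> \<phi> x \<noteq> 0" by (rule eventually_mono) auto
  then have "filterlim \<phi> (at 0 within {..0}) at_top"
    unfolding filterlim_at using lim by blast
  moreover have "(V \<longlongrightarrow> V 0) (at 0 within {..0})"
    using V_cont by (auto simp: continuous_on_def)
  ultimately have "((\<lambda>x. V (\<phi> x)) \<longlongrightarrow> V 0) at_top" by (rule filterlim_compose[rotated])
  then have "((\<lambda>x. 2 * (E 0 + V (\<phi> x))) \<longlongrightarrow> 2 * (E 0 + 0)) at_top"
    using V0 by (intro tendsto_intros) auto
  moreover have p2: "(p x)\<^sup>2 = 2 * (E 0 + V (\<phi> x))" if "x \<ge> 0" for x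
    using E0[OF that] by (simp add: E_def)
  then have "\<forall>\<^sub>F x in at_top. 2 * (E 0 + V (\<phi> x)) = (p x)\<^sup>2"
    by (intro eventually_mono[OF eventually_ge_at_top[of 0]]) simp
  ultimately have plim: "((\<lambda>x. (p x)\<^sup>2) \<longlongrightarrow> 2 * E 0) at_top"
    by (auto intro: Lim_transform_eventually)
  have "E 0 \<ge> 0"
  proof -
    have "0 \<le> 2 * E 0" by (rule tendsto_lowerbound[OF plim]) (auto intro: always_eventually)
    then show ?thesis by simp
  qed
  moreover have "\<not> E 0 > 0"
  proof
    assume E: "E 0 > 0"
    then have "\<forall>\<^sub>F x in at_top. (p x)\<^sup>2 > E 0" by (intro order_tendstoD(1)[OF plim]) auto
    then obtain X0 where X0: "\<And>x. x \<ge> X0 \<Longrightarrow> (p x)\<^sup>2 > E 0" unfolding eventually_at_top_linorder by blast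
    define X where "X = max 0 X0"
    define k where "k = sqrt (E 0)"
    have k: "k > 0" using E by (simp add: k_def)
    have pk: "p x > k" if "x \<ge> X" for x
      using X0[of x] pp[of x] that unfolding k_def X_def by (intro real_less_lsqrt) auto
    define Y where "Y = X + (- \<phi> X) / k"
    have "\<phi> X < 0" by (rule neg) (simp add: X_def)
    then have XY: "X < Y" using k by (simp add: Y_def divide_neg_pos)
    have "\<exists>x\<in>{X..Y}. \<phi> Y - \<phi> X = (\<lambda>v. p x * v) (Y - X)"
      using XY by (intro mvt_very_simple)
        (auto intro!: has_field_derivative_imp_has_derivative has_field_derivative_subset[OF d] simp: X_def)
    then obtain x where x: "x \<in> {X..Y}" "\<phi> Y - \<phi> X = p x * (Y - X)" by auto
    have "\<phi> Y - \<phi> X \<ge> k * (Y - X)"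
      unfolding x(2) using pk[of x] x XY by (intro mult_right_mono) auto
    also have "k * (Y - X) = - \<phi> X" using k by (simp add: Y_def)
    finally show False using neg[of Y] XY by (auto simp: X_def)
  qed
  ultimately have "E 0 = 0" by simp
  then have p2: "(p x)\<^sup>2 = 2 * V (\<phi> x)" if "x \<ge> 0" for x using p2[OF that] by simp
  show "p x = sqrt (2 * V (\<phi> x))" using p2[OF x] pp[OF x] by (metis less_imp_le real_sqrt_abs abs_of_pos)
  have "(p x)\<^sup>2 > 0" using pp[OF x] by simp
  then show "V (\<phi> x) > 0" using p2[OF x] by simp
qed

text \<open>
  The distance \<open>G t\<close> that a profile needs to climb from \<open>b0\<close> to the value \<open>t\<close>; it straightens
  \<open>\<phi>' = sqrt(2V(\<phi>))\<close> to \<open>(G \<circ> \<phi>)' = 1\<close>. Starting below \<open>b0\<close> makes \<open>b0\<close> an interior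
  point, so that two-sided derivatives are available at \<open>x = 0\<close>.
\<close>

lemma travel_coordinate:
  assumes b: "b < b0" and pos: "\<And>t. t \<in> {b..<0} \<Longrightarrow> V t > 0"
  shows "\<exists>G. G b0 = 0 \<and> (\<forall>t\<in>{b<..<0}. (G has_real_derivative 1 / sqrt (2 * V t)) (at t))"
proof -
  define q where "q t = 1 / sqrt (2 * V t)" for t
  define G where "G t = integral {b..t} q - integral {b..b0} q" for t
  have "(G has_real_derivative q t) (at t)" if t: "t \<in> {b<..<0}" for t
  proof -
    have Vp: "2 * V s > 0" if "s \<in> {b..t/2}" for s using pos[of s] that t by auto
    have "continuous_on {b..t/2} V"
      using t by (intro continuous_on_subset[OF V_cont]) auto
    then have "continuous_on {b..t/2} q"
      unfolding q_def using Vp by (intro continuous_intros) force+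
    then have "((\<lambda>x. integral {b..x} q) has_real_derivative q t) (at t within {b..t/2})"
      using t by (intro integral_has_real_derivative) auto
    moreover have "at t within {b..t/2} = at t" using t by (intro at_within_Icc_at) auto
    ultimately show ?thesis unfolding G_def by (auto intro!: derivative_eq_intros)
  qed
  then show ?thesis by (intro exI[of _ G]) (simp add: G_def q_def)
qed

lemma profile_unique:
  assumes pos: "\<And>t. t \<in> {b0..<0} \<Longrightarrow> V t > 0"
    and d: "\<And>x. x \<ge> 0 \<Longrightarrow> (\<phi> has_real_derivative sqrt (2 * V (\<phi> x))) (at x within {0..})"
    and d2: "\<And>x. x \<ge> 0 \<Longrightarrow> (\<eta> has_real_derivative sqrt (2 * V (\<eta> x))) (at x within {0..})"
    and r: "\<And>x. x \<ge> 0 \<Longrightarrow> \<phi> x \<in> {b0..<0}" "\<And>x. x \<ge> 0 \<Longrightarrow> \<eta> x \<in> {b0..<0}"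
    and init: "\<phi> 0 = b0" "\<eta> 0 = b0" and x: "x \<ge> 0"
  shows "\<phi> x = \<eta> x"
proof -
  obtain b where b: "b < b0" "\<And>t. t \<in> {b..<0} \<Longrightarrow> V t > 0" using positive_extends[OF pos] by auto
  obtain G where G: "G b0 = 0" "\<And>t. t \<in> {b<..<0} \<Longrightarrow> (G has_real_derivative 1 / sqrt (2 * V t)) (at t)"
    using travel_coordinate[OF b] by blast
  have Gmono: "G s < G t" if "b < s" "s < t" "t < 0" for s t
  proof (rule DERIV_pos_imp_increasing[OF that(2)])
    fix u assume "s \<le> u" "u \<le> t"
    then have u: "u \<in> {b<..<0}" using that by auto
    then have "0 < 1 / sqrt (2 * V u)" using b(2)[of u] by simp
    then show "\<exists>y. (G has_real_derivative y) (at u) \<and> 0 < y" using G(2)[OF u] by blast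
  qed
  have Gx: "G (\<psi> x) = x"
    if d: "\<And>x. x \<ge> 0 \<Longrightarrow> (\<psi> has_real_derivative sqrt (2 * V (\<psi> x))) (at x within {0..})"
      and r: "\<And>x. x \<ge> 0 \<Longrightarrow> \<psi> x \<in> {b0..<0}" and init: "\<psi> 0 = b0" for \<psi>
  proof -
    have D: "((\<lambda>x. G (\<psi> x) - x) has_real_derivative 0) (at x within {0..})" if "x \<ge> 0" for x
    proof -
      have "((\<lambda>x. G (\<psi> x)) has_real_derivative (1 / sqrt (2 * V (\<psi> x)) * sqrt (2 * V (\<psi> x)))) (at x within {0..})"
        using r[OF that] b d[OF that] by (intro DERIV_chain2[OF G(2)]) auto
      moreover have "V (\<psi> x) > 0" using r[OF that] pos by auto
      ultimately show ?thesis by (auto intro!: derivative_eq_intros)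
    qed
    show ?thesis
    proof (cases "x = 0")
      case False
      have "G (\<psi> x) - x = G (\<psi> 0) - 0"
      proof (rule DERIV_isconst2[of 0 x "\<lambda>x. G (\<psi> x) - x"])
        show "continuous_on {0..x} (\<lambda>x. G (\<psi> x) - x)"
          by (rule DERIV_continuous_on, rule has_field_derivative_subset[OF D]) auto
        show "((\<lambda>x. G (\<psi> x) - x) has_real_derivative 0) (at y)" if "0 < y" "y < x" for y
          using D[of y] that by (simp add: at_within_Ici_interior)
      qed (use x False in auto)
      then show ?thesis using init G(1) by simp
    qed (use init G(1) in simp)
  qed
  have "G (\<phi> x) = G (\<eta> x)" using Gx[OF d r(1) init(1)] Gx[OF d2 r(2) init(2)] by simp
  then show ?thesis
    using Gmono[of "\<phi> x" "\<eta> x"] Gmono[of "\<eta> x" "\<phi> x"] r[OF x] b(1) by (cases "\<phi> x" "\<eta> x" rule: linorder_cases) auto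
qed

text \<open>
  The profile is the inverse of the travel coordinate \<open>G\<close>. It is defined on the whole half line because
  \<open>V t \<le> C t\<^sup>2\<close> gives \<open>G t \<ge> (ln (-b0) - ln (-t)) / sqrt(2C)\<close>, which is unbounded as \<open>t\<close> tends to
  \<open>0\<close>. For negative arguments it is extended by the constant \<open>b0\<close>, which makes it continuous, hence
  measurable, on the real line.
\<close>

lemma profile_exists:
  assumes pos: "\<And>t. t \<in> {b0..<0} \<Longrightarrow> V t > 0"
  shows "\<exists>\<phi>. continuous_on UNIV \<phi> \<and> \<phi> 0 = b0 \<and> (\<forall>x. \<phi> x \<in> {b0..<0})
    \<and> (\<forall>x\<ge>0. (\<phi> has_real_derivative sqrt (2 * V (\<phi> x))) (at x within {0..}))
    \<and> (\<phi> \<longlongrightarrow> 0) at_top"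
proof -
  obtain b where b: "b < b0" "\<And>t. t \<in> {b..<0} \<Longrightarrow> V t > 0" using positive_extends[OF pos] by auto
  obtain G where G: "G b0 = 0" "\<And>t. t \<in> {b<..<0} \<Longrightarrow> (G has_real_derivative 1 / sqrt (2 * V t)) (at t)"
    using travel_coordinate[OF b] by blast
  have Gmono: "G s < G t" if "b < s" "s < t" "t < 0" for s t
  proof (rule DERIV_pos_imp_increasing[OF that(2)])
    fix u assume "s \<le> u" "u \<le> t"
    then have u: "u \<in> {b<..<0}" using that by auto
    then have "0 < 1 / sqrt (2 * V u)" using b(2)[of u] by simp
    then show "\<exists>y. (G has_real_derivative y) (at u) \<and> 0 < y" using G(2)[OF u] by blast
  qed
  have Ginj: "inj_on G {b<..<0}"
  proof (rule inj_onI)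
    fix s t assume "s \<in> {b<..<0}" "t \<in> {b<..<0}" "G s = G t"
    then show "s = t" using Gmono[of s t] Gmono[of t s] by (cases s t rule: linorder_cases) auto
  qed
  have Gcont: "isCont G t" if "t \<in> {b<..<0}" for t using G(2)[OF that] by (rule DERIV_isCont)
  have Gcon: "continuous_on {s..t} G" if "b < s" "t < 0" for s t
    using Gcont that by (intro continuous_at_imp_continuous_on) auto
  obtain C where C: "C > 0" "\<And>t. t \<in> {b0..0} \<Longrightarrow> \<bar>V t\<bar> \<le> C * t\<^sup>2"
    "\<And>t. t \<in> {b0..0} \<Longrightarrow> \<bar>h t\<bar> \<le> C * \<bar>t\<bar>"
    using quadratic_upper by blast
  define k where "k = sqrt (2 * C)"
  have k: "k > 0" using C by (simp add: k_def)
  have Glow: "G t \<ge> (ln (- b0) - ln (- t)) / k" if t: "t \<in> {b0..<0}" for t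
  proof -
    have "(\<lambda>t. G t + ln (- t) / k) b0 \<le> (\<lambda>t. G t + ln (- t) / k) t"
    proof (rule DERIV_nonneg_imp_nondecreasing[where f = "\<lambda>t. G t + ln (- t) / k"])
      fix s assume s: "b0 \<le> s" "s \<le> t"
      then have s0: "s < 0" "s \<in> {b<..<0}" using t b by auto
      have "sqrt (2 * V s) \<le> sqrt (2 * C * s\<^sup>2)" using C(2)[of s] s t by (intro real_sqrt_le_mono) auto
      also have "\<dots> = k * \<bar>s\<bar>" by (simp add: k_def real_sqrt_mult)
      finally have le: "sqrt (2 * V s) \<le> k * - s" using s0 by simp
      have "V s > 0" using s t by (intro pos) auto
      then have "1 / (k * - s) \<le> 1 / sqrt (2 * V s)"
        using le s0 k by (intro divide_left_mono) (auto simp: mult_neg_pos mult_pos_neg)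
      then have "0 \<le> 1 / sqrt (2 * V s) + 1 / (k * s)" by simp
      moreover have "((\<lambda>t. G t + ln (- t) / k) has_real_derivative (1 / sqrt (2 * V s) + 1 / (k * s))) (at s)"
        using G(2)[OF s0(2)] s0(1) k by (auto intro!: derivative_eq_intros simp: field_simps)
      ultimately show "\<exists>y. ((\<lambda>t. G t + ln (- t) / k) has_real_derivative y) (at s) \<and> 0 \<le> y" by blast
    qed (use t in auto)
    then show ?thesis using G(1) by (simp add: diff_divide_distrib)
  qed
  have surj: "\<exists>t\<in>{b0..<0}. G t = x" if "x \<ge> 0" for x
  proof -
    \<comment> \<open>The value at which the logarithmic lower bound for \<open>G\<close> equals \<open>x\<close>.\<close>
    define s where "s = b0 * exp (- k * x)"
    have "exp (- k * x) \<le> 1" using k that by simp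
    then have "b0 * 1 \<le> b0 * exp (- k * x)" using b0 by (intro mult_left_mono_neg) auto
    then have s: "s \<in> {b0..<0}" using b0 by (simp add: s_def mult_neg_pos)
    have "- s = (- b0) * exp (- k * x)" by (simp add: s_def)
    also have "ln \<dots> = ln (- b0) + ln (exp (- k * x))" using b0 by (intro ln_mult_pos) auto
    finally have "ln (- s) = ln (- b0) - k * x" by simp
    then have "x \<le> G s" using Glow[OF s] k by simp
    then have "\<exists>t. b0 \<le> t \<and> t \<le> s \<and> G t = x"
      using that G(1) s b(1) by (intro IVT' Gcon) auto
    then show ?thesis using s by auto
  qed
  define \<Phi> where "\<Phi> = inv_into {b<..<0} G"
  define \<phi> where "\<phi> x = \<Phi> (max x 0)" for x
  have \<Phi>G: "\<Phi> (G t) = t" if "t \<in> {b<..<0}" for t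
    unfolding \<Phi>_def using Ginj that by (rule inv_into_f_f)
  have \<phi>G: "\<phi> x \<in> {b0..<0} \<and> G (\<phi> x) = max x 0" for x
  proof -
    obtain t where t: "t \<in> {b0..<0}" "G t = max x 0" using surj[of "max x 0"] by auto
    then have "\<phi> x = t" using \<Phi>G[of t] b(1) by (simp add: \<phi>_def)
    then show ?thesis using t by simp
  qed
  have \<Phi>d: "(\<Phi> has_real_derivative sqrt (2 * V t)) (at (G t))" if t: "t \<in> {b0..<0}" for t
  proof -
    define a' b' where "a' = (b + t) / 2" and "b' = t / 2"
    have ab: "b < a'" "a' < t" "t < b'" "b' < 0" using t b(1) by (auto simp: a'_def b'_def)
    have 1: "isCont \<Phi> (G t)"
    proof (rule isCont_inverse_function2[of a' t b'])
      show "\<Phi> (G z) = z" if "a' \<le> z" "z \<le> b'" for z using ab that by (auto intro!: \<Phi>G)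
      show "isCont G z" if "a' \<le> z" "z \<le> b'" for z using ab that by (auto intro!: Gcont)
    qed (use ab in auto)
    have 2: "G (\<Phi> y) = y" if "G a' < y" "y < G b'" for y
    proof -
      have "\<exists>s. a' \<le> s \<and> s \<le> b' \<and> G s = y" using that ab by (intro IVT' Gcon) auto
      then show ?thesis using \<Phi>G ab by auto
    qed
    have "V t > 0" using t pos by auto
    then have "(\<Phi> has_real_derivative inverse (1 / sqrt (2 * V t))) (at (G t))"
    proof (intro DERIV_inverse_function[of G _ \<Phi> "G t" "G a'" "G b'"])
      show "(G has_real_derivative 1 / sqrt (2 * V t)) (at (\<Phi> (G t)))"
        using G(2)[of t] \<Phi>G[of t] t b(1) by auto
    qed (use 1 2 ab Gmono in auto)
    then show ?thesis by simp
  qed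
  have \<phi>\<Phi>: "G (\<phi> x) = x" if "x \<ge> 0" for x using \<phi>G[of x] that by simp
  have d: "(\<phi> has_real_derivative sqrt (2 * V (\<phi> x))) (at x within {0..})" if x: "x \<ge> 0" for x
  proof -
    have "(\<Phi> has_real_derivative sqrt (2 * V (\<phi> x))) (at x)"
      using \<Phi>d[of "\<phi> x"] \<phi>G[of x] \<phi>\<Phi>[OF x] by simp
    then have "(\<Phi> has_real_derivative sqrt (2 * V (\<phi> x))) (at x within {0..})"
      by (rule has_field_derivative_at_within)
    then show ?thesis
      by (rule has_field_derivative_transform_within[where d = 1]) (use x in \<open>auto simp: \<phi>_def\<close>)
  qed
  have c0: "continuous_on {0..} \<phi>" using d by (intro DERIV_continuous_on) auto
  have "continuous_on UNIV (\<lambda>x. \<phi> (max x 0))"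
    by (intro continuous_on_compose2[OF c0]) (auto intro!: continuous_intros)
  then have "continuous_on UNIV \<phi>" by (simp add: \<phi>_def)
  moreover have "\<phi> 0 = b0" using \<Phi>G[of b0] G(1) b0 b(1) by (simp add: \<phi>_def)
  moreover have "(\<phi> \<longlongrightarrow> 0) at_top"
  proof (rule tendstoI)
    fix e :: real assume e: "e > 0"
    define t where "t = max (b0 / 2) (- e)"
    have t: "t \<in> {b0..<0}" "b < t" "- e \<le> t" using b0 b(1) e by (auto simp: t_def)
    show "\<forall>\<^sub>F x in at_top. dist (\<phi> x) 0 < e"
      using eventually_gt_at_top[of "max 0 (G t)"]
    proof eventually_elim
      case (elim x)
      then have "G (\<phi> x) > G t" using \<phi>\<Phi>[of x] by simp
      then have "\<not> \<phi> x \<le> t" using Gmono[of "\<phi> x" t] \<phi>G[of x] b(1) t by (cases "\<phi> x = t") auto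
      then show ?case using \<phi>G[of x] t by (simp add: dist_real_def)
    qed
  qed
  ultimately show ?thesis using d \<phi>G by blast
qed

text \<open>
  From \<open>V t \<ge> c t\<^sup>2\<close> one gets \<open>\<phi>' \<ge> - k \<phi>\<close> with \<open>k = sqrt(2c)\<close>, so \<open>\<phi> e\<^bsup>kx\<^esup>\<close> increases and stays above
  \<open>b0\<close>. The derivatives are bounded by multiples of \<open>|\<phi>|\<close> through the quadratic upper bound.
\<close>

lemma exponential_decay:
  assumes a: "h' 0 > 0" and pos: "\<And>t. t \<in> {b0..<0} \<Longrightarrow> V t > 0"
    and d: "\<And>x. x \<ge> 0 \<Longrightarrow> (\<phi> has_real_derivative sqrt (2 * V (\<phi> x))) (at x within {0..})"
    and r: "\<And>x. x \<ge> 0 \<Longrightarrow> \<phi> x \<in> {b0..<0}" and init: "\<phi> 0 = b0"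
  shows "\<exists>c>0. \<exists>C>0. \<forall>x\<ge>0. \<bar>\<phi> x\<bar> \<le> C * exp (- c * x) \<and> sqrt (2 * V (\<phi> x)) \<le> C * exp (- c * x)
     \<and> \<bar>h (\<phi> x)\<bar> \<le> C * exp (- c * x)"
proof -
  obtain c where c: "c > 0" "\<And>t. t \<in> {b0..0} \<Longrightarrow> V t \<ge> c * t\<^sup>2"
    using quadratic_lower[OF a pos] by blast
  obtain C where C: "C > 0" "\<And>t. t \<in> {b0..0} \<Longrightarrow> \<bar>V t\<bar> \<le> C * t\<^sup>2" "\<And>t. t \<in> {b0..0} \<Longrightarrow> \<bar>h t\<bar> \<le> C * \<bar>t\<bar>"
    using quadratic_upper by blast
  define k where "k = sqrt (2 * c)"
  have k: "k > 0" using c by (simp add: k_def)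
  have low: "sqrt (2 * V (\<phi> x)) \<ge> - k * \<phi> x" if "x \<ge> 0" for x
  proof -
    have "- k * \<phi> x = sqrt (2 * c * (\<phi> x)\<^sup>2)" using r[OF that] by (simp add: k_def real_sqrt_mult)
    also have "\<dots> \<le> sqrt (2 * V (\<phi> x))" using c(2)[of "\<phi> x"] r[OF that] by (intro real_sqrt_le_mono) auto
    finally show ?thesis .
  qed
  have dec: "- \<phi> x \<le> - b0 * exp (- k * x)" if x: "x \<ge> 0" for x
  proof -
    have D: "((\<lambda>x. \<phi> x * exp (k * x)) has_real_derivative (sqrt (2 * V (\<phi> y)) + k * \<phi> y) * exp (k * y)) (at y within {0..})"
      if "y \<ge> 0" for y
      using d[OF that] by (auto intro!: derivative_eq_intros simp: algebra_simps)
    have "\<exists>z\<in>{0..x}. \<phi> x * exp (k * x) - \<phi> 0 * exp (k * 0)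
       = (\<lambda>v. (sqrt (2 * V (\<phi> z)) + k * \<phi> z) * exp (k * z) * v) (x - 0)"
      using x by (intro mvt_very_simple)
        (auto intro!: has_field_derivative_imp_has_derivative has_field_derivative_subset[OF D])
    then obtain z where z: "z \<in> {0..x}"
      "\<phi> x * exp (k * x) - b0 = (sqrt (2 * V (\<phi> z)) + k * \<phi> z) * exp (k * z) * x" using init by auto
    have "0 \<le> (sqrt (2 * V (\<phi> z)) + k * \<phi> z) * exp (k * z) * x"
      using low[of z] z x by (intro mult_nonneg_nonneg) auto
    then have "b0 \<le> \<phi> x * exp (k * x)" using z(2) by linarith
    then have "- \<phi> x * exp (k * x) \<le> - b0" by simp
    then show ?thesis by (simp add: exp_minus field_simps)
  qed
  define C' where "C' = max 1 (max C (sqrt (2 * C))) * (- b0)"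
  have C': "C' > 0" using b0 by (simp add: C'_def mult_pos_neg)
  have "\<forall>x\<ge>0. \<bar>\<phi> x\<bar> \<le> C' * exp (- k * x) \<and> sqrt (2 * V (\<phi> x)) \<le> C' * exp (- k * x)
     \<and> \<bar>h (\<phi> x)\<bar> \<le> C' * exp (- k * x)"
  proof (intro allI impI conjI)
    fix x :: real assume x: "x \<ge> 0"
    have rx: "\<phi> x \<in> {b0..0}" using r[OF x] by auto
    have key: "K * \<bar>\<phi> x\<bar> \<le> C' * exp (- k * x)" if "K \<le> max 1 (max C (sqrt (2 * C)))" "K \<ge> 0" for K
    proof -
      have "K * \<bar>\<phi> x\<bar> \<le> max 1 (max C (sqrt (2 * C))) * (- b0 * exp (- k * x))"
        using that dec[OF x] rx by (intro mult_mono) auto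
      then show ?thesis by (simp add: C'_def)
    qed
    show "\<bar>\<phi> x\<bar> \<le> C' * exp (- k * x)" using key[of 1] by simp
    show "\<bar>h (\<phi> x)\<bar> \<le> C' * exp (- k * x)" using key[of C] C(3)[OF rx] C(1) by (simp add: max.coboundedI1 max.coboundedI2)
    have "sqrt (2 * V (\<phi> x)) \<le> sqrt (2 * C * (\<phi> x)\<^sup>2)"
      using C(2)[OF rx] by (intro real_sqrt_le_mono) auto
    also have "\<dots> = sqrt (2 * C) * \<bar>\<phi> x\<bar>" by (simp add: real_sqrt_mult)
    also have "\<dots> \<le> C' * exp (- k * x)" using C(1) by (intro key) auto
    finally show "sqrt (2 * V (\<phi> x)) \<le> C' * exp (- k * x)" .
  qed
  then show ?thesis using k C' by blast
qed

end

section \<open>Cut-off functions and approximation\<close>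

text \<open>
  Continuous differentiability in the form that test functions use: a continuous derivative relative to
  the set, which may be closed.
\<close>

definition C1_on :: "'a::real_normed_vector set \<Rightarrow> ('a \<Rightarrow> real) \<Rightarrow> bool" where
  "C1_on D \<psi> \<longleftrightarrow> (\<exists>\<psi>' :: 'a \<Rightarrow> 'a \<Rightarrow>\<^sub>L real.
     (\<forall>p\<in>D. (\<psi> has_derivative blinfun_apply (\<psi>' p)) (at p within D)) \<and> continuous_on D \<psi>')"

lemma C1_on_bounded_linear:
  assumes "bounded_linear L" shows "C1_on D L"
  unfolding C1_on_def
  by (rule exI[of _ "\<lambda>_. Blinfun L"])
     (use assms in \<open>auto simp: bounded_linear_Blinfun_apply bounded_linear_imp_has_derivative\<close>)

lemma C1_on_continuous: "C1_on D \<psi> \<Longrightarrow> continuous_on D \<psi>"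
  unfolding C1_on_def by (auto intro: has_derivative_continuous_on)

lemma C1_on_mult:
  assumes "C1_on D f" "C1_on D g" shows "C1_on D (\<lambda>p. f p * g p)"
proof -
  obtain f' where f': "\<And>p. p \<in> D \<Longrightarrow> (f has_derivative blinfun_apply (f' p)) (at p within D)" "continuous_on D f'"
    using assms(1) unfolding C1_on_def by blast
  obtain g' where g': "\<And>p. p \<in> D \<Longrightarrow> (g has_derivative blinfun_apply (g' p)) (at p within D)" "continuous_on D g'"
    using assms(2) unfolding C1_on_def by blast
  show ?thesis
    unfolding C1_on_def
  proof (intro exI[of _ "\<lambda>p. f p *\<^sub>R g' p + g p *\<^sub>R f' p"] conjI ballI)
    fix p assume "p \<in> D"
    from has_derivative_mult[OF f'(1)[OF this] g'(1)[OF this]]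
    show "((\<lambda>p. f p * g p) has_derivative blinfun_apply (f p *\<^sub>R g' p + g p *\<^sub>R f' p)) (at p within D)"
      by (rule has_derivative_eq_rhs) (auto simp: fun_eq_iff blinfun.bilinear_simps algebra_simps)
  next
    show "continuous_on D (\<lambda>p. f p *\<^sub>R g' p + g p *\<^sub>R f' p)"
      using assms by (intro continuous_intros f' g' C1_on_continuous)
  qed
qed

lemma C1_on_diff:
  assumes "C1_on D f" "C1_on D g" shows "C1_on D (\<lambda>p. f p - g p)"
proof -
  obtain f' where f': "\<And>p. p \<in> D \<Longrightarrow> (f has_derivative blinfun_apply (f' p)) (at p within D)" "continuous_on D f'"
    using assms(1) unfolding C1_on_def by blast
  obtain g' where g': "\<And>p. p \<in> D \<Longrightarrow> (g has_derivative blinfun_apply (g' p)) (at p within D)" "continuous_on D g'"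
    using assms(2) unfolding C1_on_def by blast
  show ?thesis
    unfolding C1_on_def
  proof (intro exI[of _ "\<lambda>p. f' p - g' p"] conjI ballI)
    fix p assume "p \<in> D"
    from has_derivative_diff[OF f'(1)[OF this] g'(1)[OF this]]
    show "((\<lambda>p. f p - g p) has_derivative blinfun_apply (f' p - g' p)) (at p within D)"
      by (rule has_derivative_eq_rhs) (auto simp: fun_eq_iff blinfun.bilinear_simps)
  next
    show "continuous_on D (\<lambda>p. f' p - g' p)" by (intro continuous_intros f' g')
  qed
qed

lemma C1_on_compose:
  assumes \<psi>: "C1_on D \<psi>" and h: "\<And>t. t \<in> T \<Longrightarrow> (h has_real_derivative h' t) (at t within T)"
    and h': "continuous_on T h'" and T: "\<psi> ` D \<subseteq> T"
  shows "C1_on D (\<lambda>p. h (\<psi> p))"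
proof -
  obtain \<psi>' where \<psi>': "\<And>p. p \<in> D \<Longrightarrow> (\<psi> has_derivative blinfun_apply (\<psi>' p)) (at p within D)" "continuous_on D \<psi>'"
    using \<psi> unfolding C1_on_def by blast
  show ?thesis
    unfolding C1_on_def
  proof (intro exI[of _ "\<lambda>p. h' (\<psi> p) *\<^sub>R \<psi>' p"] conjI ballI)
    fix p assume p: "p \<in> D"
    have "((\<lambda>p. h (\<psi> p)) has_derivative (\<lambda>v. h' (\<psi> p) * blinfun_apply (\<psi>' p) v)) (at p within D)"
      using h by (intro has_derivative_in_compose2[OF _ T p \<psi>'(1)[OF p]]) (auto simp: has_field_derivative_def)
    then show "((\<lambda>p. h (\<psi> p)) has_derivative blinfun_apply (h' (\<psi> p) *\<^sub>R \<psi>' p)) (at p within D)"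
      by (rule has_derivative_eq_rhs) (auto simp: fun_eq_iff blinfun.bilinear_simps)
  next
    show "continuous_on D (\<lambda>p. h' (\<psi> p) *\<^sub>R \<psi>' p)"
      by (intro continuous_intros continuous_on_compose2[OF h' C1_on_continuous[OF \<psi>] T] \<psi>')
  qed
qed

lemma DERIV_pos_part_square:
  "((\<lambda>s. (max 0 s)\<^sup>2) has_real_derivative 2 * max 0 s) (at (s::real))"
proof (cases "s = 0")
  case True
  have "((\<lambda>y::real. max 0 y) \<longlongrightarrow> max 0 0) (at 0)" by (intro tendsto_intros)
  then have "((\<lambda>y::real. ((max 0 y)\<^sup>2 - (max 0 0)\<^sup>2) / (y - 0)) \<longlongrightarrow> max 0 0) (at 0)"
    by (rule Lim_transform_eventually)
       (auto simp: eventually_at_filter max_def power2_eq_square)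
  then show ?thesis using True by (simp add: has_field_derivative_iff)
next
  case False
  show ?thesis
  proof (cases "s > 0")
    case True
    have "((\<lambda>s. s\<^sup>2) has_real_derivative 2 * max 0 s) (at s)"
      using True by (auto intro!: derivative_eq_intros)
    then show ?thesis
      by (rule has_field_derivative_transform_within_open[where S = "{0<..}"]) (use True in auto)
  next
    case F: False
    have "((\<lambda>s. 0) has_real_derivative 2 * max 0 s) (at s)"
      using F by (auto intro!: derivative_eq_intros)
    then show ?thesis
      by (rule has_field_derivative_transform_within_open[where S = "{..<0}"]) (use F False in auto)
  qed
qed

text \<open>
  A \<open>C\<^sup>1\<close> function that is \<open>0\<close> on \<open>(-\<infinity>, 0]\<close> and \<open>1\<close> on \<open>[1, \<infinity>)\<close>, written as a quotient of squared positive
  parts so that it is differentiable without a case distinction.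
\<close>

definition smoothstep :: "real \<Rightarrow> real" where
  "smoothstep s = (max 0 s)\<^sup>2 / ((max 0 s)\<^sup>2 + (max 0 (1 - s))\<^sup>2)"

definition smoothstep' :: "real \<Rightarrow> real" where
  "smoothstep' s = 2 * (max 0 s * (max 0 (1 - s))\<^sup>2 + (max 0 s)\<^sup>2 * max 0 (1 - s)) / ((max 0 s)\<^sup>2 + (max 0 (1 - s))\<^sup>2)\<^sup>2"

lemma smoothstep_den: "(max 0 s)\<^sup>2 + (max 0 (1 - s))\<^sup>2 > (0::real)"
  by (cases "s > 0") (auto simp: max_def add_pos_nonneg add_nonneg_pos)

lemma smoothstep_den_neq: "(max 0 s)\<^sup>2 + (max 0 (1 - s))\<^sup>2 \<noteq> (0::real)"
  using smoothstep_den[of s] by linarith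

lemma DERIV_smoothstep: "(smoothstep has_real_derivative smoothstep' s) (at s)"
proof -
  have D1: "((\<lambda>s. (max 0 (1 - s))\<^sup>2) has_real_derivative 2 * max 0 (1 - s) * (- 1)) (at s)"
    by (rule DERIV_chain2[OF DERIV_pos_part_square]) (auto intro!: derivative_eq_intros)
  show ?thesis
    unfolding smoothstep_def[abs_def] smoothstep'_def
    by (rule DERIV_cong[OF DERIV_divide[OF DERIV_pos_part_square DERIV_add[OF DERIV_pos_part_square D1] smoothstep_den_neq]])
       (simp add: power2_eq_square algebra_simps)
qed

lemma continuous_smoothstep': "continuous_on A smoothstep'"
proof -
  have "((max 0 s)\<^sup>2 + (max 0 (1 - s))\<^sup>2)\<^sup>2 \<noteq> 0" for s :: real
    using smoothstep_den_neq[of s] by (simp only: power_eq_0_iff) blast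
  then show ?thesis unfolding smoothstep'_def[abs_def] by (intro continuous_intros) auto
qed

lemma continuous_smoothstep: "continuous_on A smoothstep"
  by (rule DERIV_continuous_on[OF has_field_derivative_at_within[OF DERIV_smoothstep]])

lemma smoothstep_le_0: "s \<le> 0 \<Longrightarrow> smoothstep s = 0" and smoothstep_ge_1: "s \<ge> 1 \<Longrightarrow> smoothstep s = 1"
  and smoothstep'_le_0: "s \<le> 0 \<Longrightarrow> smoothstep' s = 0" and smoothstep'_ge_1: "s \<ge> 1 \<Longrightarrow> smoothstep' s = 0"
  by (auto simp: smoothstep_def smoothstep'_def max_def)

lemma smoothstep'_nonneg: "smoothstep' s \<ge> 0"
  unfolding smoothstep'_def by (intro divide_nonneg_nonneg mult_nonneg_nonneg add_nonneg_nonneg) auto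

lemma smoothstep_bounds: "0 \<le> smoothstep s" "smoothstep s \<le> 1"
  unfolding smoothstep_def using smoothstep_den[of s] by (auto simp: divide_le_eq_1)

text \<open>
  A \<open>C\<^sup>1\<close> approximation of the indicator of \<open>(a, b)\<close> with sharpness \<open>n\<close>.
\<close>

definition bump :: "real \<Rightarrow> real \<Rightarrow> real \<Rightarrow> real \<Rightarrow> real" where
  "bump n a b t = smoothstep (n * (t - a)) * smoothstep (n * (b - t))"

definition bump' :: "real \<Rightarrow> real \<Rightarrow> real \<Rightarrow> real \<Rightarrow> real" where
  "bump' n a b t = smoothstep' (n * (t - a)) * n * smoothstep (n * (b - t)) + smoothstep' (n * (b - t)) * (- n) * smoothstep (n * (t - a))"

lemma DERIV_bump: "(bump n a b has_real_derivative bump' n a b t) (at t)"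
  unfolding bump_def[abs_def] bump'_def
  by (rule DERIV_cong[OF DERIV_mult[OF DERIV_chain2[OF DERIV_smoothstep, of "\<lambda>t. n * (t - a)" n]
        DERIV_chain2[OF DERIV_smoothstep, of "\<lambda>t. n * (b - t)" "- n"]]])
     (auto intro!: derivative_eq_intros)

lemma continuous_bump': "continuous_on A (bump' n a b)"
  unfolding bump'_def[abs_def]
  by (intro continuous_intros continuous_on_compose2[OF continuous_smoothstep] continuous_on_compose2[OF continuous_smoothstep']) auto

lemma continuous_bump: "continuous_on A (bump n a b)"
  by (rule DERIV_continuous_on[OF has_field_derivative_at_within[OF DERIV_bump]])

lemma bump_bounds: "0 \<le> bump n a b t" "bump n a b t \<le> 1"
  unfolding bump_def using smoothstep_bounds by (auto intro: mult_nonneg_nonneg mult_le_one)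

lemma bump_outside: "n \<ge> 0 \<Longrightarrow> t \<notin> {a<..<b} \<Longrightarrow> bump n a b t = 0"
  unfolding bump_def by (auto simp: not_less mult_nonneg_nonpos smoothstep_le_0)

lemma bump_tendsto_indicator: "(\<lambda>n. bump (real n) a b t) \<longlonglongrightarrow> indicator {a<..<b} t"
proof (cases "t \<in> {a<..<b}")
  case True
  then have pos: "t - a > 0" "b - t > 0" by auto
  obtain N where N: "max (1 / (t - a)) (1 / (b - t)) < real N" using reals_Archimedean2 by blast
  have "\<forall>\<^sub>F n in sequentially. bump (real n) a b t = indicator {a<..<b} t"
    using eventually_ge_at_top[of N]
  proof eventually_elim
    case (elim n)
    then have "1 / (t - a) < real n" "1 / (b - t) < real n" using N by linarith+
    then have "1 \<le> real n * (t - a)" "1 \<le> real n * (b - t)" using pos by (auto simp: field_simps)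
    then show ?case using True by (simp add: bump_def smoothstep_ge_1)
  qed
  then show ?thesis by (rule tendsto_eventually)
next
  case False
  then show ?thesis by (simp add: bump_outside)
qed

text \<open>
  The kernels \<open>smoothstep' ((x - y) / \<delta>) / \<delta>\<close> are nonnegative, live on \<open>[y, y + \<delta>]\<close> and have integral one.
\<close>

lemma approximate_identity:
  fixes M :: "real \<Rightarrow> real"
  assumes M: "continuous_on {y..y + 1} M" and e: "e > 0"
  shows "\<exists>d>0. \<forall>\<delta>. 0 < \<delta> \<and> \<delta> \<le> d \<longrightarrow>
    integrable lborel (\<lambda>x. indicator {y..y + \<delta>} x * (smoothstep' ((x - y) / \<delta>) / \<delta> * M x)) \<and>
    \<bar>(\<integral>x. indicator {y..y + \<delta>} x * (smoothstep' ((x - y) / \<delta>) / \<delta> * M x) \<partial>lborel) - M y\<bar> \<le> e"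
proof -
  have "\<exists>d>0. \<forall>x\<in>{y..y+1}. dist x y < d \<longrightarrow> dist (M x) (M y) < e"
    using M e unfolding continuous_on_iff by auto
  then obtain d0 where d0: "d0 > 0" "\<And>x. x \<in> {y..y+1} \<Longrightarrow> dist x y < d0 \<Longrightarrow> dist (M x) (M y) < e" by blast
  define d where "d = min 1 (d0 / 2)"
  show ?thesis
  proof (intro exI[of _ d] conjI allI impI)
    fix \<delta> assume "0 < \<delta> \<and> \<delta> \<le> d"
    then have \<delta>: "0 < \<delta>" "\<delta> \<le> 1" "\<delta> < d0" using d0 by (auto simp: d_def)
    let ?K = "\<lambda>x. smoothstep' ((x - y) / \<delta>) / \<delta>"
    let ?I = "indicator {y..y + \<delta>} :: real \<Rightarrow> real"
    have Kc: "continuous_on {y..y + \<delta>} ?K"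
      using \<delta> by (intro continuous_intros continuous_on_compose2[OF continuous_smoothstep']) auto
    have Mc: "continuous_on {y..y + \<delta>} M" using M \<delta> by (rule_tac continuous_on_subset) auto
    have K0: "?K x \<ge> 0" for x using \<delta> smoothstep'_nonneg by simp
    have i1: "integrable lborel (\<lambda>x. ?I x * ?K x)"
      using borel_integrable_atLeastAtMost'[OF Kc] by (simp add: set_integrable_def)
    have i2: "integrable lborel (\<lambda>x. ?I x * (?K x * M x))"
      using borel_integrable_atLeastAtMost'[OF continuous_on_mult[OF Kc Mc]] by (simp add: set_integrable_def)
    have "(\<integral>x. ?I x *\<^sub>R ?K x \<partial>lborel) = smoothstep ((y + \<delta> - y) / \<delta>) - smoothstep ((y - y) / \<delta>)"
    proof (rule integral_FTC_atLeastAtMost[OF _ _ Kc])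
      show "((\<lambda>x. smoothstep ((x - y) / \<delta>)) has_vector_derivative ?K x) (at x within {y..y + \<delta>})" for x
      proof -
        have "((\<lambda>x. smoothstep ((x - y) / \<delta>)) has_real_derivative smoothstep' ((x - y) / \<delta>) * (1 / \<delta>)) (at x)"
          by (rule DERIV_chain2[OF DERIV_smoothstep]) (use \<delta> in \<open>auto intro!: derivative_eq_intros\<close>)
        then show ?thesis
          by (simp add: has_real_derivative_iff_has_vector_derivative[symmetric] has_field_derivative_at_within)
      qed
    qed (use \<delta> in auto)
    then have one: "(\<integral>x. ?I x * ?K x \<partial>lborel) = 1" using \<delta> by (simp add: smoothstep_ge_1 smoothstep_le_0)
    have "(\<integral>x. ?I x * (?K x * M x) \<partial>lborel) - M y = (\<integral>x. ?I x * (?K x * M x) \<partial>lborel) - (\<integral>x. ?I x * ?K x \<partial>lborel) * M y"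
      by (simp only: one mult_1)
    also have "\<dots> = (\<integral>x. ?I x * (?K x * M x) - ?I x * ?K x * M y \<partial>lborel)"
      by (subst Bochner_Integration.integral_diff[OF i2 integrable_mult_left[OF i1]])
         (simp only: integral_mult_left_zero)
    finally have eq: "(\<integral>x. ?I x * (?K x * M x) \<partial>lborel) - M y
      = (\<integral>x. ?I x * (?K x * M x) - ?I x * ?K x * M y \<partial>lborel)" .
    have "(\<integral>x. \<bar>?I x * (?K x * M x) - ?I x * ?K x * M y\<bar> \<partial>lborel) \<le> (\<integral>x. e * (?I x * ?K x) \<partial>lborel)"
    proof (rule integral_mono[OF integrable_abs[OF Bochner_Integration.integrable_diff[OF i2 integrable_mult_left[OF i1]]]
          integrable_mult_right[OF i1]])
      fix x
      show "\<bar>?I x * (?K x * M x) - ?I x * ?K x * M y\<bar> \<le> e * (?I x * ?K x)"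
      proof (cases "x \<in> {y..y + \<delta>}")
        case True
        then have "\<bar>M x - M y\<bar> \<le> e" using d0(2)[of x] \<delta> by (auto simp: dist_real_def)
        then have "?K x * \<bar>M x - M y\<bar> \<le> ?K x * e" using K0[of x] by (rule mult_left_mono)
        moreover have "\<bar>?K x * M x - ?K x * M y\<bar> = ?K x * \<bar>M x - M y\<bar>"
          unfolding right_diff_distrib[symmetric] abs_mult using K0[of x] by (simp only: abs_of_nonneg)
        moreover have "?I x = 1" using True by simp
        ultimately show ?thesis by (simp only: mult_1 mult.commute)
      qed simp
    qed
    moreover have "(\<integral>x. e * (?I x * ?K x) \<partial>lborel) = e" by (simp only: integral_mult_right_zero one mult_1_right)
    ultimately show "\<bar>(\<integral>x. ?I x * (?K x * M x) \<partial>lborel) - M y\<bar> \<le> e"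
      unfolding eq using integral_abs_bound[of lborel "\<lambda>x. ?I x * (?K x * M x) - ?I x * ?K x * M y"] by linarith
    show "integrable lborel (\<lambda>x. ?I x * (?K x * M x))" by (rule i2)
  qed (use d0 in \<open>simp add: d_def\<close>)
qed

text \<open>
  In \<open>f n * W n = (f n - f0) * W n + f0 * W n\<close> the first term is small in \<open>L\<^sup>1\<close>, and the second one
  converges by domination.
\<close>

lemma tendsto_integral_mult_bounded:
  fixes f :: "nat \<Rightarrow> 'a \<Rightarrow> real"
  assumes f: "\<And>n. integrable M (f n)" "integrable M f0" "(\<lambda>n. \<integral>x. \<bar>f n x - f0 x\<bar> \<partial>M) \<longlonglongrightarrow> 0"
    and [measurable]: "\<And>n. W n \<in> borel_measurable M" "W0 \<in> borel_measurable M"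
    and B: "\<And>n x. \<bar>W n x\<bar> \<le> B" and lim: "\<And>x. (\<lambda>n. W n x) \<longlonglongrightarrow> W0 x"
  shows "(\<lambda>n. \<integral>x. f n x * W n x \<partial>M) \<longlonglongrightarrow> (\<integral>x. f0 x * W0 x \<partial>M)"
proof -
  have [measurable]: "f n \<in> borel_measurable M" "f0 \<in> borel_measurable M" for n using f by auto
  have bound: "integrable M (\<lambda>x. g x * W n x)" if "integrable M g" for g n
  proof (rule Bochner_Integration.integrable_bound[where f = "\<lambda>x. B * \<bar>g x\<bar>"])
    show "AE x in M. norm (g x * W n x) \<le> norm (B * \<bar>g x\<bar>)"
    proof (rule AE_I2)
      fix x
      have "\<bar>W n x\<bar> \<le> \<bar>B\<bar>" using B[of n x] by linarith
      then have "\<bar>g x\<bar> * \<bar>W n x\<bar> \<le> \<bar>g x\<bar> * \<bar>B\<bar>" by (intro mult_left_mono) auto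
      then show "norm (g x * W n x) \<le> norm (B * \<bar>g x\<bar>)" by (simp add: abs_mult mult.commute)
    qed
  qed (use that in auto)
  have 1: "(\<lambda>n. \<integral>x. f0 x * W n x \<partial>M) \<longlonglongrightarrow> (\<integral>x. f0 x * W0 x \<partial>M)"
  proof (rule integral_dominated_convergence[where w = "\<lambda>x. B * \<bar>f0 x\<bar>"])
    show "AE x in M. norm (f0 x * W n x) \<le> B * \<bar>f0 x\<bar>" for n
      by (rule AE_I2) (simp add: abs_mult mult.commute[of B] mult_left_mono B)
    show "AE x in M. (\<lambda>n. f0 x * W n x) \<longlonglongrightarrow> f0 x * W0 x"
      by (rule AE_I2) (intro tendsto_intros lim)
  qed (use f in auto)
  have 2: "(\<lambda>n. \<integral>x. (f n x - f0 x) * W n x \<partial>M) \<longlonglongrightarrow> 0"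
  proof (rule Lim_null_comparison)
    have "(\<lambda>n. B * (\<integral>x. \<bar>f n x - f0 x\<bar> \<partial>M)) \<longlonglongrightarrow> B * 0" by (intro tendsto_intros f)
    then show "(\<lambda>n. B * (\<integral>x. \<bar>f n x - f0 x\<bar> \<partial>M)) \<longlonglongrightarrow> 0" by simp
    show "\<forall>\<^sub>F n in sequentially. norm (\<integral>x. (f n x - f0 x) * W n x \<partial>M) \<le> B * (\<integral>x. \<bar>f n x - f0 x\<bar> \<partial>M)"
    proof (rule always_eventually, rule allI)
      fix n
      have i: "integrable M (\<lambda>x. f n x - f0 x)" using f by auto
      have "\<bar>\<integral>x. (f n x - f0 x) * W n x \<partial>M\<bar> \<le> (\<integral>x. \<bar>(f n x - f0 x) * W n x\<bar> \<partial>M)"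
        by (rule integral_abs_bound)
      also have "\<dots> \<le> (\<integral>x. B * \<bar>f n x - f0 x\<bar> \<partial>M)"
        by (rule integral_mono[OF integrable_abs[OF bound[OF i]]])
           (use i in \<open>auto simp: abs_mult mult.commute[of B] mult_left_mono B\<close>)
      finally show "norm (\<integral>x. (f n x - f0 x) * W n x \<partial>M) \<le> B * (\<integral>x. \<bar>f n x - f0 x\<bar> \<partial>M)" by simp
    qed
  qed
  have "(\<integral>x. (f n x - f0 x) * W n x \<partial>M) + (\<integral>x. f0 x * W n x \<partial>M) = (\<integral>x. f n x * W n x \<partial>M)" for n
    using bound[OF f(1), of n n] bound[OF f(2), of n] by (simp add: left_diff_distrib)
  then show ?thesis using tendsto_add[OF 2 1] by simp
qed

text \<open>
  Boxes are an intersection-stable generator of the Borel sets. The sets over which \<open>g\<close> has integral zero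
  are closed under disjoint unions and, since boxes exhaust the space and hence the total integral vanishes,
  under complements.
\<close>

lemma AE_zero_of_box_integrals:
  fixes g :: "'a::euclidean_space \<Rightarrow> real"
  assumes g: "integrable lborel g" and box: "\<And>a b. (\<integral>x. indicator (box a b) x * g x \<partial>lborel) = 0"
  shows "AE x in lborel. g x = 0"
proof -
  let ?\<I> = "\<lambda>A. \<integral>x. indicator A x * g x \<partial>lborel"
  have [measurable]: "g \<in> borel_measurable borel" using g by auto
  have int: "integrable lborel (\<lambda>x. indicator A x * g x)" if "A \<in> sets borel" for A
    using integrable_mult_indicator[OF _ g, of A] that by simp
  have UN: "?\<I> UNIV = 0"
  proof -
    have "(\<lambda>n. ?\<I> (box (- (real n *\<^sub>R One)) (real n *\<^sub>R One))) \<longlonglongrightarrow> ?\<I> UNIV"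
    proof (rule integral_dominated_convergence[where w = "\<lambda>x. \<bar>g x\<bar>"])
      show "AE x in lborel. (\<lambda>n. indicator (box (- (real n *\<^sub>R One)) (real n *\<^sub>R One)) x * g x) \<longlonglongrightarrow> indicator UNIV x * g x"
      proof (rule AE_I2)
        fix x :: 'a
        obtain N where N: "norm x < real N" using reals_Archimedean2 by blast
        have "\<forall>\<^sub>F n in sequentially. indicator (box (- (real n *\<^sub>R One)) (real n *\<^sub>R One)) x * g x = indicator UNIV x * g x"
          using eventually_ge_at_top[of N]
        proof eventually_elim
          case (elim n)
          have "x \<in> box (- (real n *\<^sub>R One)) (real n *\<^sub>R One)"
            unfolding mem_box
          proof (intro ballI)
            fix i :: 'a assume i: "i \<in> Basis"
            have "\<bar>x \<bullet> i\<bar> < real n" using Basis_le_norm[OF i, of x] N elim by linarith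
            then show "- (real n *\<^sub>R One) \<bullet> i < x \<bullet> i \<and> x \<bullet> i < real n *\<^sub>R One \<bullet> i"
              using i by (auto simp: inner_sum_left_Basis)
          qed
          then show ?case by simp
        qed
        then show "(\<lambda>n. indicator (box (- (real n *\<^sub>R One)) (real n *\<^sub>R One)) x * g x) \<longlonglongrightarrow> indicator UNIV x * g x"
          by (rule tendsto_eventually)
      qed
      show "AE x in lborel. norm (indicator (box (- (real n *\<^sub>R One)) (real n *\<^sub>R One)) x * g x) \<le> \<bar>g x\<bar>" for n
        by (rule AE_I2) (auto simp: indicator_def)
    qed (use g in auto)
    then show ?thesis using box by (simp add: LIMSEQ_const_iff)
  qed
  have zero: "?\<I> A = 0" if "A \<in> sets borel" for A
  proof -
    have "Int_stable (range (\<lambda>(a, b). box a b :: 'a set))"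
      by (auto simp: Int_stable_def box_Int_box)
    moreover have "range (\<lambda>(a, b). box a b :: 'a set) \<subseteq> Pow UNIV" by simp
    moreover have "A \<in> sigma_sets UNIV (range (\<lambda>(a, b). box a b :: 'a set))"
      using that by (simp add: borel_eq_box)
    ultimately show ?thesis
    proof (induction rule: sigma_sets_induct_disjoint)
      case (basic A)
      then show ?case using box by auto
    next
      case (compl A)
      then have A: "A \<in> sets borel" by (simp add: borel_eq_box)
      have "?\<I> (UNIV - A) = ?\<I> UNIV - ?\<I> A"
      proof -
        have "indicator (UNIV - A) x * g x = indicator UNIV x * g x - indicator A x * g x" for x
          by (auto simp: indicator_def)
        then show ?thesis
          using Bochner_Integration.integral_diff[OF int[of UNIV] int[OF A]] by simp
      qed
      then show ?case using UN compl by simp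
    next
      case (union A)
      then have A: "A i \<in> sets borel" for i by (auto simp: borel_eq_box)
      have "(\<lambda>n. ?\<I> (\<Union>i<n. A i)) \<longlonglongrightarrow> ?\<I> (\<Union>i. A i)"
      proof (rule integral_dominated_convergence[where w = "\<lambda>x. \<bar>g x\<bar>"])
        show "AE x in lborel. (\<lambda>n. indicator (\<Union>i<n. A i) x * g x) \<longlonglongrightarrow> indicator (\<Union>i. A i) x * g x"
          by (intro AE_I2 tendsto_intros LIMSEQ_indicator_UN)
        show "AE x in lborel. norm (indicator (\<Union>i<n. A i) x * g x) \<le> \<bar>g x\<bar>" for n
          by (rule AE_I2) (auto simp: indicator_def)
      qed (use g A in auto)
      moreover have "?\<I> (\<Union>i<n. A i) = 0" for n
      proof (induction n)
        case (Suc n)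
        have "A n \<inter> A i = {}" if "i < n" for i
          using disjoint_family_onD[OF union(1), of n i] that by auto
        then have "A n \<inter> (\<Union>i<n. A i) = {}" by blast
        then have "indicator (\<Union>i<Suc n. A i) x * g x = indicator (A n) x * g x + indicator (\<Union>i<n. A i) x * g x" for x
          by (auto simp: lessThan_Suc indicator_def)
        then have "?\<I> (\<Union>i<Suc n. A i) = ?\<I> (A n) + ?\<I> (\<Union>i<n. A i)"
          using int[of "A n"] int[of "\<Union>i<n. A i"] A by simp
        then show ?case using Suc union by simp
      qed simp
      ultimately show ?case by (simp add: LIMSEQ_const_iff)
    qed simp
  qed
  have "AE x in lborel. g x = (\<lambda>_. 0) x"
    by (rule density_unique_real) (use g zero in \<open>auto simp: set_lebesgue_integral_def\<close>)
  then show ?thesis by simp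
qed

section \<open>Moments along the flow\<close>

lemma integrable_compact_mult:
  fixes f g :: "'a::euclidean_space \<Rightarrow> real"
  assumes f: "set_integrable lborel K f" and K: "compact K" and g: "continuous_on K g"
  shows "integrable lborel (\<lambda>p. indicator K p * (f p * g p))"
proof -
  have "bounded (g ` K)" using K g compact_continuous_image compact_imp_bounded by blast
  then obtain B where B: "\<And>p. p \<in> K \<Longrightarrow> \<bar>g p\<bar> \<le> B" unfolding bounded_iff by auto
  have [measurable]: "K \<in> sets borel" using K by (rule borel_compact)
  have gm: "(\<lambda>p. indicator K p *\<^sub>R g p) \<in> borel_measurable borel"
    using g by (intro borel_measurable_continuous_on_indicator) auto
  have fi: "integrable lborel (\<lambda>p. indicator K p * f p)" using f by (simp add: set_integrable_def)
  have eq: "indicator K p * (f p * g p) = (indicator K p * f p) * (indicator K p *\<^sub>R g p)" for p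
    by (simp add: indicator_def)
  show ?thesis
    unfolding eq
  proof (rule Bochner_Integration.integrable_bound[where f = "\<lambda>p. B * (indicator K p * f p)"])
    show "integrable lborel (\<lambda>p. B * (indicator K p * f p))" using fi by (rule integrable_mult_right)
    show "(\<lambda>p. indicator K p * f p * indicator K p *\<^sub>R g p) \<in> borel_measurable lborel"
      using borel_measurable_integrable[OF fi] gm by simp
    show "AE p in lborel. norm (indicator K p * f p * indicator K p *\<^sub>R g p) \<le> norm (B * (indicator K p * f p))"
    proof (rule AE_I2)
      fix p
      show "norm (indicator K p * f p * indicator K p *\<^sub>R g p) \<le> norm (B * (indicator K p * f p))"
      proof (cases "p \<in> K")
        case True
        then have "\<bar>g p\<bar> \<le> \<bar>B\<bar>" using B[OF True] by linarith
        then have "\<bar>f p\<bar> * \<bar>g p\<bar> \<le> \<bar>f p\<bar> * \<bar>B\<bar>" by (intro mult_left_mono) auto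
        then show ?thesis using True by (simp add: abs_mult mult.commute)
      qed simp
    qed
  qed
qed

text \<open>
  The weight that localises a moment: a bump in the energy variable \<open>\<xi>\<^sub>1\<^sup>2 - 2t\<close>, where \<open>t\<close> stands for
  \<open>\<phi>(x)\<close>, a smooth restriction to the sign \<open>\<sigma>\<close> of \<open>\<xi>\<^sub>1\<close>, and a bump in each component of \<open>\<xi>'\<close>.
\<close>

definition moment_weight :: "real \<Rightarrow> real \<Rightarrow> real \<Rightarrow> real \<Rightarrow> real \<Rightarrow> real ^ 2 \<Rightarrow> real ^ 2 \<Rightarrow> real \<Rightarrow> vel \<Rightarrow> real" where
  "moment_weight n A B \<sigma> c l u t \<xi> = bump n A B ((fst \<xi>)\<^sup>2 - 2 * t) * smoothstep (\<sigma> * fst \<xi> / c)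
     * (bump n (l $ 1) (u $ 1) (snd \<xi> $ 1) * bump n (l $ 2) (u $ 2) (snd \<xi> $ 2))"

lemma moment_weight_bounds: "0 \<le> moment_weight n A B \<sigma> c l u t \<xi>" "moment_weight n A B \<sigma> c l u t \<xi> \<le> 1"
  unfolding moment_weight_def using bump_bounds smoothstep_bounds
  by (auto intro!: mult_nonneg_nonneg mult_le_one)

lemma moment_weight_nonzeroD:
  assumes "moment_weight n A B \<sigma> c l u t \<xi> \<noteq> 0" "n \<ge> 0" "t \<le> 0"
  shows "A < (fst \<xi>)\<^sup>2 - 2 * t" "\<bar>fst \<xi>\<bar> \<le> sqrt \<bar>B\<bar>" "snd \<xi> \<in> cbox l u"
proof -
  have nz: "bump n A B ((fst \<xi>)\<^sup>2 - 2 * t) \<noteq> 0" "bump n (l $ 1) (u $ 1) (snd \<xi> $ 1) \<noteq> 0"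
    "bump n (l $ 2) (u $ 2) (snd \<xi> $ 2) \<noteq> 0" using assms(1) by (auto simp: moment_weight_def)
  then have mem: "(fst \<xi>)\<^sup>2 - 2 * t \<in> {A<..<B}" "snd \<xi> $ 1 \<in> {l $ 1<..<u $ 1}" "snd \<xi> $ 2 \<in> {l $ 2<..<u $ 2}"
    using bump_outside[OF assms(2)] by blast+
  then show "A < (fst \<xi>)\<^sup>2 - 2 * t" by simp
  show "snd \<xi> \<in> cbox l u" using mem by (auto simp: mem_box_cart forall_2 less_imp_le)
  have "(fst \<xi>)\<^sup>2 \<le> \<bar>B\<bar>" using mem assms(3) by auto
  then have "sqrt ((fst \<xi>)\<^sup>2) \<le> sqrt \<bar>B\<bar>" by (rule real_sqrt_le_mono)
  then show "\<bar>fst \<xi>\<bar> \<le> sqrt \<bar>B\<bar>" by simp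
qed

lemma measurable_moment_weight [measurable]: "moment_weight n A B \<sigma> c l u t \<in> borel_measurable borel"
  unfolding moment_weight_def[abs_def] divide_inverse
  by (intro borel_measurable_continuous_onI continuous_intros
        continuous_on_compose2[OF continuous_bump[of UNIV]] continuous_on_compose2[OF continuous_smoothstep[of UNIV]]) auto

lemma weight_bounded:
  assumes "n \<ge> 0" "t \<le> 0" shows "\<bar>fst \<xi> * moment_weight n A B \<sigma> c l u t \<xi>\<bar> \<le> sqrt \<bar>B\<bar>"
proof (cases "moment_weight n A B \<sigma> c l u t \<xi> = 0")
  case False
  have "\<bar>fst \<xi>\<bar> * \<bar>moment_weight n A B \<sigma> c l u t \<xi>\<bar> \<le> sqrt \<bar>B\<bar> * 1"
    using moment_weight_nonzeroD(2)[OF False assms] moment_weight_bounds[of n A B \<sigma> c l u t \<xi>] by (intro mult_mono) auto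
  then show ?thesis by (simp add: abs_mult)
qed simp

lemma tendsto_moment_weight:
  assumes "t \<longlonglongrightarrow> t0"
  shows "(\<lambda>k. fst \<xi> * moment_weight n A B \<sigma> c l u (t k) \<xi>) \<longlonglongrightarrow> fst \<xi> * moment_weight n A B \<sigma> c l u t0 \<xi>"
proof -
  have "isCont (bump n A B) s" for s using DERIV_bump by (rule DERIV_isCont)
  then have "(\<lambda>k. bump n A B ((fst \<xi>)\<^sup>2 - 2 * t k)) \<longlonglongrightarrow> bump n A B ((fst \<xi>)\<^sup>2 - 2 * t0)"
    by (rule isCont_tendsto_compose) (intro tendsto_intros assms)
  then show ?thesis unfolding moment_weight_def by (intro tendsto_intros)
qed

lemma tendsto_moment:
  assumes f: "\<And>k. integrable lborel (f k)" "integrable lborel f0"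
      "(\<lambda>k. \<integral>\<xi>. \<bar>f k \<xi> - f0 \<xi>\<bar> \<partial>lborel) \<longlonglongrightarrow> 0"
    and t: "t \<longlonglongrightarrow> t0" "\<And>k. t k \<le> 0" and n: "n \<ge> 0"
  shows "(\<lambda>k. \<integral>\<xi>. f k \<xi> * (fst \<xi> * moment_weight n A B \<sigma> c l u (t k) \<xi>) \<partial>lborel)
    \<longlonglongrightarrow> (\<integral>\<xi>. f0 \<xi> * (fst \<xi> * moment_weight n A B \<sigma> c l u t0 \<xi>) \<partial>lborel)"
  by (rule tendsto_integral_mult_bounded[where B = "sqrt \<bar>B\<bar>", OF f])
     (use weight_bounded[OF n] t tendsto_moment_weight in auto)

lemma C_L1_D:
  assumes "C_L1 f" "\<And>k. x k \<ge> 0" "x0 \<ge> 0" "x \<longlonglongrightarrow> x0"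
  shows "(\<lambda>k. \<integral>\<xi>. \<bar>f (x k) \<xi> - f x0 \<xi>\<bar> \<partial>lborel) \<longlonglongrightarrow> 0"
proof -
  have lim: "((\<lambda>x. \<integral>\<xi>. \<bar>f x \<xi> - f x0 \<xi>\<bar> \<partial>lborel) \<longlongrightarrow> 0) (at x0 within {0..})"
    using assms unfolding C_L1_def by blast
  then have "((\<lambda>x. \<integral>\<xi>. \<bar>f x \<xi> - f x0 \<xi>\<bar> \<partial>lborel) \<longlongrightarrow> (\<integral>\<xi>. \<bar>f x0 \<xi> - f x0 \<xi>\<bar> \<partial>lborel)) (at x0 within {0..})"
    by simp
  then have "continuous (at x0 within {0..}) (\<lambda>x. \<integral>\<xi>. \<bar>f x \<xi> - f x0 \<xi>\<bar> \<partial>lborel)"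
    by (simp add: continuous_within)
  then have "((\<lambda>x. \<integral>\<xi>. \<bar>f x \<xi> - f x0 \<xi>\<bar> \<partial>lborel) \<circ> x) \<longlonglongrightarrow> (\<integral>\<xi>. \<bar>f x0 \<xi> - f x0 \<xi>\<bar> \<partial>lborel)"
    using assms(2-4) unfolding continuous_within_sequentially by auto
  then show ?thesis by (simp add: comp_def)
qed

lemma partial_x_eq:
  assumes "((\<lambda>y. \<psi> (y, \<xi>)) has_real_derivative d) (at x within {0..})" "x \<ge> 0"
  shows "partial_x \<psi> x \<xi> = d"
  unfolding partial_x_def using assms by (intro deriv_on_eqI[where y = "x + 1"]) auto

lemma partial_\<xi>1_eq:
  assumes "((\<lambda>s. \<psi> (x, s, snd \<xi>)) has_real_derivative d) (at (fst \<xi>))"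
  shows "partial_\<xi>1 \<psi> x \<xi> = d"
  unfolding partial_\<xi>1_def using assms by (intro deriv_on_eqI[where y = "fst \<xi> + 1"]) auto

definition phase :: "(real \<times> vel) set" where "phase = {0..} \<times> UNIV"

lemma C1_on_fst: "C1_on D (\<lambda>p :: real \<times> vel. fst p)"
  by (rule C1_on_bounded_linear[OF bounded_linear_fst])

lemma C1_on_vel1: "C1_on D (\<lambda>p :: real \<times> vel. fst (snd p))"
  by (rule C1_on_bounded_linear[OF bounded_linear_compose[OF bounded_linear_fst bounded_linear_snd]])

lemma C1_on_vel': "C1_on D (\<lambda>p :: real \<times> vel. snd (snd p) $ i)"
  by (rule C1_on_bounded_linear[OF bounded_linear_compose[OF bounded_linear_vec_nth
        bounded_linear_compose[OF bounded_linear_snd bounded_linear_snd]]])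

lemmas C1_coordinates = C1_on_fst C1_on_vel1 C1_on_vel'

lemma C1_on_const: "C1_on D (\<lambda>_. c)"
  unfolding C1_on_def by (rule exI[of _ "\<lambda>_. 0"]) (simp add: zero_blinfun.rep_eq)

lemma C1_on_compose_real:
  assumes "C1_on D \<psi>" "\<And>t. (h has_real_derivative h' t) (at t)" "continuous_on UNIV h'"
  shows "C1_on D (\<lambda>p. h (\<psi> p))"
  by (rule C1_on_compose[OF assms(1) _ assms(3)]) (simp_all add: assms(2))

text \<open>
  The qualitative properties of a potential under which every characteristic can be followed to infinity.
\<close>

locale monotone_profile =
  fixes \<phi> p :: "real \<Rightarrow> real"
  assumes d: "x \<ge> 0 \<Longrightarrow> (\<phi> has_real_derivative p x) (at x within {0..})"
    and pc: "continuous_on {0..} p"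
    and mono: "0 \<le> x \<Longrightarrow> x < y \<Longrightarrow> \<phi> x < \<phi> y"
    and neg: "x \<ge> 0 \<Longrightarrow> \<phi> x < 0"
begin

lemma p_eq: "x \<ge> 0 \<Longrightarrow> deriv_on {0..} \<phi> x = p x"
  using d[of x] by (intro deriv_on_eqI[where y = "x + 1"]) auto

lemma \<phi>_cont: "continuous_on {0..} \<phi>"
  using d by (intro DERIV_continuous_on) auto

lemma \<phi>_tendsto:
  assumes "\<And>k. x k \<ge> 0" "x0 \<ge> 0" "x \<longlonglongrightarrow> x0" shows "(\<lambda>k. \<phi> (x k)) \<longlonglongrightarrow> \<phi> x0"
  using \<phi>_cont assms unfolding continuous_on_sequentially by (auto simp: comp_def)

lemma C1_moment_weight: "C1_on phase (\<lambda>q. moment_weight n A B \<sigma> c l u (\<phi> (fst q)) (snd q))"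
proof -
  have \<phi>1: "C1_on phase (\<lambda>q. \<phi> (fst q))"
    by (rule C1_on_compose[OF C1_coordinates(1), where T = "{0..}" and h' = p])
       (use d pc in \<open>auto simp: phase_def\<close>)
  have b: "C1_on phase \<psi> \<Longrightarrow> C1_on phase (\<lambda>q. bump n a b (\<psi> q))" for \<psi> n a b
    by (rule C1_on_compose_real[OF _ DERIV_bump continuous_bump'])
  have s: "C1_on phase \<psi> \<Longrightarrow> C1_on phase (\<lambda>q. smoothstep (\<psi> q))" for \<psi>
    by (rule C1_on_compose_real[OF _ DERIV_smoothstep continuous_smoothstep'])
  have "C1_on phase (\<lambda>q. (fst (snd q))\<^sup>2 - 2 * \<phi> (fst q))"
    unfolding power2_eq_square by (intro C1_on_diff C1_on_mult C1_coordinates \<phi>1 C1_on_const)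
  moreover have "C1_on phase (\<lambda>q. \<sigma> * fst (snd q) / c)"
    using C1_on_mult[OF C1_on_const[of phase "\<sigma> / c"] C1_coordinates(2)] by simp
  ultimately show ?thesis
    unfolding moment_weight_def by (intro C1_on_mult b s C1_coordinates)
qed

text \<open>
  The test function is \<open>\<eta>(x)\<close> times the weight, where \<open>\<eta>\<close> rises smoothly from \<open>0\<close> to \<open>1\<close> near \<open>y\<close> and falls
  back near \<open>z\<close>. As functions of the energy are annihilated by the transport operator, only the term with
  \<open>\<eta>'\<close> survives, and it is a difference of approximate identities at \<open>y\<close> and \<open>z\<close>. The restriction to one
  sign of \<open>\<xi>\<^sub>1\<close> is harmless: for \<open>x \<ge> y\<close> the support of the energy bump lies in \<open>|\<xi>\<^sub>1| \<ge> c\<close>, where the smooth sign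
  is constant.
\<close>

lemma moment_conserved:
  assumes weak: "weak_Vlasov \<alpha> f_b f \<phi>"
    and L1: "L1_loc ({0..} \<times> UNIV) (\<lambda>(x, \<xi>). f x \<xi>)" and CL: "C_L1 f"
    and y: "0 < y" "y < z" and n: "n \<ge> 0" and c: "c > 0" "c\<^sup>2 \<le> A + 2 * \<phi> y" and \<sigma>: "\<bar>\<sigma>\<bar> = 1"
  shows "(\<integral>\<xi>. f y \<xi> * (fst \<xi> * moment_weight n A B \<sigma> c l u (\<phi> y) \<xi>) \<partial>lborel)
       = (\<integral>\<xi>. f z \<xi> * (fst \<xi> * moment_weight n A B \<sigma> c l u (\<phi> z) \<xi>) \<partial>lborel)"
proof -
  define w where "w x = moment_weight n A B \<sigma> c l u (\<phi> x)" for x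
  define M where "M x = (\<integral>\<xi>. f x \<xi> * (fst \<xi> * w x \<xi>) \<partial>lborel)" for x
  have Mc: "continuous_on {0..} M"
    unfolding continuous_on_sequentially
  proof (intro allI ballI impI, elim conjE)
    fix x :: "nat \<Rightarrow> real" and x0 assume x: "x0 \<in> {0..}" "\<forall>k. x k \<in> {0..}" "x \<longlonglongrightarrow> x0"
    then have x': "\<And>k. x k \<ge> 0" "x0 \<ge> 0" by auto
    have "(\<lambda>k. M (x k)) \<longlonglongrightarrow> M x0"
      unfolding M_def w_def
      using CL x' neg by (intro tendsto_moment C_L1_D \<phi>_tendsto x n) (auto simp: C_L1_def less_imp_le)
    then show "(M \<circ> x) \<longlonglongrightarrow> M x0" by (simp add: comp_def)
  qed
  have key: "\<bar>M y - M z\<bar> \<le> 2 * e" if e: "e > 0" for e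
  proof -
    obtain d1 where d1: "d1 > 0" "\<And>\<delta>. 0 < \<delta> \<Longrightarrow> \<delta> \<le> d1 \<Longrightarrow>
      integrable lborel (\<lambda>x. indicator {y..y + \<delta>} x * (smoothstep' ((x - y) / \<delta>) / \<delta> * M x)) \<and>
      \<bar>(\<integral>x. indicator {y..y + \<delta>} x * (smoothstep' ((x - y) / \<delta>) / \<delta> * M x) \<partial>lborel) - M y\<bar> \<le> e"
      using approximate_identity[of y M e] e continuous_on_subset[OF Mc, of "{y..y+1}"] y by auto
    obtain d2 where d2: "d2 > 0" "\<And>\<delta>. 0 < \<delta> \<Longrightarrow> \<delta> \<le> d2 \<Longrightarrow>
      integrable lborel (\<lambda>x. indicator {z..z + \<delta>} x * (smoothstep' ((x - z) / \<delta>) / \<delta> * M x)) \<and>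
      \<bar>(\<integral>x. indicator {z..z + \<delta>} x * (smoothstep' ((x - z) / \<delta>) / \<delta> * M x) \<partial>lborel) - M z\<bar> \<le> e"
      using approximate_identity[of z M e] e continuous_on_subset[OF Mc, of "{z..z+1}"] y by auto
    define \<delta> where "\<delta> = min d1 (min d2 (z - y))"
    have \<delta>: "\<delta> > 0" "\<delta> \<le> d1" "\<delta> \<le> d2" "y + \<delta> \<le> z" using d1(1) d2(1) y by (auto simp: \<delta>_def)
    define \<eta> where "\<eta> x = smoothstep ((x - y) / \<delta>) - smoothstep ((x - z) / \<delta>)" for x
    define \<eta>' where "\<eta>' x = smoothstep' ((x - y) / \<delta>) / \<delta> - smoothstep' ((x - z) / \<delta>) / \<delta>" for x
    have S: "((\<lambda>x. smoothstep ((x - a) / \<delta>)) has_real_derivative smoothstep' ((x - a) / \<delta>) / \<delta>) (at x)" for a x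
      by (rule DERIV_cong[OF DERIV_chain2[OF DERIV_smoothstep, of _ "1 / \<delta>"]])
         (use \<delta> in \<open>auto intro!: derivative_eq_intros\<close>)
    have \<eta>d: "(\<eta> has_real_derivative \<eta>' x) (at x)" for x
      unfolding \<eta>_def[abs_def] \<eta>'_def by (intro DERIV_diff S)
    have \<eta>'c: "continuous_on X \<eta>'" for X
      unfolding \<eta>'_def[abs_def] using \<delta>(1)
      by (intro continuous_intros continuous_on_compose2[OF continuous_smoothstep']) auto
    have \<eta>0: "\<eta> x = 0" "\<eta>' x = 0" if "x \<notin> {y<..<z + \<delta>}" for x
    proof -
      have "x \<le> y \<or> x \<ge> z + \<delta>" using that by auto
      then have "(x - y) / \<delta> \<le> 0 \<and> (x - z) / \<delta> \<le> 0 \<or> (x - y) / \<delta> \<ge> 1 \<and> (x - z) / \<delta> \<ge> 1"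
        using \<delta> y by (auto simp: field_simps)
      then show "\<eta> x = 0" "\<eta>' x = 0"
        by (auto simp: \<eta>_def \<eta>'_def smoothstep_le_0 smoothstep_ge_1 smoothstep'_le_0 smoothstep'_ge_1)
    qed
    define \<psi> where "\<psi> q = \<eta> (fst q) * w (fst q) (snd q)" for q :: "real \<times> vel"
    define K where "K = {y..z + \<delta>} \<times> ({- sqrt \<bar>B\<bar>..sqrt \<bar>B\<bar>} \<times> cbox l u)"
    have K: "compact K" "K \<subseteq> {0..} \<times> UNIV" "K \<subseteq> phase"
      using y unfolding K_def phase_def by (auto intro!: compact_Times)
    have wK: "q \<in> K" if "w (fst q) (snd q) \<noteq> 0" "fst q \<in> {y<..<z + \<delta>}" for q
      using moment_weight_nonzeroD(2,3)[OF that(1)[unfolded w_def] n] neg[of "fst q"] that(2) y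
      by (cases q) (auto simp: K_def mem_Times_iff abs_le_iff)
    have \<psi>C: "C1_on phase \<psi>"
      unfolding \<psi>_def w_def
      by (intro C1_on_mult C1_moment_weight C1_on_compose_real[OF C1_coordinates(1) \<eta>d \<eta>'c])
    have "C1_compact \<psi>"
      unfolding C1_compact_def
    proof (intro conjI exI[of _ K] K)
      show "\<exists>\<psi>'. (\<forall>p\<in>{0..} \<times> UNIV. (\<psi> has_derivative blinfun_apply (\<psi>' p)) (at p within {0..} \<times> UNIV)) \<and>
         continuous_on ({0..} \<times> UNIV) \<psi>'"
        using \<psi>C unfolding C1_on_def phase_def .
      show "\<forall>q\<in>{0..} \<times> UNIV - K. \<psi> q = 0"
        using wK \<eta>0(1) by (auto simp: \<psi>_def)
    qed
    moreover have \<psi>0: "\<psi> (0, \<xi>) = 0" for \<xi> using \<eta>0(1)[of 0] y by (simp add: \<psi>_def)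
    ultimately have "\<psi> \<in> test_functions \<alpha>" by (simp add: test_functions_def)
    then have W: "(LINT p : {0<..} \<times> UNIV | lborel.
           (case p of (x, \<xi>) \<Rightarrow>
              f x \<xi> * (fst \<xi> * partial_x \<psi> x \<xi> + deriv_on {0..} \<phi> x * partial_\<xi>1 \<psi> x \<xi>)))
        + (LINT \<xi> : half_space | lborel. f_b \<xi> * (fst \<xi> * \<psi> (0, \<xi>))) = 0"
      using weak unfolding weak_Vlasov_def by blast
    have transport: "fst \<xi> * partial_x \<psi> x \<xi> + deriv_on {0..} \<phi> x * partial_\<xi>1 \<psi> x \<xi> = \<eta>' x * (fst \<xi> * w x \<xi>)"
      if x: "x > 0" for x and \<xi> :: vel
    proof -
      define E where "E = (fst \<xi>)\<^sup>2 - 2 * \<phi> x"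
      define S where "S = smoothstep (\<sigma> * fst \<xi> / c)"
      define H where "H = bump n (l $ 1) (u $ 1) (snd \<xi> $ 1) * bump n (l $ 2) (u $ 2) (snd \<xi> $ 2)"
      have 1: "partial_x \<psi> x \<xi> = \<eta>' x * (bump n A B E * S * H) + (bump' n A B E * (- 2 * p x) * S * H) * \<eta> x"
      proof (rule partial_x_eq)
        have "((\<lambda>y. bump n A B ((fst \<xi>)\<^sup>2 - 2 * \<phi> y)) has_real_derivative bump' n A B E * (- 2 * p x)) (at x within {0..})"
          unfolding E_def
          by (rule DERIV_chain2[OF DERIV_bump]) (use d[of x] x in \<open>auto intro!: derivative_eq_intros\<close>)
        then have "((\<lambda>y. bump n A B ((fst \<xi>)\<^sup>2 - 2 * \<phi> y) * S * H) has_real_derivative bump' n A B E * (- 2 * p x) * S * H) (at x within {0..})"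
          by (intro DERIV_cmult_right)
        from DERIV_mult[OF has_field_derivative_at_within[OF \<eta>d] this]
        show "((\<lambda>y. \<psi> (y, \<xi>)) has_real_derivative
          \<eta>' x * (bump n A B E * S * H) + (bump' n A B E * (- 2 * p x) * S * H) * \<eta> x) (at x within {0..})"
          by (simp add: \<psi>_def w_def moment_weight_def E_def S_def H_def)
      qed (use x in simp)
      have 2: "partial_\<xi>1 \<psi> x \<xi> = \<eta> x * ((bump' n A B E * (2 * fst \<xi>) * S + smoothstep' (\<sigma> * fst \<xi> / c) * (\<sigma> / c) * bump n A B E) * H)"
      proof (rule partial_\<xi>1_eq)
        have b: "((\<lambda>s. bump n A B (s\<^sup>2 - 2 * \<phi> x)) has_real_derivative bump' n A B E * (2 * fst \<xi>)) (at (fst \<xi>))"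
          unfolding E_def
          by (rule DERIV_chain2[OF DERIV_bump]) (auto intro!: derivative_eq_intros)
        have s: "((\<lambda>s. smoothstep (\<sigma> * s / c)) has_real_derivative smoothstep' (\<sigma> * fst \<xi> / c) * (\<sigma> / c)) (at (fst \<xi>))"
          by (rule DERIV_chain2[OF DERIV_smoothstep]) (use c in \<open>auto intro!: derivative_eq_intros\<close>)
        from DERIV_cmult[OF DERIV_cmult_right[OF DERIV_mult[OF b s], of H], of "\<eta> x"]
        show "((\<lambda>s. \<psi> (x, s, snd \<xi>)) has_real_derivative
          \<eta> x * ((bump' n A B E * (2 * fst \<xi>) * S + smoothstep' (\<sigma> * fst \<xi> / c) * (\<sigma> / c) * bump n A B E) * H)) (at (fst \<xi>))"
          by (simp add: \<psi>_def w_def moment_weight_def E_def S_def H_def)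
      qed
      \<comment> \<open>The derivative of the smooth sign never meets the energy bump.\<close>
      have 3: "\<eta> x * (smoothstep' (\<sigma> * fst \<xi> / c) * bump n A B E) = 0"
      proof (rule ccontr)
        assume "\<not> ?thesis"
        then have nz: "\<eta> x \<noteq> 0" "smoothstep' (\<sigma> * fst \<xi> / c) \<noteq> 0" "bump n A B E \<noteq> 0" by auto
        from nz(1) have "x > y" using \<eta>0(1)[of x] by (cases "x > y") auto
        then have "\<phi> y < \<phi> x" using mono y by simp
        moreover have "A < E" using bump_outside[OF n, of E A B] nz(3) by (cases "E \<in> {A<..<B}") auto
        ultimately have "c\<^sup>2 < (fst \<xi>)\<^sup>2" using c by (simp add: E_def)
        then have "c\<^sup>2 < \<bar>fst \<xi>\<bar>\<^sup>2" by simp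
        then have "c < \<bar>fst \<xi>\<bar>" by (rule power2_less_imp_less) simp
        then have "c < \<bar>\<sigma> * fst \<xi>\<bar>" using \<sigma> by (simp add: abs_mult)
        then have "\<sigma> * fst \<xi> / c \<ge> 1 \<or> \<sigma> * fst \<xi> / c \<le> 0" using c by (auto simp: field_simps abs_if split: if_splits)
        then show False using nz(2) smoothstep'_le_0 smoothstep'_ge_1 by blast
      qed
      have "fst \<xi> * partial_x \<psi> x \<xi> + deriv_on {0..} \<phi> x * partial_\<xi>1 \<psi> x \<xi>
        = \<eta>' x * (fst \<xi> * (bump n A B E * S * H)) + p x * (\<sigma> / c) * H * (\<eta> x * (smoothstep' (\<sigma> * fst \<xi> / c) * bump n A B E))"
        unfolding 1 2 p_eq[OF less_imp_le[OF x]] by (simp add: algebra_simps)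
      then show ?thesis unfolding 3 by (simp add: w_def moment_weight_def E_def S_def H_def)
    qed
    define g where "g q = \<eta>' (fst q) * (fst (snd q) * w (fst q) (snd q))" for q :: "real \<times> vel"
    have gc: "continuous_on K g"
      unfolding g_def w_def
      by (intro continuous_intros continuous_on_compose2[OF \<eta>'c] C1_on_continuous continuous_on_subset[OF C1_on_continuous[OF C1_moment_weight] K(3)]) auto
    have gi: "integrable lborel (\<lambda>q. indicator K q * ((case q of (x, \<xi>) \<Rightarrow> f x \<xi>) * g q))"
      using L1 K unfolding L1_loc_def by (intro integrable_compact_mult gc) auto
    have gout: "g q = 0" if "q \<notin> K" for q
      using that wK[of q] \<eta>0(2)[of "fst q"] by (auto simp: g_def)
    have "0 = (\<integral>q. indicator K q * ((case q of (x, \<xi>) \<Rightarrow> f x \<xi>) * g q) \<partial>lborel)"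
    proof -
      have "(LINT p : {0<..} \<times> UNIV | lborel.
           (case p of (x, \<xi>) \<Rightarrow> f x \<xi> * (fst \<xi> * partial_x \<psi> x \<xi> + deriv_on {0..} \<phi> x * partial_\<xi>1 \<psi> x \<xi>))) = 0"
        using W by (simp add: \<psi>0)
      moreover have "indicator ({0<..} \<times> UNIV) q *\<^sub>R (case q of (x, \<xi>) \<Rightarrow>
            f x \<xi> * (fst \<xi> * partial_x \<psi> x \<xi> + deriv_on {0..} \<phi> x * partial_\<xi>1 \<psi> x \<xi>))
          = indicator K q * ((case q of (x, \<xi>) \<Rightarrow> f x \<xi>) * g q)" for q :: "real \<times> vel"
      proof (cases "fst q > 0")
        case True
        then show ?thesis using transport[OF True] gout[of q]
          by (cases q; cases "q \<in> K") (auto simp: g_def)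
      next
        case False
        then have "q \<notin> K" using y by (auto simp: K_def)
        then show ?thesis using False by (auto simp: indicator_def)
      qed
      ultimately show ?thesis unfolding set_lebesgue_integral_def by simp
    qed
    also have "\<dots> = (\<integral>x. \<integral>\<xi>. indicator K (x, \<xi>) * (f x \<xi> * g (x, \<xi>)) \<partial>lborel \<partial>lborel)"
      using lborel_pair.integral_fst'[of "\<lambda>q. indicator K q * ((case q of (x, \<xi>) \<Rightarrow> f x \<xi>) * g q)"] gi
      by (simp add: lborel_prod)
    also have "\<dots> = (\<integral>x. \<eta>' x * M x \<partial>lborel)"
    proof (rule Bochner_Integration.integral_cong[OF refl])
      fix x
      have "(\<integral>\<xi>. indicator K (x, \<xi>) * (f x \<xi> * g (x, \<xi>)) \<partial>lborel) = (\<integral>\<xi>. \<eta>' x * (f x \<xi> * (fst \<xi> * w x \<xi>)) \<partial>lborel)"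
      proof (rule Bochner_Integration.integral_cong[OF refl])
        fix \<xi>
        show "indicator K (x, \<xi>) * (f x \<xi> * g (x, \<xi>)) = \<eta>' x * (f x \<xi> * (fst \<xi> * w x \<xi>))"
          using gout[of "(x, \<xi>)"] by (cases "(x, \<xi>) \<in> K") (auto simp: g_def)
      qed
      then show "(\<integral>\<xi>. indicator K (x, \<xi>) * (f x \<xi> * g (x, \<xi>)) \<partial>lborel) = \<eta>' x * M x" by (simp add: M_def)
    qed
    also have "\<dots> = (\<integral>x. indicator {y..y + \<delta>} x * (smoothstep' ((x - y) / \<delta>) / \<delta> * M x)
        - indicator {z..z + \<delta>} x * (smoothstep' ((x - z) / \<delta>) / \<delta> * M x) \<partial>lborel)"
    proof (rule Bochner_Integration.integral_cong[OF refl])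
      fix x
      have out: "smoothstep' ((x - a) / \<delta>) = 0" if "x \<notin> {a..a + \<delta>}" for a
      proof -
        have "(x - a) / \<delta> \<le> 0 \<or> (x - a) / \<delta> \<ge> 1" using that \<delta>(1) by (auto simp: field_simps)
        then show ?thesis by (auto simp: smoothstep'_le_0 smoothstep'_ge_1)
      qed
      show "\<eta>' x * M x = indicator {y..y + \<delta>} x * (smoothstep' ((x - y) / \<delta>) / \<delta> * M x)
        - indicator {z..z + \<delta>} x * (smoothstep' ((x - z) / \<delta>) / \<delta> * M x)"
        using out[of y] out[of z]
        by (cases "x \<in> {y..y + \<delta>}"; cases "x \<in> {z..z + \<delta>}") (auto simp: \<eta>'_def left_diff_distrib)
    qed
    also have "\<dots> = (\<integral>x. indicator {y..y + \<delta>} x * (smoothstep' ((x - y) / \<delta>) / \<delta> * M x) \<partial>lborel)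
        - (\<integral>x. indicator {z..z + \<delta>} x * (smoothstep' ((x - z) / \<delta>) / \<delta> * M x) \<partial>lborel)"
      using d1(2)[OF \<delta>(1,2)] d2(2)[OF \<delta>(1,3)] by (intro Bochner_Integration.integral_diff) auto
    finally show ?thesis using d1(2)[OF \<delta>(1,2)] d2(2)[OF \<delta>(1,3)] by linarith
  qed
  have "\<bar>M y - M z\<bar> \<le> 0"
  proof (rule field_le_epsilon)
    fix e :: real assume "e > 0"
    then show "\<bar>M y - M z\<bar> \<le> 0 + e" using key[of "e / 2"] by simp
  qed
  then show ?thesis by (simp add: M_def w_def)
qed

text \<open>
  At every point to the right of \<open>x\<close> the conservation law, with its second point sent to infinity, gives
  the claimed value; at \<open>x\<close> itself, which may be the wall, it follows by continuity from the right.
\<close>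

lemma moment_identity:
  assumes weak: "weak_Vlasov \<alpha> f_b f \<phi>"
    and L1: "L1_loc ({0..} \<times> UNIV) (\<lambda>(x, \<xi>). f x \<xi>)" and CL: "C_L1 f"
    and f_inf: "integrable lborel f_inf" "((\<lambda>x. \<integral>\<xi>. \<bar>f x \<xi> - f_inf \<xi>\<bar> \<partial>lborel) \<longlongrightarrow> 0) at_top"
    and lim: "(\<phi> \<longlongrightarrow> 0) at_top"
    and x: "x \<ge> 0" and n: "n \<ge> 0" and c: "c > 0" "c\<^sup>2 \<le> A + 2 * \<phi> x" and \<sigma>: "\<bar>\<sigma>\<bar> = 1"
  shows "(\<integral>\<xi>. f x \<xi> * (fst \<xi> * moment_weight n A B \<sigma> c l u (\<phi> x) \<xi>) \<partial>lborel)
       = (\<integral>\<xi>. f_inf \<xi> * (fst \<xi> * moment_weight n A B \<sigma> c l u 0 \<xi>) \<partial>lborel)"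
proof -
  define M where "M x = (\<integral>\<xi>. f x \<xi> * (fst \<xi> * moment_weight n A B \<sigma> c l u (\<phi> x) \<xi>) \<partial>lborel)" for x
  define M0 where "M0 = (\<integral>\<xi>. f_inf \<xi> * (fst \<xi> * moment_weight n A B \<sigma> c l u 0 \<xi>) \<partial>lborel)"
  have fi: "integrable lborel (f y)" if "y \<ge> 0" for y using CL that by (auto simp: C_L1_def)
  have c': "c\<^sup>2 \<le> A + 2 * \<phi> y" if "y > x" for y using mono[OF x that] c by linarith
  have Mx: "M y = M0" if "y > x" for y
  proof -
    have y: "y > 0" using that x by simp
    have lim1: "filterlim (\<lambda>k. y + 1 + real k) at_top sequentially"
      by (intro filterlim_tendsto_add_at_top[OF tendsto_const] filterlim_real_sequentially)
    have "(\<lambda>k. M (y + 1 + real k)) \<longlonglongrightarrow> M0"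
      unfolding M_def M0_def
    proof (rule tendsto_moment)
      show "(\<lambda>k. \<integral>\<xi>. \<bar>f (y + 1 + real k) \<xi> - f_inf \<xi>\<bar> \<partial>lborel) \<longlonglongrightarrow> 0"
        using filterlim_compose[OF f_inf(2) lim1] .
      show "(\<lambda>k. \<phi> (y + 1 + real k)) \<longlonglongrightarrow> 0" using filterlim_compose[OF lim lim1] .
      show "\<phi> (y + 1 + real k) \<le> 0" for k using neg[of "y + 1 + real k"] y by simp
    qed (use fi y f_inf n in auto)
    moreover have "M (y + 1 + real k) = M y" for k
      unfolding M_def by (rule moment_conserved[OF weak L1 CL y _ n c(1) c'[OF that] \<sigma>, symmetric]) simp
    ultimately show ?thesis by (simp add: LIMSEQ_const_iff)
  qed
  have pos: "x + 1 / real (Suc k) \<ge> 0" "x + 1 / real (Suc k) > x" for k using x by (auto simp: add_nonneg_nonneg)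
  have "(\<lambda>k. x + 1 / real (Suc k)) \<longlonglongrightarrow> x + 0"
    by (intro tendsto_intros LIMSEQ_inverse_real_of_nat[unfolded inverse_eq_divide])
  then have xl: "(\<lambda>k. x + 1 / real (Suc k)) \<longlonglongrightarrow> x" by simp
  have "(\<lambda>k. M (x + 1 / real (Suc k))) \<longlonglongrightarrow> M x"
    unfolding M_def
    by (rule tendsto_moment[OF fi[OF pos(1)] fi[OF x] C_L1_D[OF CL pos(1) x xl] \<phi>_tendsto[OF pos(1) x xl] less_imp_le[OF neg[OF pos(1)]] n])
  then have "M x = M0" using Mx[OF pos(2)] by (simp add: LIMSEQ_const_iff)
  then show ?thesis by (simp add: M_def M0_def)
qed

end

section \<open>Solutions are transported from infinity\<close>

lemma smoothstep_sign:
  assumes "c > 0" "\<bar>v\<bar> \<ge> c"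
  shows "smoothstep (v / c) = indicator {0<..} v"
proof (cases "v > 0")
  case True
  then have "v / c \<ge> 1" using assms by (simp add: field_simps)
  then show ?thesis using True by (simp add: smoothstep_ge_1)
next
  case False
  then have "v / c \<le> 0" using assms by (simp add: divide_nonpos_pos)
  then show ?thesis using False by (simp add: smoothstep_le_0)
qed

lemma mem_box_vel: "\<xi> \<in> box a b \<longleftrightarrow> fst a < fst \<xi> \<and> fst \<xi> < fst b \<and> snd \<xi> \<in> box (snd a) (snd b)" for \<xi> :: vel
  by (cases \<xi>; cases a; cases b) (auto simp: mem_box Basis_prod_def)

text \<open>
  On a half line of velocities, bounds on \<open>v\<close> are bounds on \<open>v\<^sup>2\<close>, so that intersecting with a box stays
  within the family of sets that moments of the energy can see.
\<close>

lemma vel_cutoff_eq: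
  assumes \<sigma>: "\<sigma> = 1 \<or> \<sigma> = -1"
  shows "\<exists>a' b'. a \<le> a' \<and> (\<forall>v. (a < v\<^sup>2 \<and> v\<^sup>2 < b \<and> \<sigma> * v > 0) \<and> l < v \<and> v < u
     \<longleftrightarrow> a' < v\<^sup>2 \<and> v\<^sup>2 < b' \<and> \<sigma> * v > (0::real))"
proof -
  define L U where "L = (if \<sigma> = 1 then l else - u)" and "U = (if \<sigma> = 1 then u else - l)"
  have lu: "l < v \<and> v < u \<longleftrightarrow> L < \<sigma> * v \<and> \<sigma> * v < U" for v
    using \<sigma> by (auto simp: L_def U_def)
  have sq: "(\<sigma> * v)\<^sup>2 = v\<^sup>2" for v using \<sigma> by auto
  have L: "L < t \<longleftrightarrow> (max 0 L)\<^sup>2 < t\<^sup>2" if "t > 0" for t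
  proof (cases "L > 0")
    case True
    then show ?thesis
      using that power_strict_mono[of L t 2] power2_less_imp_less[of L t] by auto
  next
    case False
    then show ?thesis using that by simp
  qed
  have U: "t < U \<longleftrightarrow> t\<^sup>2 < (max 0 U)\<^sup>2" if "t > 0" for t
  proof (cases "U > 0")
    case True
    then show ?thesis
      using that power_strict_mono[of t U 2] power2_less_imp_less[of t U] by auto
  next
    case False
    then show ?thesis using that by simp
  qed
  show ?thesis
  proof (rule exI[of _ "max a ((max 0 L)\<^sup>2)"], rule exI[of _ "min b ((max 0 U)\<^sup>2)"], intro conjI allI)
    fix v
    show "(a < v\<^sup>2 \<and> v\<^sup>2 < b \<and> \<sigma> * v > 0) \<and> l < v \<and> v < u
      \<longleftrightarrow> max a ((max 0 L)\<^sup>2) < v\<^sup>2 \<and> v\<^sup>2 < min b ((max 0 U)\<^sup>2) \<and> \<sigma> * v > 0"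
      using L[of "\<sigma> * v"] U[of "\<sigma> * v"] lu[of v] unfolding sq by auto
  qed simp
qed

lemma AE_fst_neq: "AE \<xi> in (lborel :: vel measure). fst \<xi> \<noteq> a"
proof -
  have "AE p in (lborel :: real measure) \<Otimes>\<^sub>M (lborel :: (real ^ 2) measure). fst p \<noteq> a"
  proof (rule lborel_pair.AE_pair_measure)
    show "AE x in (lborel :: real measure). AE y in (lborel :: (real ^ 2) measure). fst (x, y) \<noteq> a"
      using AE_lborel_singleton[of a] by eventually_elim simp
  qed measurable
  then show ?thesis unfolding lborel_prod .
qed

context monotone_profile begin

text \<open>
  Let \<open>D\<close> be the difference of the two sides. Rewriting the moment identity in the velocity at infinity
  gives \<open>\<integral>D \<xi>\<^sub>1 w = 0\<close> for every weight \<open>w\<close> whose energy bump avoids the slow particles. Sharpening the bumps turns \<open>w\<close> into indicators of boxes with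
  \<open>\<xi>\<^sub>1\<close> of one sign, away from \<open>0\<close>, and these determine \<open>D \<xi>\<^sub>1\<close>.
\<close>

lemma characteristic_AE:
  assumes weak: "weak_Vlasov \<alpha> f_b f \<phi>"
    and L1: "L1_loc ({0..} \<times> UNIV) (\<lambda>(x, \<xi>). f x \<xi>)" and CL: "C_L1 f"
    and f_inf: "integrable lborel f_inf" "((\<lambda>x. \<integral>\<xi>. \<bar>f x \<xi> - f_inf \<xi>\<bar> \<partial>lborel) \<longlongrightarrow> 0) at_top"
    and r: "r > 2" "Lr_loc_L1 r f_inf"
    and lim: "(\<phi> \<longlongrightarrow> 0) at_top" and x: "x \<ge> 0"
  shows "AE \<xi> in lborel. f x \<xi> = f_inf (vel_inf (- 2 * \<phi> x) \<xi>)"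
proof -
  define m where "m = - 2 * \<phi> x"
  have m: "m > 0" using neg[OF x] by (simp add: m_def)
  have [measurable]: "f_inf \<in> borel_measurable borel" using f_inf by auto
  define D where "D \<xi> = f x \<xi> - f_inf (vel_inf m \<xi>)" for \<xi>
  have fx: "integrable lborel (f x)" using CL x by (auto simp: C_L1_def)
  have fm: "integrable lborel (\<lambda>\<xi>. f_inf (vel_inf m \<xi>))"
    using m by (intro integrable_comp_vel_inf[OF r(1) f_inf(1) r(2)]) auto
  have Di: "integrable lborel D" unfolding D_def using fx fm by (rule Bochner_Integration.integrable_diff)
  have [measurable]: "D \<in> borel_measurable borel" using Di by auto
  have step1: "(\<integral>\<xi>. D \<xi> * (fst \<xi> * moment_weight n A B \<sigma> c l u (\<phi> x) \<xi>) \<partial>lborel) = 0"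
    if n: "n \<ge> 0" and c: "c > 0" "c\<^sup>2 \<le> A - m" and \<sigma>: "\<sigma> = 1 \<or> \<sigma> = -1" for n A B \<sigma> c l u
  proof -
    let ?w = "moment_weight n A B \<sigma> c l u"
    have int: "integrable lborel (\<lambda>\<xi>. g \<xi> * (fst \<xi> * ?w (\<phi> x) \<xi>))" if g: "integrable lborel g" for g
    proof (rule Bochner_Integration.integrable_bound[where f = "\<lambda>\<xi>. sqrt \<bar>B\<bar> * g \<xi>"])
      show "AE \<xi> in lborel. norm (g \<xi> * (fst \<xi> * ?w (\<phi> x) \<xi>)) \<le> norm (sqrt \<bar>B\<bar> * g \<xi>)"
      proof (rule AE_I2)
        fix \<xi>
        have "\<bar>g \<xi>\<bar> * \<bar>fst \<xi> * ?w (\<phi> x) \<xi>\<bar> \<le> \<bar>g \<xi>\<bar> * sqrt \<bar>B\<bar>"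
          using weight_bounded[OF n less_imp_le[OF neg[OF x]]] by (intro mult_left_mono) auto
        then show "norm (g \<xi> * (fst \<xi> * ?w (\<phi> x) \<xi>)) \<le> norm (sqrt \<bar>B\<bar> * g \<xi>)"
          by (simp add: abs_mult mult.commute)
      qed
      have "g \<in> borel_measurable borel" using g by auto
      then show "(\<lambda>\<xi>. g \<xi> * (fst \<xi> * ?w (\<phi> x) \<xi>)) \<in> borel_measurable lborel" by measurable
    qed (use g in simp)
    have "(\<integral>\<xi>. f_inf (vel_inf m \<xi>) * (fst \<xi> * ?w (\<phi> x) \<xi>) \<partial>lborel)
      = (\<integral>\<zeta>. jac m (fst \<zeta>) * (f_inf (vel_inf m (vel_loc m \<zeta>)) * (fst (vel_loc m \<zeta>) * ?w (\<phi> x) (vel_loc m \<zeta>))) \<partial>lborel)"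
      by (rule integrable_vel_loc(2)) (use m in auto)
    also have "\<dots> = (\<integral>\<zeta>. f_inf \<zeta> * (fst \<zeta> * ?w 0 \<zeta>) \<partial>lborel)"
    proof (rule Bochner_Integration.integral_cong[OF refl])
      fix \<zeta> :: vel
      let ?s = "fst \<zeta>" and ?v = "vloc m (fst \<zeta>)"
      show "jac m ?s * (f_inf (vel_inf m (vel_loc m \<zeta>)) * (fst (vel_loc m \<zeta>) * ?w (\<phi> x) (vel_loc m \<zeta>)))
        = f_inf \<zeta> * (?s * ?w 0 \<zeta>)"
      proof (cases "m < ?s\<^sup>2")
        case True
        have v2: "?v\<^sup>2 = ?s\<^sup>2 - m" using True m by (cases "?s = 0") (auto simp: vloc_def power_mult_distrib sgn_if)
        have js: "jac m ?s * ?v = ?s" using True m by (auto simp: jac_def vloc_def sgn_if)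
        have sg: "sgn ?v = sgn ?s" using True by (auto simp: vloc_def sgn_mult)
        \<comment> \<open>On the support of the energy bump both \<open>?v\<close> and \<open>?s\<close> have modulus at least \<open>c\<close> and the same sign, so the smooth signs agree.\<close>
        have "?w (\<phi> x) (vel_loc m \<zeta>) = ?w 0 \<zeta>"
        proof (cases "bump n A B (?s\<^sup>2) = 0")
          case True
          then show ?thesis using v2 by (simp add: moment_weight_def vel_loc_def m_def)
        next
          case False
          then have "A < ?s\<^sup>2" using bump_outside[OF n, of "?s\<^sup>2" A B] by (cases "?s\<^sup>2 \<in> {A<..<B}") auto
          then have "c\<^sup>2 \<le> ?v\<^sup>2" "c\<^sup>2 \<le> ?s\<^sup>2" using c m v2 by auto
          then have "c \<le> \<bar>?v\<bar>" "c \<le> \<bar>?s\<bar>" using c by (simp_all add: abs_le_square_iff[symmetric])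
          then have "smoothstep (\<sigma> * ?v / c) = indicator {0<..} (\<sigma> * ?v)" "smoothstep (\<sigma> * ?s / c) = indicator {0<..} (\<sigma> * ?s)"
            using c \<sigma> by (intro smoothstep_sign; auto simp: abs_mult)+
          moreover have "\<sigma> * ?v > 0 \<longleftrightarrow> \<sigma> * ?s > 0"
            using \<sigma> sg by (auto simp: sgn_if split: if_splits)
          ultimately show ?thesis using v2 by (simp add: moment_weight_def vel_loc_def m_def indicator_def)
        qed
        moreover have "fst (vel_loc m \<zeta>) = ?v" by (simp add: vel_loc_def)
        moreover have "vel_inf m (vel_loc m \<zeta>) = \<zeta>" using True m by (intro vel_inf_loc) auto
        moreover have "jac m ?s * (f_inf \<zeta> * (?v * ?w 0 \<zeta>)) = f_inf \<zeta> * ((jac m ?s * ?v) * ?w 0 \<zeta>)"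
          by (simp only: mult_ac)
        ultimately show ?thesis by (simp only: js)
      next
        case False
        then have "?s\<^sup>2 \<le> A" using c by (smt (verit) zero_le_power2)
        then have "?w 0 \<zeta> = 0" using bump_outside[OF n, of "?s\<^sup>2" A B] by (simp add: moment_weight_def)
        then show ?thesis using False by (simp add: jac_def)
      qed
    qed
    finally have eq: "(\<integral>\<xi>. f_inf (vel_inf m \<xi>) * (fst \<xi> * ?w (\<phi> x) \<xi>) \<partial>lborel) = (\<integral>\<zeta>. f_inf \<zeta> * (fst \<zeta> * ?w 0 \<zeta>) \<partial>lborel)" .
    have "(\<integral>\<xi>. f x \<xi> * (fst \<xi> * ?w (\<phi> x) \<xi>) \<partial>lborel) = (\<integral>\<zeta>. f_inf \<zeta> * (fst \<zeta> * ?w 0 \<zeta>) \<partial>lborel)"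
      using c \<sigma> by (intro moment_identity[OF weak L1 CL f_inf lim x n]) (auto simp: m_def)
    then show ?thesis
      unfolding D_def left_diff_distrib using int[OF fx] int[OF fm] eq by simp
  qed
  define cut where "cut a b \<sigma> \<xi> \<longleftrightarrow> a < (fst \<xi>)\<^sup>2 \<and> (fst \<xi>)\<^sup>2 < b \<and> \<sigma> * fst \<xi> > 0" for a b \<sigma> :: real and \<xi> :: vel
  have [measurable]: "Measurable.pred borel (cut a b \<sigma>)" for a b \<sigma> unfolding cut_def by measurable
  have step2: "(\<integral>\<xi>. D \<xi> * fst \<xi> * indicator {\<xi>. cut a b \<sigma> \<xi> \<and> snd \<xi> \<in> box l u} \<xi> \<partial>lborel) = 0"
    if a: "a > 0" and \<sigma>: "\<sigma> = 1 \<or> \<sigma> = -1" for a b \<sigma> l u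
  proof -
    define c where "c = sqrt a"
    have c: "c > 0" "c\<^sup>2 = a" using a by (auto simp: c_def)
    let ?w = "\<lambda>n. moment_weight n (m + a) (m + b) \<sigma> c l u (\<phi> x)"
    have "(\<lambda>n. \<integral>\<xi>. D \<xi> * (fst \<xi> * ?w (real n) \<xi>) \<partial>lborel)
      \<longlonglongrightarrow> (\<integral>\<xi>. D \<xi> * fst \<xi> * indicator {\<xi>. cut a b \<sigma> \<xi> \<and> snd \<xi> \<in> box l u} \<xi> \<partial>lborel)"
    proof (rule integral_dominated_convergence[where w = "\<lambda>\<xi>. \<bar>D \<xi>\<bar> * sqrt \<bar>m + b\<bar>"])
      show "AE \<xi> in lborel. norm (D \<xi> * (fst \<xi> * ?w (real n) \<xi>)) \<le> \<bar>D \<xi>\<bar> * sqrt \<bar>m + b\<bar>" for n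
      proof (rule AE_I2)
        fix \<xi>
        have "\<bar>D \<xi>\<bar> * \<bar>fst \<xi> * ?w (real n) \<xi>\<bar> \<le> \<bar>D \<xi>\<bar> * sqrt \<bar>m + b\<bar>"
          using weight_bounded[OF _ less_imp_le[OF neg[OF x]]] by (intro mult_left_mono) auto
        then show "norm (D \<xi> * (fst \<xi> * ?w (real n) \<xi>)) \<le> \<bar>D \<xi>\<bar> * sqrt \<bar>m + b\<bar>" by (simp add: abs_mult)
      qed
      show "AE \<xi> in lborel. (\<lambda>n. D \<xi> * (fst \<xi> * ?w (real n) \<xi>))
         \<longlonglongrightarrow> D \<xi> * fst \<xi> * indicator {\<xi>. cut a b \<sigma> \<xi> \<and> snd \<xi> \<in> box l u} \<xi>"
      proof (rule AE_I2)
        fix \<xi> :: vel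
        have E: "(fst \<xi>)\<^sup>2 - 2 * \<phi> x = (fst \<xi>)\<^sup>2 + m" by (simp add: m_def)
        have lim: "(\<lambda>n. ?w (real n) \<xi>) \<longlonglongrightarrow> indicator {m + a<..<m + b} ((fst \<xi>)\<^sup>2 + m) * smoothstep (\<sigma> * fst \<xi> / c)
          * (indicator {l $ 1<..<u $ 1} (snd \<xi> $ 1) * indicator {l $ 2<..<u $ 2} (snd \<xi> $ 2))"
          unfolding moment_weight_def E by (intro tendsto_intros bump_tendsto_indicator)
        have "indicator {m + a<..<m + b} ((fst \<xi>)\<^sup>2 + m) * smoothstep (\<sigma> * fst \<xi> / c)
          = (indicator {m + a<..<m + b} ((fst \<xi>)\<^sup>2 + m) * indicator {0<..} (\<sigma> * fst \<xi>) :: real)"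
        proof (cases "a < (fst \<xi>)\<^sup>2")
          case True
          then have "c\<^sup>2 \<le> (fst \<xi>)\<^sup>2" using c by simp
          then have "c\<^sup>2 \<le> \<bar>fst \<xi>\<bar>\<^sup>2" by simp
          then have "c \<le> \<bar>fst \<xi>\<bar>" by (rule power2_le_imp_le) simp
          then have "smoothstep (\<sigma> * fst \<xi> / c) = indicator {0<..} (\<sigma> * fst \<xi>)"
            using c \<sigma> by (intro smoothstep_sign) (auto simp: abs_mult)
          then show ?thesis by simp
        qed simp
        then have "indicator {m + a<..<m + b} ((fst \<xi>)\<^sup>2 + m) * smoothstep (\<sigma> * fst \<xi> / c)
          * (indicator {l $ 1<..<u $ 1} (snd \<xi> $ 1) * indicator {l $ 2<..<u $ 2} (snd \<xi> $ 2))
          = (indicator {\<xi>. cut a b \<sigma> \<xi> \<and> snd \<xi> \<in> box l u} \<xi> :: real)"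
          by (auto simp: indicator_def cut_def mem_box_cart forall_2)
        with lim have "(\<lambda>n. ?w (real n) \<xi>) \<longlonglongrightarrow> indicator {\<xi>. cut a b \<sigma> \<xi> \<and> snd \<xi> \<in> box l u} \<xi>" by simp
        from tendsto_mult[OF tendsto_const[of "D \<xi> * fst \<xi>"] this]
        show "(\<lambda>n. D \<xi> * (fst \<xi> * ?w (real n) \<xi>))
         \<longlonglongrightarrow> D \<xi> * fst \<xi> * indicator {\<xi>. cut a b \<sigma> \<xi> \<and> snd \<xi> \<in> box l u} \<xi>" by (simp add: mult.assoc)
      qed
      show "integrable lborel (\<lambda>\<xi>. \<bar>D \<xi>\<bar> * sqrt \<bar>m + b\<bar>)" using Di by simp
      have bs: "(\<lambda>\<xi>::vel. snd \<xi> \<in> box l u) = (\<lambda>\<xi>. \<xi> \<in> snd -` box l u)" by auto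
      have "open ((snd :: vel \<Rightarrow> _) -` box l u)" by (intro open_vimage continuous_intros) auto
      then have [measurable]: "Measurable.pred borel (\<lambda>\<xi>::vel. snd \<xi> \<in> box l u)"
        unfolding bs by simp
      show "(\<lambda>\<xi>. D \<xi> * fst \<xi> * indicator {\<xi>. cut a b \<sigma> \<xi> \<and> snd \<xi> \<in> box l u} \<xi>) \<in> borel_measurable lborel"
        by measurable
    qed measurable
    moreover have "(\<integral>\<xi>. D \<xi> * (fst \<xi> * ?w (real n) \<xi>) \<partial>lborel) = 0" for n
      using c \<sigma> by (intro step1) auto
    ultimately show ?thesis by (simp add: LIMSEQ_const_iff)
  qed
  have step3: "AE \<xi> in lborel. D \<xi> * fst \<xi> * indicator {\<xi>. cut a b \<sigma> \<xi>} \<xi> = 0"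
    if a: "a > 0" and \<sigma>: "\<sigma> = 1 \<or> \<sigma> = -1" for a b \<sigma>
  proof (rule AE_zero_of_box_integrals)
    show "integrable lborel (\<lambda>\<xi>. D \<xi> * fst \<xi> * indicator {\<xi>. cut a b \<sigma> \<xi>} \<xi>)"
    proof (rule Bochner_Integration.integrable_bound[where f = "\<lambda>\<xi>. \<bar>D \<xi>\<bar> * sqrt \<bar>b\<bar>"])
      show "AE \<xi> in lborel. norm (D \<xi> * fst \<xi> * indicator {\<xi>. cut a b \<sigma> \<xi>} \<xi>) \<le> norm (\<bar>D \<xi>\<bar> * sqrt \<bar>b\<bar>)"
      proof (rule AE_I2)
        fix \<xi>
        show "norm (D \<xi> * fst \<xi> * indicator {\<xi>. cut a b \<sigma> \<xi>} \<xi>) \<le> norm (\<bar>D \<xi>\<bar> * sqrt \<bar>b\<bar>)"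
        proof (cases "cut a b \<sigma> \<xi>")
          case True
          then have "sqrt ((fst \<xi>)\<^sup>2) \<le> sqrt \<bar>b\<bar>" by (intro real_sqrt_le_mono) (auto simp: cut_def)
          then have "\<bar>D \<xi>\<bar> * \<bar>fst \<xi>\<bar> \<le> \<bar>D \<xi>\<bar> * sqrt \<bar>b\<bar>" by (intro mult_left_mono) auto
          then show ?thesis using True by (simp add: abs_mult)
        qed simp
      qed
    qed (use Di in simp_all)
    fix p q :: vel
    obtain a' b' where ab: "a \<le> a'" "\<And>v. (a < v\<^sup>2 \<and> v\<^sup>2 < b \<and> \<sigma> * v > 0) \<and> fst p < v \<and> v < fst q
     \<longleftrightarrow> a' < v\<^sup>2 \<and> v\<^sup>2 < b' \<and> \<sigma> * v > 0" using vel_cutoff_eq[OF \<sigma>, of a b "fst p" "fst q"] by blast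
    have "(\<integral>\<xi>. indicator (box p q) \<xi> * (D \<xi> * fst \<xi> * indicator {\<xi>. cut a b \<sigma> \<xi>} \<xi>) \<partial>lborel)
      = (\<integral>\<xi>. D \<xi> * fst \<xi> * indicator {\<xi>. cut a' b' \<sigma> \<xi> \<and> snd \<xi> \<in> box (snd p) (snd q)} \<xi> \<partial>lborel)"
    proof (rule Bochner_Integration.integral_cong[OF refl])
      fix \<xi> :: vel
      have "\<xi> \<in> box p q \<and> cut a b \<sigma> \<xi> \<longleftrightarrow> cut a' b' \<sigma> \<xi> \<and> snd \<xi> \<in> box (snd p) (snd q)"
        using ab(2)[of "fst \<xi>"] unfolding mem_box_vel cut_def by blast
      then show "indicator (box p q) \<xi> * (D \<xi> * fst \<xi> * indicator {\<xi>. cut a b \<sigma> \<xi>} \<xi>)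
        = D \<xi> * fst \<xi> * indicator {\<xi>. cut a' b' \<sigma> \<xi> \<and> snd \<xi> \<in> box (snd p) (snd q)} \<xi>"
        by (auto simp: indicator_def)
    qed
    also have "\<dots> = 0" using a ab(1) \<sigma> by (intro step2) auto
    finally show "(\<integral>\<xi>. indicator (box p q) \<xi> * (D \<xi> * fst \<xi> * indicator {\<xi>. cut a b \<sigma> \<xi>} \<xi>) \<partial>lborel) = 0" .
  qed
  have "AE \<xi> in lborel. \<forall>k. D \<xi> * fst \<xi> * indicator {\<xi>. cut (1 / real (Suc k)) (real (Suc k)) 1 \<xi>} \<xi> = 0"
    "AE \<xi> in lborel. \<forall>k. D \<xi> * fst \<xi> * indicator {\<xi>. cut (1 / real (Suc k)) (real (Suc k)) (-1) \<xi>} \<xi> = 0"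
    unfolding AE_all_countable by (intro allI step3; simp)+
  moreover note AE_fst_neq[of 0]
  ultimately show ?thesis
  proof eventually_elim
    case (elim \<xi>)
    obtain k where k: "max ((fst \<xi>)\<^sup>2) (1 / (fst \<xi>)\<^sup>2) < real k" using reals_Archimedean2 by blast
    have pos: "(fst \<xi>)\<^sup>2 > 0" using elim by simp
    have "1 / (fst \<xi>)\<^sup>2 < real (Suc k)" using k by simp
    then have 1: "1 / real (Suc k) < (fst \<xi>)\<^sup>2" using pos by (simp add: field_simps)
    have 2: "(fst \<xi>)\<^sup>2 < real (Suc k)" using k by simp
    have "D \<xi> = 0"
    proof (cases "fst \<xi> > 0")
      case True
      then have "cut (1 / real (Suc k)) (real (Suc k)) 1 \<xi>" using 1 2 unfolding cut_def by simp
      then show ?thesis using elim(1) True by (auto dest!: spec[of _ k])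
    next
      case False
      then have "cut (1 / real (Suc k)) (real (Suc k)) (-1) \<xi>" using 1 2 elim(3) unfolding cut_def by simp
      then show ?thesis using elim(2,3) by (auto dest!: spec[of _ k])
    qed
    then show ?case by (simp add: D_def m_def)
  qed
qed

end

section \<open>The transport operator along a characteristic\<close>

definition reflect :: "vel \<Rightarrow> vel" where "reflect \<zeta> = (- fst \<zeta>, snd \<zeta>)"

lemma measurable_reflect [measurable]: "reflect \<in> borel_measurable borel"
  unfolding reflect_def[abs_def] borel_prod[symmetric] by measurable

lemma nn_integral_reflect:
  fixes H :: "vel \<Rightarrow> ennreal"
  assumes [measurable]: "H \<in> borel_measurable borel"
  shows "(\<integral>\<^sup>+\<zeta>. H (reflect \<zeta>) \<partial>lborel) = (\<integral>\<^sup>+\<zeta>. H \<zeta> \<partial>lborel)"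
proof -
  have [measurable]: "H \<in> borel_measurable (lborel \<Otimes>\<^sub>M lborel)"
    by (simp add: lborel_prod)
  have R: "(\<lambda>\<zeta>. H (reflect \<zeta>)) \<in> borel_measurable (lborel \<Otimes>\<^sub>M lborel)"
    unfolding lborel_prod by simp
  have "(\<integral>\<^sup>+\<zeta>. H \<zeta> \<partial>lborel) = (\<integral>\<^sup>+y. \<integral>\<^sup>+x. H (x, y) \<partial>lborel \<partial>lborel)"
    by (subst lborel_pair.nn_integral_snd) (simp_all add: lborel_prod)
  also have "\<dots> = (\<integral>\<^sup>+y. \<integral>\<^sup>+x. H (- x, y) \<partial>lborel \<partial>lborel)"
  proof (rule nn_integral_cong)
    fix y :: "real ^ 2"
    show "(\<integral>\<^sup>+x. H (x, y) \<partial>lborel) = (\<integral>\<^sup>+x. H (- x, y) \<partial>lborel)"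
      by (subst nn_integral_real_affine[where c = "-1" and t = 0]) simp_all
  qed
  also have "\<dots> = (\<integral>\<^sup>+\<zeta>. H (reflect \<zeta>) \<partial>lborel)"
    using lborel_pair.nn_integral_snd[OF R] by (simp add: lborel_prod reflect_def)
  finally show ?thesis ..
qed

lemma distr_reflect: "distr lborel borel reflect = lborel"
proof (rule measure_eqI)
  fix A assume "A \<in> sets (distr lborel borel reflect)"
  then have [measurable]: "A \<in> sets borel" by simp
  have "emeasure (distr lborel borel reflect) A = (\<integral>\<^sup>+\<zeta>. indicator A (reflect \<zeta>) \<partial>lborel)"
    by (subst nn_integral_distr[symmetric, of reflect lborel borel]) simp_all
  also have "\<dots> = emeasure lborel A" by (subst nn_integral_reflect) simp_all
  finally show "emeasure (distr lborel borel reflect) A = emeasure lborel A" .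
qed simp

lemma AE_reflect:
  assumes "AE \<zeta> in lborel. P \<zeta>" shows "AE \<zeta> in lborel. P (reflect \<zeta>)"
proof -
  have "AE \<zeta> in distr lborel borel reflect. P \<zeta>" unfolding distr_reflect by (rule assms)
  then show ?thesis by (rule AE_distrD[rotated]) simp
qed

text \<open>
  Folding the velocity axis pairs the particles that leave with velocity \<open>s\<close> with those that arrive with
  velocity \<open>-s\<close>.
\<close>

lemma integral_fold_reflect:
  fixes J :: "vel \<Rightarrow> real"
  assumes J: "integrable lborel J"
  shows "(\<integral>\<zeta>. J \<zeta> \<partial>lborel) = (\<integral>\<zeta>. indicator {\<zeta>. fst \<zeta> > 0} \<zeta> * (J \<zeta> + J (reflect \<zeta>)) \<partial>lborel)"
proof -
  have [measurable]: "J \<in> borel_measurable borel" using J by auto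
  let ?P = "indicator {\<zeta>. fst \<zeta> > 0} :: vel \<Rightarrow> real" and ?N = "indicator {\<zeta>. fst \<zeta> < 0} :: vel \<Rightarrow> real"
  have ms: "{\<zeta>::vel. fst \<zeta> > 0} \<in> sets borel" "{\<zeta>::vel. fst \<zeta> < 0} \<in> sets borel" by measurable
  have iP: "integrable lborel (\<lambda>\<zeta>. ?P \<zeta> * J \<zeta>)" and iN: "integrable lborel (\<lambda>\<zeta>. ?N \<zeta> * J \<zeta>)"
    using integrable_mult_indicator[OF _ J] ms by simp_all
  have NR: "?N (reflect \<zeta>) = ?P \<zeta>" for \<zeta> by (simp add: reflect_def indicator_def)
  have iNR: "integrable lborel (\<lambda>\<zeta>. ?P \<zeta> * J (reflect \<zeta>))"
    using iN integrable_distr_eq[of reflect lborel borel "\<lambda>\<zeta>. ?N \<zeta> * J \<zeta>"] ms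
    by (simp add: distr_reflect NR)
  have "(\<integral>\<zeta>. J \<zeta> \<partial>lborel) = (\<integral>\<zeta>. ?P \<zeta> * J \<zeta> + ?N \<zeta> * J \<zeta> \<partial>lborel)"
  proof (rule integral_cong_AE)
    show "AE \<zeta> in lborel. J \<zeta> = ?P \<zeta> * J \<zeta> + ?N \<zeta> * J \<zeta>"
      using AE_fst_neq[of 0] by eventually_elim (auto simp: indicator_def)
  qed (use ms in measurable)
  also have "\<dots> = (\<integral>\<zeta>. ?P \<zeta> * J \<zeta> \<partial>lborel) + (\<integral>\<zeta>. ?N \<zeta> * J \<zeta> \<partial>lborel)"
    using iP iN by (rule Bochner_Integration.integral_add)
  also have "(\<integral>\<zeta>. ?N \<zeta> * J \<zeta> \<partial>lborel) = (\<integral>\<zeta>. ?P \<zeta> * J (reflect \<zeta>) \<partial>lborel)"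
    using integral_distr[of reflect lborel borel "\<lambda>\<zeta>. ?N \<zeta> * J \<zeta>"] ms by (simp add: distr_reflect NR)
  also have "(\<integral>\<zeta>. ?P \<zeta> * J \<zeta> \<partial>lborel) + (\<integral>\<zeta>. ?P \<zeta> * J (reflect \<zeta>) \<partial>lborel)
    = (\<integral>\<zeta>. ?P \<zeta> * J \<zeta> + ?P \<zeta> * J (reflect \<zeta>) \<partial>lborel)"
    using iP iNR by (rule Bochner_Integration.integral_add[symmetric])
  finally show ?thesis by (simp add: distrib_left)
qed

definition C1_phase :: "(real \<times> vel \<Rightarrow> real) \<Rightarrow> (real \<times> vel \<Rightarrow> (real \<times> vel) \<Rightarrow>\<^sub>L real) \<Rightarrow> bool" where
  "C1_phase \<psi> \<psi>' \<longleftrightarrow> (\<forall>q\<in>phase. (\<psi> has_derivative blinfun_apply (\<psi>' q)) (at q within phase)) \<and> continuous_on phase \<psi>'"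

lemma C1_phase_chain:
  assumes \<psi>: "C1_phase \<psi> \<psi>'" and \<gamma>: "(\<gamma> has_vector_derivative d) (at t within T)"
    and T: "t \<in> T" "\<gamma> ` T \<subseteq> phase"
  shows "((\<lambda>t. \<psi> (\<gamma> t)) has_real_derivative blinfun_apply (\<psi>' (\<gamma> t)) d) (at t within T)"
proof -
  have "(\<psi> has_derivative blinfun_apply (\<psi>' (\<gamma> t))) (at (\<gamma> t) within phase)"
    using \<psi> T unfolding C1_phase_def by blast
  then have "(\<psi> has_derivative blinfun_apply (\<psi>' (\<gamma> t))) (at (\<gamma> t) within \<gamma> ` T)"
    by (rule has_derivative_subset) (rule T)
  from has_derivative_in_compose[OF \<gamma>[unfolded has_vector_derivative_def] this] show ?thesis
    unfolding has_field_derivative_def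
    by (rule has_derivative_eq_rhs) (simp add: fun_eq_iff blinfun.scaleR_right)
qed

lemma partial_x_C1:
  assumes \<psi>: "C1_phase \<psi> \<psi>'" and x: "x \<ge> 0"
  shows "partial_x \<psi> x \<xi> = blinfun_apply (\<psi>' (x, \<xi>)) (1, 0)"
proof (rule partial_x_eq[OF _ x])
  have "((\<lambda>y. (y, \<xi>)) has_vector_derivative (1, 0)) (at x within {0..})"
    by (auto intro!: derivative_eq_intros simp: has_vector_derivative_def)
  from C1_phase_chain[OF \<psi> this] x
  show "((\<lambda>y. \<psi> (y, \<xi>)) has_real_derivative blinfun_apply (\<psi>' (x, \<xi>)) (1, 0)) (at x within {0..})"
    by (auto simp: phase_def)
qed

lemma partial_\<xi>1_C1:
  assumes \<psi>: "C1_phase \<psi> \<psi>'" and x: "x \<ge> 0"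
  shows "partial_\<xi>1 \<psi> x \<xi> = blinfun_apply (\<psi>' (x, \<xi>)) (0, (1, 0))"
proof (rule partial_\<xi>1_eq)
  have "((\<lambda>s. (x, s, snd \<xi>)) has_vector_derivative (0, (1, 0))) (at (fst \<xi>))"
    by (auto intro!: derivative_eq_intros simp: has_vector_derivative_def zero_prod_def)
  from C1_phase_chain[OF \<psi> this] x
  show "((\<lambda>s. \<psi> (x, s, snd \<xi>)) has_real_derivative blinfun_apply (\<psi>' (x, \<xi>)) (0, (1, 0))) (at (fst \<xi>))"
    by (auto simp: phase_def)
qed

text \<open>
  Vanishing is an open condition off a closed support, even relative to the closed half space, so the
  one-sided derivative vanishes too.
\<close>

lemma partials_zero_off_support:
  assumes K: "closed K" "\<And>q. q \<in> phase - K \<Longrightarrow> \<psi> q = 0" and x: "x \<ge> 0" "(x, \<xi>) \<notin> K"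
  shows "partial_x \<psi> x \<xi> = 0" "partial_\<xi>1 \<psi> x \<xi> = 0"
proof -
  obtain e where e: "e > 0" "\<And>q. dist q (x, \<xi>) < e \<Longrightarrow> q \<notin> K"
    using K(1) x(2) unfolding closed_def open_dist by (metis ComplI ComplD)
  show "partial_x \<psi> x \<xi> = 0"
  proof (rule partial_x_eq[OF _ x(1)])
    have z: "\<psi> (y, \<xi>) = 0" if "y \<in> {0..}" "dist y x < e" for y
      using that e(2)[of "(y, \<xi>)"] by (intro K(2)) (auto simp: phase_def dist_Pair_Pair)
    show "((\<lambda>y. \<psi> (y, \<xi>)) has_real_derivative 0) (at x within {0..})"
      by (rule has_field_derivative_transform_within[OF DERIV_const e(1)]) (use z x in \<open>auto simp: dist_commute\<close>)
  qed
  show "partial_\<xi>1 \<psi> x \<xi> = 0"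
  proof (rule partial_\<xi>1_eq)
    have z: "\<psi> (x, s, snd \<xi>) = 0" if "dist s (fst \<xi>) < e" for s
      using that e(2)[of "(x, s, snd \<xi>)"] x by (intro K(2)) (cases \<xi>; auto simp: phase_def dist_Pair_Pair)
    show "((\<lambda>s. \<psi> (x, s, snd \<xi>)) has_real_derivative 0) (at (fst \<xi>))"
      by (rule has_field_derivative_transform_within[OF DERIV_const e(1)]) (use z in \<open>auto simp: dist_commute\<close>)
  qed
qed

context monotone_profile begin

text \<open>
  The leftmost point reached by a particle that has speed \<open>|s|\<close> at infinity: the wall for fast particles, and
  otherwise the point where \<open>-2\<phi>\<close> equals \<open>s\<^sup>2\<close>.
\<close>

definition turning_point :: "real \<Rightarrow> real" where
  "turning_point s = (if s\<^sup>2 \<ge> - 2 * \<phi> 0 then 0 else (SOME a. a \<ge> 0 \<and> - 2 * \<phi> a = s\<^sup>2))"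

lemma turning_point:
  assumes lim: "(\<phi> \<longlongrightarrow> 0) at_top" and s: "s \<noteq> 0"
  shows "turning_point s \<ge> 0" "x > 0 \<Longrightarrow> - 2 * \<phi> x < s\<^sup>2 \<longleftrightarrow> turning_point s < x" "- 2 * \<phi> (turning_point s) \<le> s\<^sup>2"
    "\<not> s\<^sup>2 \<ge> - 2 * \<phi> 0 \<Longrightarrow> - 2 * \<phi> (turning_point s) = s\<^sup>2"
proof -
  have *: "turning_point s \<ge> 0 \<and> - 2 * \<phi> (turning_point s) = s\<^sup>2" if c: "\<not> s\<^sup>2 \<ge> - 2 * \<phi> 0"
  proof -
    have "\<forall>\<^sub>F x in at_top. \<phi> x > - s\<^sup>2 / 2" using s by (intro order_tendstoD(1)[OF lim]) auto
    then obtain X where X: "\<And>x. x \<ge> X \<Longrightarrow> \<phi> x > - s\<^sup>2 / 2" unfolding eventually_at_top_linorder by blast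
    have "\<exists>a. 0 \<le> a \<and> a \<le> max 0 X \<and> \<phi> a = - s\<^sup>2 / 2"
      using c X[of "max 0 X"] by (intro IVT' continuous_on_subset[OF \<phi>_cont]) auto
    then have "\<exists>a. a \<ge> 0 \<and> - 2 * \<phi> a = s\<^sup>2" by auto
    then show ?thesis using someI_ex[of "\<lambda>a. a \<ge> 0 \<and> - 2 * \<phi> a = s\<^sup>2"] c by (simp add: turning_point_def)
  qed
  show 1: "turning_point s \<ge> 0" using * by (cases "s\<^sup>2 \<ge> - 2 * \<phi> 0") (auto simp: turning_point_def)
  show "\<not> s\<^sup>2 \<ge> - 2 * \<phi> 0 \<Longrightarrow> - 2 * \<phi> (turning_point s) = s\<^sup>2" using * by blast
  show "- 2 * \<phi> (turning_point s) \<le> s\<^sup>2" using * by (cases "s\<^sup>2 \<ge> - 2 * \<phi> 0") (auto simp: turning_point_def)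
  show "- 2 * \<phi> x < s\<^sup>2 \<longleftrightarrow> turning_point s < x" if x: "x > 0"
  proof (cases "s\<^sup>2 \<ge> - 2 * \<phi> 0")
    case True
    then show ?thesis using mono[of 0 x] x by (simp add: turning_point_def)
  next
    case False
    then have a: "- 2 * \<phi> (turning_point s) = s\<^sup>2" using * by blast
    show ?thesis
      using mono[of "turning_point s" x] mono[of x "turning_point s"] 1 x a[symmetric]
      by (cases "turning_point s" x rule: linorder_cases) auto
  qed
qed

text \<open>
  Where the particle is present, the integrand is \<open>s\<close> times the derivative of
  \<open>F(x) = \<psi>(x, v(x), \<eta>)\<close>, with \<open>v(x)\<close> the local velocity and \<open>\<eta>\<close> the constant transverse one, because \<open>v' = \<phi>'/v\<close>. The derivative of \<open>v\<close> is
  unbounded at a turning point, so the fundamental theorem is used in the form for open intervals with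
  limits at the endpoints, given that the integrand is integrable.
\<close>

lemma integral_along_characteristic:
  fixes \<eta> :: "real ^ 2"
  assumes \<psi>: "C1_phase \<psi> \<psi>'" and K: "compact K" "\<And>q. q \<in> phase - K \<Longrightarrow> \<psi> q = 0"
    and lim: "(\<phi> \<longlongrightarrow> 0) at_top" and s: "s \<noteq> 0"
  defines "u \<equiv> \<lambda>x. indicator {0<..} x * (jac (- 2 * \<phi> x) s
      * (vloc (- 2 * \<phi> x) s * partial_x \<psi> x (vloc (- 2 * \<phi> x) s, \<eta>)
         + p x * partial_\<xi>1 \<psi> x (vloc (- 2 * \<phi> x) s, \<eta>)))"
  assumes int: "integrable lborel u"
  shows "(\<integral>x. u x \<partial>lborel) = - s * \<psi> (turning_point s, vloc (- 2 * \<phi> (turning_point s)) s, \<eta>)"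
proof -
  define a where "a = turning_point s"
  note a = turning_point[OF lim s, folded a_def]
  define v where "v x = vloc (- 2 * \<phi> x) s" for x
  define w where "w x = sqrt (s\<^sup>2 + 2 * \<phi> x)" for x
  have v: "v x = sgn s * w x" for x by (simp add: v_def w_def vloc_def)
  define F where "F x = \<psi> (x, v x, \<eta>)" for x
  define F' where "F' x = blinfun_apply (\<psi>' (x, v x, \<eta>)) (1, (sgn s * (p x / w x), 0))" for x
  have wpos: "w x > 0" "s\<^sup>2 + 2 * \<phi> x > 0" if "x > a" for x
    using that a(1) a(2)[of x] by (auto simp: w_def)
  have wc: "continuous_on {a..} w"
    unfolding w_def using a(1) by (intro continuous_intros continuous_on_subset[OF \<phi>_cont]) auto
  have vc: "continuous_on {a..} v" unfolding v by (intro continuous_intros wc)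
  have gc: "continuous_on {a..} (\<lambda>x. (x, v x, \<eta>))" by (intro continuous_intros vc)
  have \<psi>c: "continuous_on phase \<psi>"
    using \<psi> unfolding C1_phase_def by (auto intro: has_derivative_continuous_on)
  have Fc: "continuous_on {a..} F"
    unfolding F_def using a(1) by (intro continuous_on_compose2[OF \<psi>c gc]) (auto simp: phase_def)
  have DF: "(F has_real_derivative F' x) (at x)" if x: "x > a" for x
  proof -
    have "(\<phi> has_real_derivative p x) (at x)" using d[of x] x a(1) by (simp add: at_within_Ici_interior)
    then have "((\<lambda>x. s\<^sup>2 + 2 * \<phi> x) has_real_derivative 2 * p x) (at x)" by (auto intro!: derivative_eq_intros)
    then have "(w has_real_derivative (inverse (sqrt (s\<^sup>2 + 2 * \<phi> x)) / 2) * (2 * p x)) (at x)"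
      unfolding w_def[abs_def] using DERIV_real_sqrt[OF wpos(2)[OF x]] by (rule DERIV_chain2[rotated])
    then have "(w has_real_derivative p x / w x) (at x)"
      by (rule DERIV_cong) (simp add: w_def inverse_eq_divide)
    then have "(v has_real_derivative sgn s * (p x / w x)) (at x)"
      unfolding v[abs_def] by (rule DERIV_cmult)
    from has_field_derivative_at_within[OF this, of "{0<..}"]
    have "(v has_vector_derivative sgn s * (p x / w x)) (at x within {0<..})"
      by (simp only: has_real_derivative_iff_has_vector_derivative)
    then have "((\<lambda>x. (x, v x, \<eta>)) has_vector_derivative (1, (sgn s * (p x / w x), 0))) (at x within {0<..})"
      by (intro has_vector_derivative_Pair has_vector_derivative_const has_vector_derivative_id)
    moreover have "(\<lambda>x. (x, v x, \<eta>)) ` {0<..} \<subseteq> phase" by (auto simp: phase_def)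
    moreover have "x \<in> {0<..}" using x a(1) by simp
    ultimately have "(F has_real_derivative F' x) (at x within {0<..})"
      unfolding F_def F'_def by (intro C1_phase_chain[OF \<psi>])
    then show ?thesis using x a(1) by (simp add: at_within_open[of x "{0<..}"])
  qed
  have u_eq: "u x = s * F' x" if x: "x > a" for x
  proof -
    have x0: "x > 0" using x a(1) by simp
    have m: "- 2 * \<phi> x < s\<^sup>2" using a(2)[OF x0] x by simp
    have J: "jac (- 2 * \<phi> x) s = \<bar>s\<bar> / w x" using m by (simp add: jac_def w_def)
    have F': "F' x = partial_x \<psi> x (v x, \<eta>) + (sgn s * (p x / w x)) * partial_\<xi>1 \<psi> x (v x, \<eta>)"
    proof -
      have E: "(1, (sgn s * (p x / w x), 0)) = (1, 0) + (sgn s * (p x / w x)) *\<^sub>R ((0::real), ((1::real), (0 :: real ^ 2)))"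
        by (simp add: zero_prod_def)
      show ?thesis
        unfolding F'_def E blinfun.add_right blinfun.scaleR_right partial_x_C1[OF \<psi> less_imp_le[OF x0]]
          partial_\<xi>1_C1[OF \<psi> less_imp_le[OF x0]] real_scaleR_def ..
    qed
    have "\<bar>s\<bar> / w x * (v x * X + p x * Y) = s * (X + (sgn s * (p x / w x)) * Y)" for X Y
      using wpos(1)[OF x] s by (simp add: v abs_sgn field_simps sgn_if)
    moreover have "indicator {0<..} x = (1::real)" using x0 by simp
    ultimately show ?thesis unfolding u_def F' v_def[symmetric] J by (simp only: mult_1)
  qed
  have u_zero: "u x = 0" if "x \<le> a" for x
  proof (cases "x > 0")
    case True
    then show ?thesis using a(2)[OF True] that by (simp add: u_def jac_def)
  qed (simp add: u_def)
  have ueq: "u x = indicator {a<..} x * (s * F' x)" for x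
    using u_eq[of x] u_zero[of x] by (cases "x > a") auto
  have F'int: "set_integrable lborel (einterval (ereal a) \<infinity>) F'"
  proof -
    have "integrable lborel (\<lambda>x. inverse s * u x)" using int by simp
    moreover have "inverse s * u x = indicator {a<..} x *\<^sub>R F' x" for x using s by (simp add: ueq field_simps)
    ultimately show ?thesis by (simp add: set_integrable_def einterval_def greaterThan_def)
  qed
  have F'cont: "isCont F' x" if x: "x > a" for x
  proof -
    have o: "open {a<..}" by simp
    have 1: "continuous_on {a<..} (\<lambda>x. \<psi>' (x, v x, \<eta>))"
      using \<psi> a(1) unfolding C1_phase_def
      by (intro continuous_on_compose2[OF _ continuous_on_subset[OF gc]]) (auto simp: phase_def)
    have 2: "continuous_on {a<..} (\<lambda>x. (1 :: real, (sgn s * (p x / w x), 0 :: real ^ 2)))"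
      using a(1) wpos(1) by (intro continuous_intros continuous_on_subset[OF pc] continuous_on_subset[OF wc]) (auto, force)
    have "continuous_on {a<..} F'" unfolding F'_def
      by (rule bounded_bilinear.continuous_on[OF bounded_bilinear_blinfun_apply 1 2])
    then show ?thesis using x by (simp add: continuous_on_eq_continuous_at)
  qed
  have "(LBINT x=ereal a..\<infinity>. F' x) = 0 - F a"
  proof (rule interval_integral_FTC_integrable[OF _ _ _ F'int])
    show "ereal a < \<infinity>" by simp
    show "(F has_vector_derivative F' x) (at x)" if "ereal a < ereal x" for x
      using DF that by (simp add: has_real_derivative_iff_has_vector_derivative)
    show "isCont F' x" if "ereal a < ereal x" for x using F'cont that by simp
    show "((F \<circ> real_of_ereal) \<longlongrightarrow> F a) (at_right (ereal a))"
    proof -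
      have "(F \<longlongrightarrow> F a) (at a within {a..})" using Fc by (auto simp: continuous_on_def)
      then have "(F \<longlongrightarrow> F a) (at_right a)" by (rule tendsto_within_subset) auto
      then show ?thesis by (simp only: ereal_tendsto_simps1)
    qed
    show "((F \<circ> real_of_ereal) \<longlongrightarrow> 0) (at_left \<infinity>)"
    proof -
      have "bounded K" using K(1) by (rule compact_imp_bounded)
      then obtain R where R: "\<And>q. q \<in> K \<Longrightarrow> norm q \<le> R" unfolding bounded_iff by auto
      have "\<forall>\<^sub>F x in at_top. F x = 0"
        using eventually_gt_at_top[of "max R a"]
      proof eventually_elim
        case (elim x)
        have "\<not> norm (x, v x, \<eta>) \<le> R"
          using norm_fst_le[of x "(v x, \<eta>)"] elim a(1) by auto
        then have "(x, v x, \<eta>) \<notin> K" using R by blast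
        then show ?case unfolding F_def using elim a(1) by (intro K(2)) (auto simp: phase_def)
      qed
      then have "(F \<longlongrightarrow> 0) at_top" by (rule tendsto_eventually)
      then show ?thesis by (simp only: ereal_tendsto_simps1)
    qed
  qed
  then have "(\<integral>x. indicator {a<..} x * F' x \<partial>lborel) = - F a"
    by (simp add: interval_lebesgue_integral_def einterval_def set_lebesgue_integral_def greaterThan_def)
  then have "(\<integral>x. s * (indicator {a<..} x * F' x) \<partial>lborel) = - s * F a"
    by (simp only: integral_mult_right_zero)
  moreover have "u = (\<lambda>x. s * (indicator {a<..} x * F' x))" by (auto simp: ueq fun_eq_iff)
  ultimately show ?thesis by (simp add: F_def v_def a_def)
qed

end

section \<open>The transported density solves the kinetic equation\<close>

context monotone_profile begin

context
  fixes f_inf :: "vel \<Rightarrow> real" and r :: real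
  assumes \<phi>C: "continuous_on UNIV \<phi>" and \<phi>neg: "\<And>x. \<phi> x < 0" and \<phi>ge: "\<And>x. \<phi> 0 \<le> \<phi> x"
    and lim: "(\<phi> \<longlongrightarrow> 0) at_top"
    and r: "r > 2" and finf: "integrable lborel f_inf" "Lr_loc_L1 r f_inf"
begin

definition transported :: "real \<Rightarrow> vel \<Rightarrow> real" where
  "transported x \<xi> = f_inf (vel_inf (- 2 * \<phi> x) \<xi>)"

lemma f_inf_borel [measurable]: "f_inf \<in> borel_measurable borel" using finf(1) by auto

lemma \<phi>_borel [measurable]: "\<phi> \<in> borel_measurable borel"
  using \<phi>C by (rule borel_measurable_continuous_onI)

lemma transported_borel [measurable]: "(\<lambda>q. transported (fst q) (snd q)) \<in> borel_measurable borel"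
  unfolding transported_def by measurable

lemma transported_integrable: "integrable lborel (transported x)"
  unfolding transported_def[abs_def] using \<phi>neg[of x] by (intro integrable_comp_vel_inf[OF r finf]) auto

lemma transported_C_L1: "C_L1 transported"
  unfolding C_L1_def
proof (intro conjI allI impI transported_integrable)
  fix x0 :: real assume "0 \<le> x0"
  show "((\<lambda>x. \<integral>\<xi>. \<bar>transported x \<xi> - transported x0 \<xi>\<bar> \<partial>lborel) \<longlongrightarrow> 0) (at x0 within {0..})"
    unfolding tendsto_at_iff_sequentially
  proof (intro allI impI)
    fix X :: "nat \<Rightarrow> real" assume X: "X \<longlonglongrightarrow> x0"
    have "isCont \<phi> x0" using \<phi>C by (simp add: continuous_on_eq_continuous_at)
    then have "(\<lambda>n. \<phi> (X n)) \<longlonglongrightarrow> \<phi> x0" using X by (rule isCont_tendsto_compose)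
    then have "(\<lambda>n. - 2 * \<phi> (X n)) \<longlonglongrightarrow> - 2 * \<phi> x0" by (intro tendsto_intros)
    then show "((\<lambda>x. \<integral>\<xi>. \<bar>transported x \<xi> - transported x0 \<xi>\<bar> \<partial>lborel) \<circ> X) \<longlonglongrightarrow> 0"
      unfolding transported_def comp_def using \<phi>neg by (intro L1_continuous_vel_inf[OF r finf]) (auto simp: less_imp_le)
  qed
qed

lemma transported_at_top: "((\<lambda>x. \<integral>\<xi>. \<bar>transported x \<xi> - f_inf \<xi>\<bar> \<partial>lborel) \<longlongrightarrow> 0) at_top"
proof (rule tendsto_at_topI_sequentially)
  fix X :: "nat \<Rightarrow> real" assume X: "filterlim X at_top sequentially"
  have "(\<lambda>n. \<phi> (X n)) \<longlonglongrightarrow> 0" using filterlim_compose[OF lim X] .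
  then have "(\<lambda>n. - 2 * \<phi> (X n)) \<longlonglongrightarrow> - 2 * 0" by (intro tendsto_intros)
  then have "(\<lambda>n. \<integral>\<xi>. \<bar>f_inf (vel_inf (- 2 * \<phi> (X n)) \<xi>) - f_inf (vel_inf 0 \<xi>)\<bar> \<partial>lborel) \<longlonglongrightarrow> 0"
    using \<phi>neg by (intro L1_continuous_vel_inf[OF r finf]) (auto simp: less_imp_le)
  then show "(\<lambda>n. \<integral>\<xi>. \<bar>transported (X n) \<xi> - f_inf \<xi>\<bar> \<partial>lborel) \<longlonglongrightarrow> 0" by (simp add: transported_def)
qed

lemma transported_bound: "\<exists>C\<ge>0. \<forall>x. (\<integral>\<^sup>+\<xi>. ennreal \<bar>transported x \<xi>\<bar> \<partial>lborel) \<le> ennreal C"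
proof -
  have "- 2 * \<phi> 0 \<ge> 0" using \<phi>neg[of 0] by simp
  from uniform_L1_bound[OF r finf this] obtain C where C: "C \<ge> 0"
    "\<forall>m\<in>{0..- 2 * \<phi> 0}. (\<integral>\<^sup>+\<xi>. ennreal \<bar>f_inf (vel_inf m \<xi>)\<bar> \<partial>lborel) \<le> ennreal C" by blast
  have "- 2 * \<phi> x \<in> {0..- 2 * \<phi> 0}" for x using \<phi>neg[of x] \<phi>ge[of x] by simp
  then show ?thesis using C unfolding transported_def by blast
qed

text \<open>
  The \<open>L\<^sup>1\<close> norms of the slices are bounded uniformly in \<open>x\<close>, so Tonelli's theorem applies on strips
  \<open>0 \<le> x \<le> X\<close>.
\<close>

lemma integrable_transported_mult:
  fixes g :: "real \<times> vel \<Rightarrow> real"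
  assumes [measurable]: "g \<in> borel_measurable borel" and g: "\<And>q. \<bar>g q\<bar> \<le> B" "\<And>q. fst q \<notin> {0..X} \<Longrightarrow> g q = 0"
  shows "integrable lborel (\<lambda>q. transported (fst q) (snd q) * g q)"
proof -
  obtain C where C: "C \<ge> 0" "\<And>x. (\<integral>\<^sup>+\<xi>. ennreal \<bar>transported x \<xi>\<bar> \<partial>lborel) \<le> ennreal C" using transported_bound by blast
  have B: "B \<ge> 0" using g(1)[of undefined] by linarith
  have m: "(\<lambda>q. ennreal (norm (transported (fst q) (snd q) * g q))) \<in> borel_measurable (lborel \<Otimes>\<^sub>M lborel)"
    unfolding lborel_prod by measurable
  have "(\<integral>\<^sup>+q. ennreal (norm (transported (fst q) (snd q) * g q)) \<partial>lborel)
    = (\<integral>\<^sup>+x. \<integral>\<^sup>+\<xi>. ennreal (norm (transported x \<xi> * g (x, \<xi>))) \<partial>lborel \<partial>lborel)"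
    using lborel.nn_integral_fst[OF m] by (simp add: lborel_prod)
  also have "\<dots> \<le> (\<integral>\<^sup>+x. ennreal (B * C) * indicator {0..X} x \<partial>lborel)"
  proof (rule nn_integral_mono)
    fix x :: real
    show "(\<integral>\<^sup>+\<xi>. ennreal (norm (transported x \<xi> * g (x, \<xi>))) \<partial>lborel) \<le> ennreal (B * C) * indicator {0..X} x"
    proof (cases "x \<in> {0..X}")
      case True
      have [measurable]: "transported x \<in> borel_measurable borel" using transported_integrable[of x] by auto
      have "(\<integral>\<^sup>+\<xi>. ennreal (norm (transported x \<xi> * g (x, \<xi>))) \<partial>lborel) \<le> (\<integral>\<^sup>+\<xi>. ennreal B * ennreal \<bar>transported x \<xi>\<bar> \<partial>lborel)"
      proof (rule nn_integral_mono)
        fix \<xi>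
        have "\<bar>transported x \<xi>\<bar> * \<bar>g (x, \<xi>)\<bar> \<le> \<bar>transported x \<xi>\<bar> * B" using g(1) by (intro mult_left_mono) auto
        then show "ennreal (norm (transported x \<xi> * g (x, \<xi>))) \<le> ennreal B * ennreal \<bar>transported x \<xi>\<bar>"
          using B by (simp add: ennreal_mult[symmetric] abs_mult mult.commute ennreal_leI)
      qed
      also have "\<dots> = ennreal B * (\<integral>\<^sup>+\<xi>. ennreal \<bar>transported x \<xi>\<bar> \<partial>lborel)" by (rule nn_integral_cmult) measurable
      also have "\<dots> \<le> ennreal B * ennreal C" using C(2) by (intro mult_left_mono) auto
      finally show ?thesis using True B C(1) by (simp add: ennreal_mult)
    next
      case False
      then show ?thesis using g(2)[of "(x, _)"] by simp
    qed
  qed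
  also have "\<dots> < \<infinity>" using emeasure_compact_finite[OF compact_Icc, of 0 X]
    by (subst nn_integral_cmult_indicator) (auto simp: ennreal_mult_less_top)
  finally show ?thesis by (intro integrableI_bounded) auto
qed

lemma transported_L1_loc: "L1_loc ({0..} \<times> UNIV) (\<lambda>(x, \<xi>). transported x \<xi>)"
  unfolding L1_loc_def
proof (intro allI impI, elim conjE)
  fix K :: "(real \<times> vel) set" assume K: "compact K" "K \<subseteq> {0..} \<times> UNIV"
  obtain X where X: "\<And>q. q \<in> K \<Longrightarrow> norm q \<le> X" using compact_imp_bounded[OF K(1)] unfolding bounded_iff by auto
  have [measurable]: "K \<in> sets borel" using K(1) by (rule borel_compact)
  have "integrable lborel (\<lambda>q. transported (fst q) (snd q) * indicator K q)"
  proof (rule integrable_transported_mult[where B = 1 and X = X])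
    show "indicator K q = (0::real)" if "fst q \<notin> {0..X}" for q
    proof -
      have "q \<notin> K"
      proof
        assume "q \<in> K"
        then show False using X[of q] K(2) that norm_fst_le[of "fst q" "snd q"] by auto
      qed
      then show ?thesis by simp
    qed
  qed (auto simp: indicator_def)
  then show "set_integrable lborel K (\<lambda>(x, \<xi>). transported x \<xi>)"
    by (simp add: set_integrable_def case_prod_beta mult.commute)
qed

text \<open>
  In the velocity \<open>\<zeta>\<close> at infinity the integrand becomes \<open>h x \<zeta>\<close>, and Fubini's theorem lets the
  integration over \<open>x\<close> come first. It gives \<open>J \<zeta> = - f\<^sub>\<infinity>(\<zeta>) s \<psi>\<close> with \<open>\<psi>\<close> evaluated at the left end of the
  characteristic. After folding \<open>s\<close> and \<open>-s\<close> together, the reflected particles contribute nothing, since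
  \<open>f\<^sub>\<infinity>\<close> is even there and the velocity at the turning point is \<open>0\<close>; for the others the condition
  \<open>\<psi>(0, -v, \<xi>') = \<alpha> \<psi>(0, v, \<xi>')\<close> on test functions and the relation between \<open>f\<^sub>\<infinity>\<close> and \<open>f\<^sub>b\<close> leave \<open>- s f\<^sub>b \<psi>\<close>.
  Changing back to the velocity at the wall produces the boundary term.
\<close>

lemma transported_weak:
  assumes fb: "set_integrable lborel half_space f_b"
    and outer: "AE \<xi> in lborel. (fst \<xi>)\<^sup>2 > - 2 * \<phi> 0 \<and> fst \<xi> > 0 \<longrightarrow>
        f_inf \<xi> = f_b (sqrt ((fst \<xi>)\<^sup>2 + 2 * \<phi> 0), snd \<xi>) + \<alpha> * f_inf (reflect \<xi>)"
    and inner: "AE \<xi> in lborel. (fst \<xi>)\<^sup>2 < - 2 * \<phi> 0 \<longrightarrow> f_inf \<xi> = f_inf (reflect \<xi>)"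
  shows "weak_Vlasov \<alpha> f_b transported \<phi>"
  unfolding weak_Vlasov_def
proof
  fix \<psi> assume "\<psi> \<in> test_functions \<alpha>"
  then have C1: "C1_compact \<psi>" and bc: "\<And>v \<eta>. v > 0 \<Longrightarrow> \<alpha> * \<psi> (0, v, \<eta>) = \<psi> (0, - v, \<eta>)"
    unfolding test_functions_def mem_Collect_eq by simp_all
  have "(\<exists>\<psi>'. C1_phase \<psi> \<psi>') \<and> (\<exists>K. compact K \<and> K \<subseteq> phase \<and> (\<forall>q\<in>phase - K. \<psi> q = 0))"
    using C1 unfolding C1_compact_def C1_phase_def phase_def .
  then obtain \<psi>' K where \<psi>: "C1_phase \<psi> \<psi>'"
    and K: "compact K" "K \<subseteq> phase" "\<And>q. q \<in> phase - K \<Longrightarrow> \<psi> q = 0" by blast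
  have \<psi>0: "(\<lambda>\<xi>. \<psi> (0, \<xi>)) \<in> borel_measurable borel"
  proof -
    have "continuous_on phase \<psi>"
      using \<psi> unfolding C1_phase_def by (auto intro: has_derivative_continuous_on)
    then have "continuous_on UNIV (\<lambda>\<xi>. \<psi> (0, \<xi>))"
      by (rule continuous_on_compose2) (auto intro!: continuous_intros simp: phase_def)
    then show ?thesis by (rule borel_measurable_continuous_onI)
  qed
  have hb0: "(\<lambda>\<xi>. indicator half_space \<xi> * f_b \<xi> * (fst \<xi> * \<psi> (0, \<xi>))) \<in> borel_measurable borel"
  proof -
    have [measurable]: "(\<lambda>\<xi>. indicator half_space \<xi> * f_b \<xi>) \<in> borel_measurable borel"
      using borel_measurable_integrable[OF fb[unfolded set_integrable_def]] by simp
    note \<psi>0[measurable]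
    show ?thesis by measurable
  qed
  define m where "m x = - 2 * \<phi> x" for x
  have m: "m x > 0" for x using \<phi>neg[of x] by (simp add: m_def)
  have [measurable]: "m \<in> borel_measurable borel" unfolding m_def[abs_def] by measurable
  define L where "L q = fst (snd q) * partial_x \<psi> (fst q) (snd q) + p (fst q) * partial_\<xi>1 \<psi> (fst q) (snd q)" for q
  \<comment> \<open>Restricting to \<open>x > 0\<close> makes \<open>L0\<close> measurable on the whole space, whatever \<open>\<psi>\<close> and \<open>\<phi>\<close> do for \<open>x < 0\<close>.\<close>
  define L0 where "L0 q = indicator ({0<..} \<times> UNIV) q * L q" for q
  have Lc: "continuous_on phase L"
  proof -
    have \<psi>'c: "continuous_on phase \<psi>'" using \<psi> by (simp add: C1_phase_def)
    have "continuous_on phase (\<lambda>q. fst (snd q) * blinfun_apply (\<psi>' q) (1, 0) + p (fst q) * blinfun_apply (\<psi>' q) (0, (1, 0)))"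
      by (intro continuous_intros bounded_bilinear.continuous_on[OF bounded_bilinear_blinfun_apply] \<psi>'c
          continuous_on_compose2[OF pc]) (auto simp: phase_def)
    moreover have "L q = fst (snd q) * blinfun_apply (\<psi>' q) (1, 0) + p (fst q) * blinfun_apply (\<psi>' q) (0, (1, 0))"
      if "q \<in> phase" for q
      using that unfolding L_def phase_def
      by (cases q) (auto simp: partial_x_C1[OF \<psi>] partial_\<xi>1_C1[OF \<psi>])
    ultimately show ?thesis by (simp cong: continuous_on_cong)
  qed
  have Loff: "L q = 0" if "q \<in> phase - K" for q
    using that partials_zero_off_support[OF compact_imp_closed[OF K(1)] K(3), where x = "fst q" and \<xi> = "snd q"]
    by (auto simp: L_def phase_def)
  obtain X where X: "\<And>q. q \<in> K \<Longrightarrow> norm q \<le> X" using compact_imp_bounded[OF K(1)] unfolding bounded_iff by auto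
  have "bounded (L ` K)"
    using K(1,2) Lc by (meson compact_continuous_image compact_imp_bounded continuous_on_subset)
  then obtain B0 where B0: "\<And>q. q \<in> K \<Longrightarrow> \<bar>L q\<bar> \<le> B0" unfolding bounded_iff by auto
  define B where "B = max 0 B0"
  have L0_eq: "L0 q = indicator ({0<..} \<times> UNIV) q *\<^sub>R L q" for q by (simp add: L0_def)
  have [measurable]: "L0 \<in> borel_measurable borel"
    unfolding L0_eq[abs_def]
    by (intro borel_measurable_continuous_on_indicator continuous_on_subset[OF Lc]) (auto simp: phase_def open_Times)
  have L0B: "\<bar>L0 q\<bar> \<le> B" for q
  proof (cases "q \<in> K")
    case True
    then show ?thesis using B0[OF True] by (auto simp: L0_def B_def indicator_def)
  next
    case False
    then show ?thesis using Loff[of q] by (auto simp: L0_def B_def indicator_def phase_def)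
  qed
  have L0X: "L0 q = 0" if "fst q \<notin> {0..X}" for q
  proof (cases "q \<in> K")
    case True
    then show ?thesis using X[OF True] K(2) that norm_fst_le[of "fst q" "snd q"] by (auto simp: phase_def)
  next
    case False
    then show ?thesis using Loff[of q] by (auto simp: L0_def indicator_def phase_def)
  qed
  define h where "h x \<zeta> = jac (m x) (fst \<zeta>) * (f_inf \<zeta> * L0 (x, vel_loc (m x) \<zeta>))" for x \<zeta>
  have pairm: "(\<lambda>q::real \<times> vel. (fst q, vel_loc (m (fst q)) (snd q))) \<in> borel_measurable borel"
    by (subst borel_prod[symmetric], rule measurable_Pair) (measurable, measurable)
  have hm: "(\<lambda>q. h (fst q) (snd q)) \<in> borel_measurable borel"
    unfolding h_def using measurable_compose[OF pairm \<open>L0 \<in> borel_measurable borel\<close>] by measurable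
  have i1: "integrable lborel (\<lambda>q. transported (fst q) (snd q) * L0 q)"
    using L0B L0X by (intro integrable_transported_mult[where B = B and X = X]) auto
  have slice: "(\<lambda>\<xi>. transported x \<xi> * L0 (x, \<xi>)) \<in> borel_measurable borel" for x
  proof -
    have "(\<lambda>\<xi>::vel. (x, \<xi>)) \<in> borel_measurable borel"
      by (intro borel_measurable_continuous_onI continuous_intros)
    from measurable_compose[OF this \<open>L0 \<in> borel_measurable borel\<close>]
    show ?thesis unfolding transported_def by measurable
  qed
  have hx: "h x \<zeta> = jac (m x) (fst \<zeta>) * (transported x (vel_loc (m x) \<zeta>) * L0 (x, vel_loc (m x) \<zeta>))" for x \<zeta>
  proof (cases "m x < (fst \<zeta>)\<^sup>2")
    case True
    then show ?thesis using m[of x] unfolding h_def transported_def m_def by (simp add: vel_inf_loc)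
  qed (simp add: h_def jac_def)
  have i2: "integrable lborel (\<lambda>q. h (fst q) (snd q))"
  proof (rule integrableI_bounded)
    have mm: "(\<lambda>q. ennreal (norm (h (fst q) (snd q)))) \<in> borel_measurable (lborel \<Otimes>\<^sub>M lborel)"
      "(\<lambda>q. ennreal (norm (transported (fst q) (snd q) * L0 q))) \<in> borel_measurable (lborel \<Otimes>\<^sub>M lborel)"
      unfolding lborel_prod using hm by measurable
    have "(\<integral>\<^sup>+q. ennreal (norm (h (fst q) (snd q))) \<partial>lborel) = (\<integral>\<^sup>+x. \<integral>\<^sup>+\<zeta>. ennreal (norm (h x \<zeta>)) \<partial>lborel \<partial>lborel)"
      using lborel.nn_integral_fst[OF mm(1)] by (simp add: lborel_prod)
    also have "\<dots> = (\<integral>\<^sup>+x. \<integral>\<^sup>+\<xi>. ennreal (norm (transported x \<xi> * L0 (x, \<xi>))) \<partial>lborel \<partial>lborel)"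
    proof (rule nn_integral_cong)
      fix x
      have "(\<integral>\<^sup>+\<xi>. ennreal (norm (transported x \<xi> * L0 (x, \<xi>))) \<partial>lborel)
        = (\<integral>\<^sup>+\<zeta>. ennreal (norm (transported x (vel_loc (m x) \<zeta>) * L0 (x, vel_loc (m x) \<zeta>))) * jac (m x) (fst \<zeta>) \<partial>lborel)"
        using m[of x] slice[of x] by (intro nn_integral_vel_loc) auto
      also have "\<dots> = (\<integral>\<^sup>+\<zeta>. ennreal (norm (h x \<zeta>)) \<partial>lborel)"
        by (intro nn_integral_cong) (simp add: hx abs_mult ennreal_mult[symmetric] mult.commute)
      finally show "(\<integral>\<^sup>+\<zeta>. ennreal (norm (h x \<zeta>)) \<partial>lborel) = (\<integral>\<^sup>+\<xi>. ennreal (norm (transported x \<xi> * L0 (x, \<xi>))) \<partial>lborel)" ..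
    qed
    also have "\<dots> = (\<integral>\<^sup>+q. ennreal (norm (transported (fst q) (snd q) * L0 q)) \<partial>lborel)"
      using lborel.nn_integral_fst[OF mm(2)] by (simp add: lborel_prod)
    also have "\<dots> < \<infinity>" using i1 unfolding integrable_iff_bounded by simp
    finally show "(\<integral>\<^sup>+q. ennreal (norm (h (fst q) (snd q))) \<partial>lborel) < \<infinity>" .
  qed (use hm in simp)
  have i2p: "integrable (lborel \<Otimes>\<^sub>M lborel) (case_prod h)" using i2 by (simp add: lborel_prod case_prod_beta')
  define J where "J \<zeta> = (\<integral>x. h x \<zeta> \<partial>lborel)" for \<zeta>
  have Ji: "integrable lborel J"
    unfolding J_def[abs_def] using lborel_pair.integrable_snd[OF i2p] .
  have AEi: "AE \<zeta> in lborel. integrable lborel (\<lambda>x. h x \<zeta>)" using lborel_pair.AE_integrable_snd[OF i2p] .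
  have "(LINT q : {0<..} \<times> UNIV | lborel. (case q of (x, \<xi>) \<Rightarrow>
       transported x \<xi> * (fst \<xi> * partial_x \<psi> x \<xi> + deriv_on {0..} \<phi> x * partial_\<xi>1 \<psi> x \<xi>)))
    = (\<integral>q. transported (fst q) (snd q) * L0 q \<partial>lborel)"
    unfolding set_lebesgue_integral_def
    by (intro Bochner_Integration.integral_cong refl) (auto simp: L0_def L_def p_eq split: split_indicator)
  also have "\<dots> = (\<integral>x. \<integral>\<xi>. transported x \<xi> * L0 (x, \<xi>) \<partial>lborel \<partial>lborel)"
    using lborel_pair.integral_fst'[of "\<lambda>q. transported (fst q) (snd q) * L0 q"] i1 by (simp add: lborel_prod)
  also have "\<dots> = (\<integral>x. \<integral>\<zeta>. h x \<zeta> \<partial>lborel \<partial>lborel)"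
  proof (rule Bochner_Integration.integral_cong[OF refl])
    fix x
    show "(\<integral>\<xi>. transported x \<xi> * L0 (x, \<xi>) \<partial>lborel) = (\<integral>\<zeta>. h x \<zeta> \<partial>lborel)"
      unfolding hx using m[of x] slice[of x] by (intro integrable_vel_loc(2)) auto
  qed
  also have "\<dots> = (\<integral>\<zeta>. J \<zeta> \<partial>lborel)"
    unfolding J_def using lborel_pair.Fubini_integral[OF i2p] by simp
  also have "\<dots> = (\<integral>\<zeta>. indicator {\<zeta>. fst \<zeta> > 0} \<zeta> * (J \<zeta> + J (reflect \<zeta>)) \<partial>lborel)"
    using Ji by (rule integral_fold_reflect)
  also have "\<dots> = (\<integral>\<zeta>. - (jac (m 0) (fst \<zeta>) *
      (indicator half_space (vel_loc (m 0) \<zeta>) * f_b (vel_loc (m 0) \<zeta>) * (fst (vel_loc (m 0) \<zeta>) * \<psi> (0, vel_loc (m 0) \<zeta>)))) \<partial>lborel)"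
  proof (rule integral_cong_AE)
    define P where "P \<zeta> = (fst \<zeta> \<noteq> 0 \<longrightarrow> integrable lborel (\<lambda>x. h x \<zeta>) \<longrightarrow>
      J \<zeta> = - f_inf \<zeta> * fst \<zeta> * \<psi> (turning_point (fst \<zeta>), vel_loc (m (turning_point (fst \<zeta>))) \<zeta>))" for \<zeta> :: vel
    have P: "P \<zeta>" for \<zeta>
      unfolding P_def
    proof (intro impI)
      assume s: "fst \<zeta> \<noteq> 0" and hi: "integrable lborel (\<lambda>x. h x \<zeta>)"
      show "J \<zeta> = - f_inf \<zeta> * fst \<zeta> * \<psi> (turning_point (fst \<zeta>), vel_loc (m (turning_point (fst \<zeta>))) \<zeta>)"
      proof (cases "f_inf \<zeta> = 0")
        case True
        then show ?thesis by (simp add: J_def h_def)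
      next
        case False
        define u where "u x = indicator {0<..} x * (jac (- 2 * \<phi> x) (fst \<zeta>)
          * (vloc (- 2 * \<phi> x) (fst \<zeta>) * partial_x \<psi> x (vloc (- 2 * \<phi> x) (fst \<zeta>), snd \<zeta>)
           + p x * partial_\<xi>1 \<psi> x (vloc (- 2 * \<phi> x) (fst \<zeta>), snd \<zeta>)))" for x
        have hu: "h x \<zeta> = f_inf \<zeta> * u x" for x
          by (auto simp: h_def u_def L0_def L_def m_def vel_loc_def split: split_indicator)
        then have "u = (\<lambda>x. inverse (f_inf \<zeta>) * h x \<zeta>)" using False by (simp add: fun_eq_iff)
        then have "integrable lborel u" using hi by simp
        from integral_along_characteristic[OF \<psi> K(1,3) lim s this[unfolded u_def]]
        have "(\<integral>x. u x \<partial>lborel) = - fst \<zeta> * \<psi> (turning_point (fst \<zeta>), vloc (- 2 * \<phi> (turning_point (fst \<zeta>))) (fst \<zeta>), snd \<zeta>)"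
          unfolding u_def .
        then show ?thesis by (simp add: J_def hu m_def vel_loc_def)
      qed
    qed
    have ne: "AE \<zeta> in (lborel :: vel measure). fst \<zeta> \<noteq> 0" "AE \<zeta> in (lborel :: vel measure). fst \<zeta> \<noteq> sqrt (m 0)"
      by (rule AE_fst_neq)+
    show "AE \<zeta> in lborel. indicator {\<zeta>. fst \<zeta> > 0} \<zeta> * (J \<zeta> + J (reflect \<zeta>))
      = - (jac (m 0) (fst \<zeta>) * (indicator half_space (vel_loc (m 0) \<zeta>) * f_b (vel_loc (m 0) \<zeta>)
           * (fst (vel_loc (m 0) \<zeta>) * \<psi> (0, vel_loc (m 0) \<zeta>))))"
      using AEi AE_reflect[OF AEi] ne outer inner
    proof eventually_elim
      case (elim \<zeta>)
      let ?s = "fst \<zeta>" and ?v = "vloc (m 0) (fst \<zeta>)"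
      show ?case
      proof (cases "?s > 0")
        case False
        show ?thesis
        proof (cases "m 0 < ?s\<^sup>2")
          case True
          then have "?v \<le> 0" using False by (auto simp: vloc_def sgn_if)
          then have "indicator half_space (vel_loc (m 0) \<zeta>) = (0::real)" by (simp add: half_space_def vel_loc_def)
          then show ?thesis using False by simp
        qed (use False in \<open>simp add: jac_def\<close>)
      next
        case s: True
        define a where "a = turning_point ?s"
        have tm: "turning_point (- ?s) = a" by (simp add: turning_point_def a_def)
        have J1: "J \<zeta> = - f_inf \<zeta> * ?s * \<psi> (a, vloc (m a) ?s, snd \<zeta>)"
          using P[of \<zeta>] elim s by (simp add: P_def a_def vel_loc_def)
        have J2: "J (reflect \<zeta>) = f_inf (reflect \<zeta>) * ?s * \<psi> (a, - vloc (m a) ?s, snd \<zeta>)"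
          using P[of "reflect \<zeta>"] elim s by (simp add: P_def vel_loc_def reflect_def tm)
        consider "m 0 < ?s\<^sup>2" | "?s\<^sup>2 < m 0"
        proof -
          have "?s\<^sup>2 \<noteq> m 0" using s elim(4) by (metis abs_of_pos real_sqrt_abs)
          then show thesis using that by linarith
        qed
        then show ?thesis
        proof cases
          case 1
          then have a: "a = 0" by (simp add: a_def turning_point_def m_def)
          have v: "?v = sqrt (?s\<^sup>2 + 2 * \<phi> 0)" "?v > 0" using s 1 by (simp_all add: vloc_def m_def)
          have jv: "jac (m 0) ?s * ?v = ?s" using s 1 by (simp add: jac_def vloc_def)
          have f: "f_inf \<zeta> = f_b (?v, snd \<zeta>) + \<alpha> * f_inf (reflect \<zeta>)"
            unfolding v(1) using elim(5) s 1 by (simp add: m_def)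
          have b: "\<psi> (0, - ?v, snd \<zeta>) = \<alpha> * \<psi> (0, ?v, snd \<zeta>)" using bc[OF v(2)] by simp
          have "J \<zeta> + J (reflect \<zeta>) = - (?s * (f_b (?v, snd \<zeta>) * \<psi> (0, ?v, snd \<zeta>)))"
            unfolding J1 J2 a b by (subst f) (simp add: algebra_simps)
          also have "\<dots> = - (jac (m 0) ?s * (1 * f_b (?v, snd \<zeta>) * (?v * \<psi> (0, ?v, snd \<zeta>))))"
            by (subst jv[symmetric]) (simp only: mult_ac mult_1)
          finally show ?thesis using s v(2) by (simp add: half_space_def vel_loc_def)
        next
          case 2
          have "m a = ?s\<^sup>2" using turning_point(4)[OF lim, of ?s] s 2 by (simp add: a_def m_def)
          then have "vloc (m a) ?s = 0" by (simp add: vloc_def)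
          moreover have "f_inf \<zeta> = f_inf (reflect \<zeta>)" using elim(6) 2 by (simp add: m_def)
          ultimately show ?thesis using 2 unfolding J1 J2 by (simp add: jac_def)
        qed
      qed
    qed
    show "(\<lambda>\<zeta>. - (jac (m 0) (fst \<zeta>) * (indicator half_space (vel_loc (m 0) \<zeta>) * f_b (vel_loc (m 0) \<zeta>)
           * (fst (vel_loc (m 0) \<zeta>) * \<psi> (0, vel_loc (m 0) \<zeta>))))) \<in> borel_measurable lborel"
      using measurable_compose[OF _ hb0, of "vel_loc (m 0)" borel] by measurable
    have [measurable]: "J \<in> borel_measurable borel" using Ji by auto
    show "(\<lambda>\<zeta>. indicator {\<zeta>. fst \<zeta> > 0} \<zeta> * (J \<zeta> + J (reflect \<zeta>))) \<in> borel_measurable lborel"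
      by measurable
  qed
  also have "\<dots> = - (\<integral>\<xi>. indicator half_space \<xi> * f_b \<xi> * (fst \<xi> * \<psi> (0, \<xi>)) \<partial>lborel)"
    unfolding integral_minus using m[of 0] hb0 by (subst integrable_vel_loc(2)[of "m 0"]) auto
  finally show "(LINT q : {0<..} \<times> UNIV | lborel. (case q of (x, \<xi>) \<Rightarrow>
       transported x \<xi> * (fst \<xi> * partial_x \<psi> x \<xi> + deriv_on {0..} \<phi> x * partial_\<xi>1 \<psi> x \<xi>)))
     + (LINT \<xi> : half_space | lborel. f_b \<xi> * (fst \<xi> * \<psi> (0, \<xi>))) = 0"
    by (simp add: set_lebesgue_integral_def mult.assoc)
qed

end

end

section \<open>The boundary value problem\<close>

text \<open>
  The right-hand side of (\<ast>) and \<open>f\<^sub>\<infinity> \<circ> vel_inf (-2\<phi>(x))\<close> differ at most where \<open>\<xi>\<^sub>1 = 0\<close>, a null set.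
\<close>

lemma characteristic_formula_iff:
  "characteristic_formula f_inf f \<phi> \<longleftrightarrow> (\<forall>x\<ge>0. AE \<xi> in lborel. f x \<xi> = f_inf (vel_inf (- 2 * \<phi> x) \<xi>))"
proof -
  have "(f x \<xi> = f_inf (- sqrt ((fst \<xi>)\<^sup>2 - 2 * \<phi> x), snd \<xi>) * step (- fst \<xi>)
      + f_inf (sqrt ((fst \<xi>)\<^sup>2 - 2 * \<phi> x), snd \<xi>) * step (fst \<xi>)) = (f x \<xi> = f_inf (vel_inf (- 2 * \<phi> x) \<xi>))"
    if "fst \<xi> \<noteq> 0" for x \<xi>
    using that by (cases "fst \<xi> > 0") (simp_all add: vel_inf_def vinf_def step_def)
  then have "(AE \<xi> in lborel. f x \<xi> = f_inf (- sqrt ((fst \<xi>)\<^sup>2 - 2 * \<phi> x), snd \<xi>) * step (- fst \<xi>)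
      + f_inf (sqrt ((fst \<xi>)\<^sup>2 - 2 * \<phi> x), snd \<xi>) * step (fst \<xi>))
    \<longleftrightarrow> (AE \<xi> in lborel. f x \<xi> = f_inf (vel_inf (- 2 * \<phi> x) \<xi>))" for x
    by (intro eventually_subst eventually_mono[OF AE_fst_neq[of 0]])
  then show ?thesis unfolding characteristic_formula_def by simp
qed

lemma (in sagdeev) sqrt_profile_derivative:
  assumes "(\<phi> has_real_derivative sqrt (2 * V (\<phi> x))) (at x within S)" "\<phi> x < 0" "V (\<phi> x) > 0"
  shows "((\<lambda>x. sqrt (2 * V (\<phi> x))) has_real_derivative h (\<phi> x)) (at x within S)"
proof -
  have pos: "2 * V (\<phi> x) > 0" using assms(3) by simp
  have "((\<lambda>x. V (\<phi> x)) has_real_derivative h (\<phi> x) * sqrt (2 * V (\<phi> x))) (at x within S)"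
    by (rule DERIV_chain2[OF V_DERIV[OF assms(2)] assms(1)])
  then have "((\<lambda>x. 2 * V (\<phi> x)) has_real_derivative 2 * (h (\<phi> x) * sqrt (2 * V (\<phi> x)))) (at x within S)"
    by (rule DERIV_cmult)
  from DERIV_chain2[OF DERIV_real_sqrt[OF pos] this]
  show ?thesis by (rule DERIV_cong) (use pos in \<open>simp add: field_simps\<close>)
qed

text \<open>
  A decreasing potential that starts at \<open>\<phi>\<^sub>b < 0\<close> cannot tend to \<open>0\<close>.
\<close>

lemma VP_solution_monotone_profile:
  assumes sol: "VP_solution n_e \<alpha> \<phi>_b f_b f_inf f \<phi>" and b: "\<phi>_b < 0"
  shows "monotone_profile \<phi> (deriv_on {0..} \<phi>)" "\<And>x. x \<ge> 0 \<Longrightarrow> deriv_on {0..} \<phi> x > 0"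
proof -
  let ?p = "deriv_on {0..} \<phi>"
  have ck: "\<phi> differentiable_on {0..}" "continuous_on {0..} ?p"
    using sol by (auto simp: VP_solution_def)
  have d: "(\<phi> has_real_derivative ?p x) (at x within {0..})" if "x \<ge> 0" for x
    using has_deriv_on[OF ck(1)] that by simp
  have lim: "(\<phi> \<longlongrightarrow> 0) at_top" and init: "\<phi> 0 = \<phi>_b" using sol by (auto simp: VP_solution_def)
  have "\<not> (\<forall>x\<ge>0. ?p x < 0)"
  proof
    assume n: "\<forall>x\<ge>0. ?p x < 0"
    have "- \<phi> 0 < - \<phi> x" if "x > 0" for x
      using increasing_on_Ici[of 0 "\<lambda>x. - \<phi> x" "\<lambda>x. - ?p x" 0 x] d n that
      by (auto intro: DERIV_minus)
    then have "\<forall>\<^sub>F x in at_top. \<phi> x \<le> \<phi>_b"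
      using init by (intro eventually_mono[OF eventually_gt_at_top[of 0]]) (simp add: less_imp_le)
    then have "0 \<le> \<phi>_b" by (intro tendsto_upperbound[OF lim]) auto
    then show False using b by simp
  qed
  then show pos: "\<And>x. x \<ge> 0 \<Longrightarrow> ?p x > 0" using sol by (auto simp: VP_solution_def)
  have mono: "0 \<le> x \<Longrightarrow> x < y \<Longrightarrow> \<phi> x < \<phi> y" for x y using increasing_on_Ici[OF d pos] .
  show "monotone_profile \<phi> ?p"
    by unfold_locales (use d ck mono increasing_neg_of_tendsto_0[OF mono lim] in auto)
qed

lemma VP_solution_characteristic:
  assumes sol: "VP_solution n_e \<alpha> \<phi>_b f_b f_inf f \<phi>" and b: "\<phi>_b < 0"
    and r: "r > 2" and f_inf: "integrable lborel f_inf" "Lr_loc_L1 r f_inf" and x: "x \<ge> 0"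
  shows "AE \<xi> in lborel. f x \<xi> = f_inf (vel_inf (- 2 * \<phi> x) \<xi>)"
    and "(\<integral>\<xi>. f x \<xi> \<partial>lborel) = \<rho>_minus f_inf (\<phi> x)"
proof -
  interpret monotone_profile \<phi> "deriv_on {0..} \<phi>" by (rule VP_solution_monotone_profile[OF sol b])
  show AE: "AE \<xi> in lborel. f x \<xi> = f_inf (vel_inf (- 2 * \<phi> x) \<xi>)"
    using sol x by (intro characteristic_AE[where r = r] r f_inf) (auto simp: VP_solution_def)
  have [measurable]: "f_inf \<in> borel_measurable borel" using f_inf by auto
  have [measurable]: "f x \<in> borel_measurable borel"
    using sol x by (auto simp: VP_solution_def C_L1_def)
  have "(\<integral>\<xi>. f x \<xi> \<partial>lborel) = (\<integral>\<xi>. f_inf (vel_inf (- 2 * \<phi> x) \<xi>) \<partial>lborel)"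
    by (rule integral_cong_AE) (use AE in auto)
  also have "\<dots> = \<rho>_minus f_inf (\<phi> x)" using neg[OF x] by (simp add: rho_minus_eq)
  finally show "(\<integral>\<xi>. f x \<xi> \<partial>lborel) = \<rho>_minus f_inf (\<phi> x)" .
qed

text \<open>
  Since the density is \<open>\<rho>\<^sup>-(\<phi>)\<close>, Poisson's equation is the profile equation of \<open>V\<close>, and \<open>V\<close> is positive
  on \<open>[\<phi>\<^sub>b, 0)\<close> because \<open>\<phi>\<close> takes every value there.
\<close>

lemma VP_solution_energy:
  assumes sol: "VP_solution n_e \<alpha> \<phi>_b f_b f_inf f \<phi>" and b: "\<phi>_b < 0"
    and r: "r > 2" and f_inf: "integrable lborel f_inf" "Lr_loc_L1 r f_inf"
    and sag: "sagdeev V (\<lambda>t. \<rho>_minus f_inf t - n_e t) h' \<phi>_b"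
  shows "\<And>x. x \<ge> 0 \<Longrightarrow> (\<phi> has_real_derivative sqrt (2 * V (\<phi> x))) (at x within {0..})"
    and "\<And>x. x \<ge> 0 \<Longrightarrow> \<phi> x \<in> {\<phi>_b..<0}"
    and "\<And>t. t \<in> {\<phi>_b..<0} \<Longrightarrow> V t > 0"
proof -
  interpret S: sagdeev V "\<lambda>t. \<rho>_minus f_inf t - n_e t" h' \<phi>_b by (rule sag)
  note pos = VP_solution_monotone_profile(2)[OF sol b]
  interpret monotone_profile \<phi> "deriv_on {0..} \<phi>" by (rule VP_solution_monotone_profile[OF sol b])
  have lim: "(\<phi> \<longlongrightarrow> 0) at_top" and init: "\<phi> 0 = \<phi>_b" using sol by (auto simp: VP_solution_def)
  have ck2: "\<phi> differentiable_on {0<..}" "deriv_on {0<..} \<phi> differentiable_on {0<..}"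
    using sol by (auto simp: VP_solution_def numeral_2_eq_2)
  have ode: "deriv_on {0<..} (deriv_on {0<..} \<phi>) x = (\<integral>\<xi>. f x \<xi> \<partial>lborel) - n_e (\<phi> x)" if "x > 0" for x
    using sol that by (auto simp: VP_solution_def numeral_2_eq_2)
  have p2: "deriv_on {0<..} \<phi> x = deriv_on {0..} \<phi> x" if "x > 0" for x
  proof (rule deriv_on_eqI[where y = "x + 1"])
    show "(\<phi> has_real_derivative deriv_on {0..} \<phi> x) (at x within {0<..})"
      using d[of x] that by (auto intro: has_field_derivative_subset)
  qed (use that in auto)
  have pd: "(deriv_on {0..} \<phi> has_real_derivative \<rho>_minus f_inf (\<phi> x) - n_e (\<phi> x)) (at x)" if x: "x > 0" for x
  proof -
    have "(deriv_on {0<..} \<phi> has_real_derivative deriv_on {0<..} (deriv_on {0<..} \<phi>) x) (at x within {0<..})"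
      using has_deriv_on[OF ck2(2)] x by simp
    then have "(deriv_on {0<..} \<phi> has_real_derivative \<rho>_minus f_inf (\<phi> x) - n_e (\<phi> x)) (at x)"
      unfolding ode[OF x] VP_solution_characteristic(2)[OF sol b r f_inf less_imp_le[OF x]]
      using x by (simp add: at_within_open[of x "{0<..}"])
    then show ?thesis
      by (rule has_field_derivative_transform_within_open[where S = "{0<..}"]) (use x p2 in auto)
  qed
  have E: "deriv_on {0..} \<phi> x = sqrt (2 * V (\<phi> x))" "V (\<phi> x) > 0" if "x \<ge> 0" for x
    by (rule S.energy_identity[OF d pc pd pos lim that]; assumption)+
  show "(\<phi> has_real_derivative sqrt (2 * V (\<phi> x))) (at x within {0..})" if "x \<ge> 0" for x
    using d[OF that] E(1)[OF that] by simp
  show rng: "\<phi> x \<in> {\<phi>_b..<0}" if "x \<ge> 0" for x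
    using neg[OF that] mono[of 0 x] that init by (cases "x = 0") auto
  show "V t > 0" if t: "t \<in> {\<phi>_b..<0}" for t
  proof -
    have "\<forall>\<^sub>F x in at_top. \<phi> x > t" using t by (intro order_tendstoD(1)[OF lim]) auto
    then obtain X where X: "\<And>x. x \<ge> X \<Longrightarrow> \<phi> x > t" unfolding eventually_at_top_linorder by blast
    have "\<exists>x. 0 \<le> x \<and> x \<le> max 0 X \<and> \<phi> x = t"
      using X[of "max 0 X"] t init by (intro IVT' continuous_on_subset[OF \<phi>_cont]) auto
    then show ?thesis using E(2) by auto
  qed
qed

lemma exp_decay_of_profile:
  assumes sag: "sagdeev V h h' b" and a: "h' 0 > 0" and pos: "\<And>t. t \<in> {b..<0} \<Longrightarrow> V t > 0"
    and d: "\<And>x. x \<ge> 0 \<Longrightarrow> (\<phi> has_real_derivative sqrt (2 * V (\<phi> x))) (at x within {0..})"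
    and rng: "\<And>x. x \<ge> 0 \<Longrightarrow> \<phi> x \<in> {b..<0}" and init: "\<phi> 0 = b"
  shows "exp_decay \<phi>"
proof -
  interpret sagdeev V h h' b by (rule sag)
  have 1: "deriv_on {0..} \<phi> x = sqrt (2 * V (\<phi> x))" if "x \<ge> 0" for x
    using d[OF that] that by (intro deriv_on_eqI[where y = "x + 1"]) auto
  have 2: "deriv_on {0..} (deriv_on {0..} \<phi>) x = h (\<phi> x)" if x: "x \<ge> 0" for x
  proof (rule deriv_on_eqI[where y = "x + 1"])
    have "((\<lambda>x. sqrt (2 * V (\<phi> x))) has_real_derivative h (\<phi> x)) (at x within {0..})"
      using d[OF x] rng[OF x] pos by (intro sqrt_profile_derivative) auto
    then show "(deriv_on {0..} \<phi> has_real_derivative h (\<phi> x)) (at x within {0..})"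
      by (rule has_field_derivative_transform_within[where d = 1]) (use 1 x in auto)
  qed (use x in auto)
  obtain c C where "c > 0" "C > 0" and est: "\<And>x. x \<ge> 0 \<Longrightarrow> \<bar>\<phi> x\<bar> \<le> C * exp (- c * x)
      \<and> sqrt (2 * V (\<phi> x)) \<le> C * exp (- c * x) \<and> \<bar>h (\<phi> x)\<bar> \<le> C * exp (- c * x)"
    using exponential_decay[OF a pos d rng init] by blast
  have "\<forall>l\<in>{0, 1, 2}. \<forall>x\<ge>0. \<bar>(deriv_on {0..} ^^ l) \<phi> x\<bar> \<le> C * exp (- c * x)"
  proof (intro ballI allI impI)
    fix l :: nat and x :: real assume l: "l \<in> {0, 1, 2}" and x: "x \<ge> 0"
    have "V (\<phi> x) > 0" using rng[OF x] pos by blast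
    then have "\<bar>sqrt (2 * V (\<phi> x))\<bar> \<le> C * exp (- c * x)" using est[OF x] by simp
    moreover have "l = 0 \<or> l = Suc 0 \<or> l = Suc (Suc 0)" using l by auto
    ultimately show "\<bar>(deriv_on {0..} ^^ l) \<phi> x\<bar> \<le> C * exp (- c * x)"
      using est[OF x] by (auto simp: 1[OF x] 2[OF x])
  qed
  then show ?thesis unfolding exp_decay_def using \<open>c > 0\<close> \<open>C > 0\<close> by blast
qed

text \<open>
  The pair consists of the profile for \<open>V\<close> and the density transported along it.
\<close>

lemma VP_solution_exists:
  assumes b: "\<phi>_b < 0"
    and fb: "set_integrable lborel half_space f_b"
    and r: "r > 2" and f_inf: "integrable lborel f_inf" "Lr_loc_L1 r f_inf" "AE \<xi> in lborel. f_inf \<xi> \<ge> 0"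
    and outer: "AE \<xi> in lborel. fst \<xi> > sqrt (2 * \<bar>\<phi>_b\<bar>) \<longrightarrow>
        f_inf \<xi> = f_b (sqrt ((fst \<xi>)\<^sup>2 + 2 * \<phi>_b), snd \<xi>) + \<alpha> * f_inf (- fst \<xi>, snd \<xi>)"
    and inner: "AE \<xi> in lborel. - sqrt (2 * \<bar>\<phi>_b\<bar>) < fst \<xi> \<and> fst \<xi> < sqrt (2 * \<bar>\<phi>_b\<bar>) \<longrightarrow>
        f_inf \<xi> = f_inf (- fst \<xi>, snd \<xi>)"
    and sag: "sagdeev V (\<lambda>t. \<rho>_minus f_inf t - n_e t) h' \<phi>_b"
    and pos: "\<And>t. t \<in> {\<phi>_b..<0} \<Longrightarrow> V t > 0"
  shows "\<exists>f \<phi>. VP_solution n_e \<alpha> \<phi>_b f_b f_inf f \<phi>"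
proof -
  let ?h = "\<lambda>t. \<rho>_minus f_inf t - n_e t"
  interpret S: sagdeev V ?h h' \<phi>_b by (rule sag)
  obtain \<phi> where \<phi>: "continuous_on UNIV \<phi>" "\<phi> 0 = \<phi>_b" "\<And>x. \<phi> x \<in> {\<phi>_b..<0}"
    "\<And>x. x \<ge> 0 \<Longrightarrow> (\<phi> has_real_derivative sqrt (2 * V (\<phi> x))) (at x within {0..})"
    "(\<phi> \<longlongrightarrow> 0) at_top" using S.profile_exists[OF pos] by blast
  let ?p = "\<lambda>x. sqrt (2 * V (\<phi> x))"
  have Vp: "V (\<phi> x) > 0" for x using pos \<phi>(3) by blast
  have phi_neg: "\<phi> x < 0" for x using \<phi>(3)[of x] by simp
  have p_cont: "continuous_on A ?p" for A
    using phi_neg by (intro continuous_intros continuous_on_compose2[OF S.V_cont continuous_on_subset[OF \<phi>(1)]]) (auto simp: less_imp_le)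
  have pp: "?p x > 0" for x using Vp[of x] by simp
  have phi_mono: "0 \<le> x \<Longrightarrow> x < y \<Longrightarrow> \<phi> x < \<phi> y" for x y
    by (rule increasing_on_Ici[OF \<phi>(4) pp])
  interpret monotone_profile \<phi> ?p
    by unfold_locales (use \<phi>(4) p_cont phi_neg phi_mono in blast)+
  have \<phi>ge: "\<phi> 0 \<le> \<phi> x" for x using \<phi>(2) \<phi>(3)[of x] by simp
  note ctx = \<phi>(1) phi_neg \<phi>ge \<phi>(5) r f_inf(1,2)
  let ?f = "transported f_inf"
  have transported_def': "?f x \<xi> = f_inf (vel_inf (- 2 * \<phi> x) \<xi>)" for x \<xi> by (rule transported_def[OF ctx])
  have DI: "(\<phi> has_real_derivative ?p x) (at x within {0<..})" if "x > 0" for x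
    using \<phi>(4)[of x] that by (auto intro: has_field_derivative_subset)
  have p2: "deriv_on {0<..} \<phi> x = ?p x" if "x > 0" for x
    using DI[OF that] that by (intro deriv_on_eqI[where y = "x + 1"]) auto
  have DI2: "(deriv_on {0<..} \<phi> has_real_derivative ?h (\<phi> x)) (at x within {0<..})" if x: "x > 0" for x
    by (rule has_field_derivative_transform_within[OF S.sqrt_profile_derivative[OF DI[OF x] phi_neg Vp], where d = 1])
       (use p2 x in auto)
  have p3: "deriv_on {0<..} (deriv_on {0<..} \<phi>) x = ?h (\<phi> x)" if "x > 0" for x
    using DI2[OF that] that by (intro deriv_on_eqI[where y = "x + 1"]) auto
  have [measurable]: "f_inf \<in> borel_measurable borel" using f_inf by auto
  have "VP_solution n_e \<alpha> \<phi>_b f_b f_inf ?f \<phi>"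
    unfolding VP_solution_def
  proof (intro conjI)
    show "L1_loc ({0..} \<times> UNIV) (\<lambda>(x, \<xi>). ?f x \<xi>)" by (rule transported_L1_loc[OF ctx])
    show "C_L1 ?f" by (rule transported_C_L1[OF ctx])
    have "\<phi> differentiable_on {0..}"
      unfolding differentiable_on_def using \<phi>(4) real_differentiable_def by (metis atLeast_iff)
    moreover have "continuous_on {0..} (deriv_on {0..} \<phi>)"
      by (rule continuous_on_eq[OF p_cont]) (simp add: p_eq)
    ultimately show "Ck_on 1 {0..} \<phi>" by simp
    have "\<phi> differentiable_on {0<..}"
      unfolding differentiable_on_def using DI real_differentiable_def by (metis greaterThan_iff)
    moreover have "deriv_on {0<..} \<phi> differentiable_on {0<..}"
      unfolding differentiable_on_def using DI2 real_differentiable_def by (metis greaterThan_iff)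
    moreover have "continuous_on {0<..} (deriv_on {0<..} (deriv_on {0<..} \<phi>))"
    proof -
      have "continuous_on {0<..} (\<lambda>x. ?h (\<phi> x))"
        using phi_neg by (intro continuous_on_compose2[OF S.h_cont continuous_on_subset[OF \<phi>(1)]]) (auto simp: less_imp_le)
      then show ?thesis by (rule continuous_on_eq) (simp add: p3)
    qed
    ultimately show "Ck_on 2 {0<..} \<phi>" by (simp add: numeral_2_eq_2)
    show "\<forall>x\<ge>0. AE \<xi> in lborel. 0 \<le> ?f x \<xi>"
      unfolding transported_def' using phi_neg f_inf(3) by (intro allI impI AE_comp_vel_inf) (auto simp: less_imp_le)
    show "(\<forall>x\<ge>0. deriv_on {0..} \<phi> x > 0) \<or> (\<forall>x\<ge>0. deriv_on {0..} \<phi> x < 0)"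
      using p_eq Vp by simp
    show "weak_Vlasov \<alpha> f_b ?f \<phi>"
    proof (rule transported_weak[OF ctx fb])
      show "AE \<xi> in lborel. (fst \<xi>)\<^sup>2 > - 2 * \<phi> 0 \<and> fst \<xi> > 0 \<longrightarrow>
        f_inf \<xi> = f_b (sqrt ((fst \<xi>)\<^sup>2 + 2 * \<phi> 0), snd \<xi>) + \<alpha> * f_inf (reflect \<xi>)"
        using outer
      proof eventually_elim
        case (elim \<xi>)
        have "sqrt (2 * \<bar>\<phi>_b\<bar>) < fst \<xi>" if "(fst \<xi>)\<^sup>2 > - 2 * \<phi> 0" "fst \<xi> > 0"
          using that b \<phi>(2) by (intro real_less_lsqrt) auto
        then show ?case using elim by (simp add: \<phi>(2) reflect_def)
      qed
      show "AE \<xi> in lborel. (fst \<xi>)\<^sup>2 < - 2 * \<phi> 0 \<longrightarrow> f_inf \<xi> = f_inf (reflect \<xi>)"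
        using inner
      proof eventually_elim
        case (elim \<xi>)
        have "\<bar>fst \<xi>\<bar> < sqrt (2 * \<bar>\<phi>_b\<bar>)" if "(fst \<xi>)\<^sup>2 < - 2 * \<phi> 0"
          using that b \<phi>(2) by (intro real_less_rsqrt) auto
        then show ?case using elim by (auto simp: reflect_def abs_less_iff)
      qed
    qed
    show "((\<lambda>x. \<integral>\<xi>. \<bar>?f x \<xi> - f_inf \<xi>\<bar> \<partial>lborel) \<longlongrightarrow> 0) at_top" by (rule transported_at_top[OF ctx])
    show "\<forall>x>0. (deriv_on {0<..} ^^ 2) \<phi> x = (\<integral>\<xi>. ?f x \<xi> \<partial>lborel) - n_e (\<phi> x)"
      using p3 phi_neg by (auto simp: numeral_2_eq_2 transported_def' rho_minus_eq less_imp_le)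
    show "\<phi> 0 = \<phi>_b" by (rule \<phi>(2))
    show "(\<phi> \<longlongrightarrow> 0) at_top" by (rule \<phi>(5))
  qed
  then show ?thesis by blast
qed

text \<open>
  Strict inequality corresponds to positivity up to and including \<open>b\<close>, which extends to the left of \<open>b\<close> by
  continuity of \<open>V\<close>.
\<close>

lemma INF_B_minus_less_iff:
  assumes sag: "sagdeev (V_minus n_e f_inf) h h' b"
  shows "ereal b > (INF c\<in>B_minus n_e f_inf. ereal c) \<longleftrightarrow> (\<forall>t\<in>{b..<0}. V_minus n_e f_inf t > 0)"
proof -
  interpret sagdeev "V_minus n_e f_inf" h h' b by (rule sag)
  have "ereal b > (INF c\<in>B_minus n_e f_inf. ereal c) \<longleftrightarrow> (\<exists>c\<in>B_minus n_e f_inf. c < b)"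
    by (simp add: INF_less_iff)
  also have "\<dots> \<longleftrightarrow> (\<forall>t\<in>{b..<0}. V_minus n_e f_inf t > 0)"
  proof
    assume "\<exists>c\<in>B_minus n_e f_inf. c < b"
    then show "\<forall>t\<in>{b..<0}. V_minus n_e f_inf t > 0" by (auto simp: B_minus_def)
  next
    assume "\<forall>t\<in>{b..<0}. V_minus n_e f_inf t > 0"
    then obtain c where "c < b" "\<forall>t\<in>{c..<0}. V_minus n_e f_inf t > 0" using positive_extends by blast
    then show "\<exists>c\<in>B_minus n_e f_inf. c < b" using b0 by (intro bexI[of _ c]) (auto simp: B_minus_def)
  qed
  finally show ?thesis .
qed

theorem theorem2p6:
  fixes n_e :: "real \<Rightarrow> real" and \<alpha> \<phi>_b r :: real
    and f_b f_inf :: "vel \<Rightarrow> real"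
  assumes ne: "Ck_on 2 UNIV n_e" "n_e 0 = 1" "deriv n_e 0 = - 1"
    and phib: "\<phi>_b < 0" and alpha: "0 \<le> \<alpha>" "\<alpha> \<le> 1"
    and fb: "set_integrable lborel half_space f_b"
            "AE \<xi> in lborel. \<xi> \<in> half_space \<longrightarrow> f_b \<xi> \<ge> 0"
    and r: "r > 2"
    and finfty: "integrable lborel f_inf" "Lr_loc_L1 r f_inf" "AE \<xi> in lborel. f_inf \<xi> \<ge> 0"
    and mass: "(\<integral>\<xi>. f_inf \<xi> \<partial>lborel) = 1"
    and outer: "AE \<xi> in lborel. fst \<xi> > sqrt (2 * \<bar>\<phi>_b\<bar>) \<longrightarrow>
        f_inf \<xi> = f_b (sqrt ((fst \<xi>)\<^sup>2 + 2 * \<phi>_b), snd \<xi>) + \<alpha> * f_inf (- fst \<xi>, snd \<xi>)"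
    and inner: "AE \<xi> in lborel. - sqrt (2 * \<bar>\<phi>_b\<bar>) < fst \<xi> \<and> fst \<xi> < sqrt (2 * \<bar>\<phi>_b\<bar>) \<longrightarrow>
        f_inf \<xi> = f_inf (- fst \<xi>, snd \<xi>)"
    and V_C2: "Ck_on 2 {\<phi>_b..0} (V_minus n_e f_inf)"
  shows
    "((deriv_on {\<phi>_b..0} ^^ 2) (V_minus n_e f_inf) 0 > 0 \<longrightarrow>
        B_minus n_e f_inf \<noteq> {} \<and>
        (ereal \<phi>_b > (INF b\<in>B_minus n_e f_inf. ereal b) \<longleftrightarrow> VP_unique_solution n_e \<alpha> \<phi>_b f_b f_inf) \<and>
        (\<forall>f \<phi>. VP_solution n_e \<alpha> \<phi>_b f_b f_inf f \<phi> \<longrightarrow>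
           exp_decay \<phi> \<and>
           characteristic_formula f_inf f \<phi>)) \<and>
     ((deriv_on {\<phi>_b..0} ^^ 2) (V_minus n_e f_inf) 0 = 0 \<and> B_minus n_e f_inf \<noteq> {} \<longrightarrow>
        (ereal \<phi>_b > (INF b\<in>B_minus n_e f_inf. ereal b) \<longleftrightarrow> VP_unique_solution n_e \<alpha> \<phi>_b f_b f_inf) \<and>
        (\<forall>f \<phi>. VP_solution n_e \<alpha> \<phi>_b f_b f_inf f \<phi> \<longrightarrow> characteristic_formula f_inf f \<phi>)) \<and>
     ((deriv_on {\<phi>_b..0} ^^ 2) (V_minus n_e f_inf) 0 = 0 \<and> B_minus n_e f_inf = {} \<longrightarrow>
        (\<nexists>f \<phi>. VP_solution n_e \<alpha> \<phi>_b f_b f_inf f \<phi>)) \<and>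
     ((deriv_on {\<phi>_b..0} ^^ 2) (V_minus n_e f_inf) 0 < 0 \<longrightarrow>
        (\<nexists>f \<phi>. VP_solution n_e \<alpha> \<phi>_b f_b f_inf f \<phi>))"
proof -
  let ?V = "V_minus n_e f_inf" and ?h = "\<lambda>t. \<rho>_minus f_inf t - n_e t" and ?S = "{\<phi>_b..0}"
  define h' where "h' = deriv_on ?S (deriv_on ?S ?V)"
  have [measurable]: "f_inf \<in> borel_measurable borel" using finfty by auto
  have sag: "sagdeev ?V ?h h' \<phi>_b"
  proof
    have "continuous_on UNIV n_e"
      using ne(1) by (auto simp: numeral_2_eq_2 intro: differentiable_imp_continuous_on)
    then show hc: "continuous_on {..0} ?h"
      by (intro continuous_intros continuous_rho_minus[OF r finfty(1,2)]) (auto intro: continuous_on_subset)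
    show Vd: "(?V has_real_derivative ?h t) (at t within {..0})" if "t \<le> 0" for t
      using hc that by (rule V_minus_derivative)
    show "?V 0 = 0" by (simp add: V_minus_def zero_ereal_def[symmetric])
    show "?h 0 = 0" by (simp add: rho_minus_0 mass ne(2))
    show "\<phi>_b < 0" by (rule phib)
    have V1: "deriv_on ?S ?V t = ?h t" if "t \<in> ?S" for t
    proof (rule deriv_on_eqI[where y = "if t = 0 then \<phi>_b else 0"])
      show "(?V has_real_derivative ?h t) (at t within ?S)"
        using that by (intro has_field_derivative_subset[OF Vd]) auto
    qed (use that phib in auto)
    have dd: "deriv_on ?S ?V differentiable_on ?S" "continuous_on ?S h'"
      using V_C2 by (auto simp: numeral_2_eq_2 h'_def)
    then show "continuous_on ?S h'" by simp
    show "(?h has_real_derivative h' t) (at t within ?S)" if t: "t \<in> ?S" for t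
      using has_deriv_on[OF dd(1) t] unfolding h'_def
      by (rule has_field_derivative_transform_within[where d = 1]) (use V1 t in auto)
  qed
  interpret S: sagdeev ?V ?h h' \<phi>_b by (rule sag)
  have h'0: "(deriv_on ?S ^^ 2) ?V 0 = h' 0" by (simp add: numeral_2_eq_2 h'_def)
  let ?pos = "\<forall>t\<in>{\<phi>_b..<0}. ?V t > 0"
  have sol: "?pos" "\<forall>x\<ge>0. (\<phi> has_real_derivative sqrt (2 * ?V (\<phi> x))) (at x within {0..})"
      "\<forall>x\<ge>0. \<phi> x \<in> {\<phi>_b..<0}" "\<phi> 0 = \<phi>_b"
      "\<forall>x\<ge>0. AE \<xi> in lborel. f x \<xi> = f_inf (vel_inf (- 2 * \<phi> x) \<xi>)"
    if s: "VP_solution n_e \<alpha> \<phi>_b f_b f_inf f \<phi>" for f \<phi>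
  proof -
    note E = VP_solution_energy[OF s phib r finfty(1,2) sag]
    show "?pos" using E(3) by blast
    show "\<forall>x\<ge>0. (\<phi> has_real_derivative sqrt (2 * ?V (\<phi> x))) (at x within {0..})" using E(1) by blast
    show "\<forall>x\<ge>0. \<phi> x \<in> {\<phi>_b..<0}" using E(2) by blast
    show "\<phi> 0 = \<phi>_b" using s by (simp add: VP_solution_def)
    show "\<forall>x\<ge>0. AE \<xi> in lborel. f x \<xi> = f_inf (vel_inf (- 2 * \<phi> x) \<xi>)"
      using VP_solution_characteristic(1)[OF s phib r finfty(1,2)] by blast
  qed
  have char: "characteristic_formula f_inf f \<phi>" if "VP_solution n_e \<alpha> \<phi>_b f_b f_inf f \<phi>" for f \<phi>
    unfolding characteristic_formula_iff using sol(5)[OF that] .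
  have unique: "same_solution f \<phi> g \<eta>"
    if s1: "VP_solution n_e \<alpha> \<phi>_b f_b f_inf f \<phi>" and s2: "VP_solution n_e \<alpha> \<phi>_b f_b f_inf g \<eta>" for f \<phi> g \<eta>
    unfolding same_solution_def
  proof (intro allI impI)
    fix x :: real assume x: "x \<ge> 0"
    have eq: "\<phi> x = \<eta> x"
      by (rule S.profile_unique[OF sol(1)[OF s1, rule_format] sol(2)[OF s1, rule_format]
            sol(2)[OF s2, rule_format] sol(3)[OF s1, rule_format] sol(3)[OF s2, rule_format]
            sol(4)[OF s1] sol(4)[OF s2] x])
    have "AE \<xi> in lborel. f x \<xi> = f_inf (vel_inf (- 2 * \<phi> x) \<xi>)"
      "AE \<xi> in lborel. g x \<xi> = f_inf (vel_inf (- 2 * \<eta> x) \<xi>)"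
      using sol(5)[OF s1] sol(5)[OF s2] x by auto
    then have "AE \<xi> in lborel. f x \<xi> = g x \<xi>" by eventually_elim (simp add: eq)
    then show "(AE \<xi> in lborel. f x \<xi> = g x \<xi>) \<and> \<phi> x = \<eta> x" using eq by blast
  qed
  have ex: "\<exists>f \<phi>. VP_solution n_e \<alpha> \<phi>_b f_b f_inf f \<phi>" if "?pos"
    using that by (intro VP_solution_exists[OF phib fb(1) r finfty outer inner sag]) blast
  have iff: "ereal \<phi>_b > (INF b\<in>B_minus n_e f_inf. ereal b) \<longleftrightarrow> VP_unique_solution n_e \<alpha> \<phi>_b f_b f_inf"
    unfolding INF_B_minus_less_iff[OF sag] VP_unique_solution_def using ex unique sol(1) by blast
  have decay: "exp_decay \<phi>" if "h' 0 > 0" "VP_solution n_e \<alpha> \<phi>_b f_b f_inf f \<phi>" for f \<phi>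
    by (rule exp_decay_of_profile[OF sag that(1) sol(1)[OF that(2), rule_format]
          sol(2)[OF that(2), rule_format] sol(3)[OF that(2), rule_format] sol(4)[OF that(2)]])
  have B_ne: "B_minus n_e f_inf \<noteq> {}" if a: "h' 0 > 0"
  proof -
    obtain \<epsilon> where e: "\<epsilon> > 0" "\<And>t. t \<in> {-\<epsilon>..0} \<Longrightarrow> ?V t \<ge> h' 0 / 4 * t\<^sup>2"
      using S.quadratic_lower_near_0[OF a] by blast
    have "?V t > 0" if t: "t \<in> {-\<epsilon>..<0}" for t
    proof -
      have "h' 0 / 4 * t\<^sup>2 > 0" using a t by (intro mult_pos_pos) auto
      then show ?thesis using e(2)[of t] t by simp
    qed
    then have "- \<epsilon> \<in> B_minus n_e f_inf" using e(1) by (simp add: B_minus_def)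
    then show ?thesis by blast
  qed
  have no_empty: "\<nexists>f \<phi>. VP_solution n_e \<alpha> \<phi>_b f_b f_inf f \<phi>" if "B_minus n_e f_inf = {}"
  proof -
    have "\<not> ?pos" using that phib by (auto simp: B_minus_def)
    then show ?thesis using sol(1) by blast
  qed
  have no_neg: "\<nexists>f \<phi>. VP_solution n_e \<alpha> \<phi>_b f_b f_inf f \<phi>" if "h' 0 < 0"
  proof -
    have "\<not> ?pos" using S.negative_near_0[OF that] by force
    then show ?thesis using sol(1) by blast
  qed
  show ?thesis unfolding h'0 using iff decay char B_ne no_empty no_neg by blast
qed

end
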